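(* For the two-user IM/DD interference channel, the capacity region satisfies $\mathcal{G}'_{\rm TIN}\subseteq\mathcal{G}$, where $$\mathcal{G}'_{\rm TIN}={\rm Conv}\Bigg(\bigcup_{\substack{\kappa_i\in[0,\mathsf{A}],\ \theta_i\in(0,1],\\ \theta_i\kappa_i\in[0,\alpha_i\mathsf{A}],\ i=1,2}}\mathcal{R}'_{\rm TIN}(\boldsymbol{\kappa},\boldsymbol{\theta})\Bigg),$$ with $\boldsymbol{\kappa}=(\kappa_1,\kappa_2)$, $\boldsymbol{\theta}=(\theta_1,\theta_2)$ and $$\mathcal{R}'_{\rm TIN}(\boldsymbol{\kappa},\boldsymbol{\theta})=\Big\{(\mathsf{R}_1,\mathsf{R}_2)\in\mathbb{R}_+^2:\ \mathsf{R}_i\le\mathsf{F}(0,h_{ii}\kappa_i,h_{ji}\kappa_j,1,\theta_i,\theta_j),\ i,j\in\{1,2\},\ i\neq j\Big\}.$$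
   Context: Two-user IM/DD interference channel: for $i,j\in\{1,2\}$, $i\neq j$, $Y_i=h_{ii}X_i+h_{ji}X_j+Z_i$, with channel gains $h_{kl}\ge0$, noises $Z_1,Z_2\sim\mathcal{N}(0,\sigma^2)$ ($\sigma>0$) i.i.d. over time and independent of inputs; inputs satisfy $X_i\in[0,\mathsf{A}]$ ($\mathsf{A}>0$) and $\mathbb{E}[X_i]\le\alpha_i\mathsf{A}$, $\alpha_i\in(0,1]$. Transmitter $i$ encodes $m_i\in\{1,\dots,\lceil2^{n\mathsf{R}_i}\rceil\}$ into a length-$n$ codeword satisfying these constraints; receiver $i$ decodes $m_i$ from $Y_i^n$; $(\mathsf{R}_1,\mathsf{R}_2)$ is achievable if both average error probabilities tend to $0$ as $n\to\infty$; $\mathcal{G}$ is the closure of achievable pairs. ${\rm Conv}$ denotes convex hull. Logs base 2, $\mathcal{Q}(x)=\int_x^\infty\frac{1}{\sqrt{2\pi}}e^{-t^2/2}dt$. $\rho(\alpha)$: for $\alpha\in(0,\frac12)$, $\rho(\alpha)=\frac{e^{2\alpha\mu^*-1}}{2\pi}\big(\frac{1-e^{-\mu^*}}{\mu^*}\big)^2$ with $\mu^*$ the unique positive solution of $\alpha=\frac{1}{\mu^*}-\frac{e^{-\mu^*}}{1-e^{-\mu^*}}$; for $\alpha\in[\frac12,1]$, $\rho(\alpha)=\frac{1}{2\pi e}$. $\overline{\mathsf{C}}(\mathsf{A},\alpha)=c_1$ if $\alpha\in(0,\frac12)$, $=c_2$ if $\alpha\in[\frac12,1]$, where $$c_1=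\min_{\mu,\xi>0}\Big[1-\mathcal{Q}\big(\tfrac{\xi+\alpha\mathsf{A}}{\sigma}\big)-\mathcal{Q}\big(\tfrac{\xi+(1-\alpha)\mathsf{A}}{\sigma}\big)\Big]\log\Big(\frac{\mathsf{A}}{\sigma}\frac{e^{\mu\xi/\mathsf{A}}-e^{-\mu(1+\xi/\mathsf{A})}}{\sqrt{2\pi}\mu(1-2\mathcal{Q}(\xi/\sigma))}\Big)+\log(e)\Big[-\tfrac12+\mathcal{Q}\big(\tfrac{\xi}{\sigma}\big)+\tfrac{\xi}{\sqrt{2\pi}\sigma}e^{-\frac{\xi^2}{2\sigma^2}}+\tfrac{\sigma}{\mathsf{A}}\tfrac{\mu}{\sqrt{2\pi}}\big(e^{-\frac{\xi^2}{2\sigma^2}}-e^{-\frac{(\mathsf{A}+\xi)^2}{2\sigma^2}}\big)+\mu\alpha\big(1-2\mathcal{Q}\big(\tfrac{\xi+\mathsf{A}/2}{\sigma}\big)\big)\Big],$$ $$c_2=\min_{\xi>0}\Big[1-2\mathcal{Q}\big(\tfrac{\xi+\mathsf{A}/2}{\sigma}\big)\Big]\log\Big(\frac{\mathsf{A}+2\xi}{\sigma\sqrt{2\pi}(1-2\mathcal{Q}(\xi/\sigma))}\Big)+\log(e)\Big[-\tfrac12+\mathcal{Q}\big(\tfrac{\xi}{\sigma}\big)+\tfrac{\xi}{\sqrt{2\pi}\sigma}e^{-\frac{\xi^2}{2\sigma^2}}\Big].$$ $\mathsf{F}(a_1,a_2,a_3,\theta_1,\theta_2,\theta_3)=\frac12\log\Big(1+\frac{\rho(\theta_1)a_1^2+\rho(\theta_2)a_2^2}{\sigma^2\,2^{2\overline{\mathsf{C}}(a_3,\theta_3)}}\Big)$.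 *)

theory Defs
  imports "HOL-Probability.Probability"
begin

definition Qf :: "real \<Rightarrow> real" where
  "Qf x = integral {x..} (\<lambda>t. exp (- (t\<^sup>2) / 2) / sqrt (2 * pi))"

definition rho :: "real \<Rightarrow> real" where
  "rho \<alpha> = (if \<alpha> < 1/2 then
      (let \<mu> = (THE \<mu>. \<mu> > 0 \<and> \<alpha> = 1/\<mu> - exp (-\<mu>) / (1 - exp (-\<mu>)))
       in exp (2 * \<alpha> * \<mu> - 1) / (2 * pi) * ((1 - exp (-\<mu>)) / \<mu>)\<^sup>2)
    else 1 / (2 * pi * exp 1))"

definition c1_expr :: "real \<Rightarrow> real \<Rightarrow> real \<Rightarrow> real \<Rightarrow> real \<Rightarrow> real" where
  "c1_expr \<sigma> A \<alpha> \<mu> \<xi> =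
     (1 - Qf ((\<xi> + \<alpha> * A) / \<sigma>) - Qf ((\<xi> + (1 - \<alpha>) * A) / \<sigma>))
       * log 2 (A / \<sigma> * (exp (\<mu> * \<xi> / A) - exp (- \<mu> * (1 + \<xi> / A)))
                 / (sqrt (2 * pi) * \<mu> * (1 - 2 * Qf (\<xi> / \<sigma>))))
     + log 2 (exp 1) *
       (- 1/2 + Qf (\<xi> / \<sigma>) + \<xi> / (sqrt (2 * pi) * \<sigma>) * exp (- (\<xi>\<^sup>2) / (2 * \<sigma>\<^sup>2))
        + \<sigma> / A * \<mu> / sqrt (2 * pi) * (exp (- (\<xi>\<^sup>2) / (2 * \<sigma>\<^sup>2)) - exp (- ((A + \<xi>)\<^sup>2) / (2 * \<sigma>\<^sup>2)))
        + \<mu> * \<alpha> * (1 - 2 * Qf ((\<xi> + A / 2) / \<sigma>)))"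

definition c2_expr :: "real \<Rightarrow> real \<Rightarrow> real \<Rightarrow> real" where
  "c2_expr \<sigma> A \<xi> =
     (1 - 2 * Qf ((\<xi> + A / 2) / \<sigma>))
       * log 2 ((A + 2 * \<xi>) / (\<sigma> * sqrt (2 * pi) * (1 - 2 * Qf (\<xi> / \<sigma>))))
     + log 2 (exp 1) *
       (- 1/2 + Qf (\<xi> / \<sigma>) + \<xi> / (sqrt (2 * pi) * \<sigma>) * exp (- (\<xi>\<^sup>2) / (2 * \<sigma>\<^sup>2)))"

definition Cbar :: "real \<Rightarrow> real \<Rightarrow> real \<Rightarrow> real" where
  "Cbar \<sigma> A \<alpha> = (if A = 0 then 0
     else if \<alpha> < 1/2 then Inf {c1_expr \<sigma> A \<alpha> \<mu> \<xi> | \<mu> \<xi>. \<mu> > 0 \<and> \<xi> > 0}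
     else Inf {c2_expr \<sigma> A \<xi> | \<xi>. \<xi> > 0})"

definition Ffun :: "real \<Rightarrow> real \<Rightarrow> real \<Rightarrow> real \<Rightarrow> real \<Rightarrow> real \<Rightarrow> real \<Rightarrow> real" where
  "Ffun \<sigma> a1 a2 a3 \<theta>1 \<theta>2 \<theta>3 =
     1/2 * log 2 (1 + (rho \<theta>1 * a1\<^sup>2 + rho \<theta>2 * a2\<^sup>2) / (\<sigma>\<^sup>2 * 2 powr (2 * Cbar \<sigma> a3 \<theta>3)))"

definition num_msgs :: "nat \<Rightarrow> real \<Rightarrow> nat" where
  "num_msgs n R = nat \<lceil>2 powr (real n * R)\<rceil>"

definition admissible_codebook :: "real \<Rightarrow> real \<Rightarrow> nat \<Rightarrow> nat \<Rightarrow> (nat \<Rightarrow> nat \<Rightarrow> real) \<Rightarrow> bool" where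
  "admissible_codebook A \<alpha> n M x \<longleftrightarrow>
     (\<forall>m\<in>{1..M}. (\<forall>k<n. 0 \<le> x m k \<and> x m k \<le> A) \<and> (\<Sum>k<n. x m k) \<le> real n * (\<alpha> * A))"

definition noise :: "real \<Rightarrow> nat \<Rightarrow> (nat \<Rightarrow> real) measure" where
  "noise \<sigma> n = PiM {..<n} (\<lambda>_. density lborel (normal_density 0 \<sigma>))"

definition err_prob :: "real \<Rightarrow> nat \<Rightarrow> real \<Rightarrow> real \<Rightarrow> nat \<Rightarrow> nat \<Rightarrow>
    (nat \<Rightarrow> nat \<Rightarrow> real) \<Rightarrow> (nat \<Rightarrow> nat \<Rightarrow> real) \<Rightarrow> ((nat \<Rightarrow> real) \<Rightarrow> nat) \<Rightarrow> real" where
  "err_prob \<sigma> n hdir hcross M M' x x' g =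
     (\<Sum>m\<in>{1..M}. \<Sum>m'\<in>{1..M'}.
        measure (noise \<sigma> n)
          {z \<in> space (noise \<sigma> n). g (\<lambda>k\<in>{..<n}. hdir * x m k + hcross * x' m' k + z k) \<noteq> m})
     / (real M * real M')"

definition achievable ::
  "real \<Rightarrow> real \<Rightarrow> real \<Rightarrow> real \<Rightarrow> real \<Rightarrow> real \<Rightarrow> real \<Rightarrow> real \<Rightarrow> real \<times> real \<Rightarrow> bool" where
  "achievable h11 h12 h21 h22 \<sigma> A \<alpha>1 \<alpha>2 R \<longleftrightarrow>
     (\<exists>(x1 :: nat \<Rightarrow> nat \<Rightarrow> nat \<Rightarrow> real) (x2 :: nat \<Rightarrow> nat \<Rightarrow> nat \<Rightarrow> real)
        (g1 :: nat \<Rightarrow> (nat \<Rightarrow> real) \<Rightarrow> nat) (g2 :: nat \<Rightarrow> (nat \<Rightarrow> real) \<Rightarrow> nat).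
        (\<forall>n. admissible_codebook A \<alpha>1 n (num_msgs n (fst R)) (x1 n)
           \<and> admissible_codebook A \<alpha>2 n (num_msgs n (snd R)) (x2 n)
           \<and> g1 n \<in> measurable (PiM {..<n} (\<lambda>_. borel)) (count_space UNIV)
           \<and> g2 n \<in> measurable (PiM {..<n} (\<lambda>_. borel)) (count_space UNIV))
      \<and> (\<lambda>n. err_prob \<sigma> n h11 h21 (num_msgs n (fst R)) (num_msgs n (snd R)) (x1 n) (x2 n) (g1 n))
           \<longlonglongrightarrow> 0
      \<and> (\<lambda>n. err_prob \<sigma> n h22 h12 (num_msgs n (snd R)) (num_msgs n (fst R)) (x2 n) (x1 n) (g2 n))
           \<longlonglongrightarrow> 0)"

definition capacity_region ::
  "real \<Rightarrow> real \<Rightarrow> real \<Rightarrow> real \<Rightarrow> real \<Rightarrow> real \<Rightarrow> real \<Rightarrow> real \<Rightarrow> (real \<times> real) set" where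
  "capacity_region h11 h12 h21 h22 \<sigma> A \<alpha>1 \<alpha>2 =
     closure {R. achievable h11 h12 h21 h22 \<sigma> A \<alpha>1 \<alpha>2 R}"

definition R_TIN' ::
  "real \<Rightarrow> real \<Rightarrow> real \<Rightarrow> real \<Rightarrow> real \<Rightarrow> real \<Rightarrow> real \<Rightarrow> real \<Rightarrow> real \<Rightarrow> (real \<times> real) set" where
  "R_TIN' h11 h12 h21 h22 \<sigma> \<kappa>1 \<kappa>2 \<theta>1 \<theta>2 =
     {(R1, R2). R1 \<ge> 0 \<and> R2 \<ge> 0
        \<and> R1 \<le> Ffun \<sigma> 0 (h11 * \<kappa>1) (h21 * \<kappa>2) 1 \<theta>1 \<theta>2
        \<and> R2 \<le> Ffun \<sigma> 0 (h22 * \<kappa>2) (h12 * \<kappa>1) 1 \<theta>2 \<theta>1}"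

definition G_TIN' ::
  "real \<Rightarrow> real \<Rightarrow> real \<Rightarrow> real \<Rightarrow> real \<Rightarrow> real \<Rightarrow> real \<Rightarrow> real \<Rightarrow> (real \<times> real) set" where
  "G_TIN' h11 h12 h21 h22 \<sigma> A \<alpha>1 \<alpha>2 =
     convex hull (\<Union> {R_TIN' h11 h12 h21 h22 \<sigma> \<kappa>1 \<kappa>2 \<theta>1 \<theta>2 | \<kappa>1 \<kappa>2 \<theta>1 \<theta>2.
        \<kappa>1 \<in> {0..A} \<and> \<kappa>2 \<in> {0..A} \<and> \<theta>1 \<in> {0<..1} \<and> \<theta>2 \<in> {0<..1}
        \<and> \<theta>1 * \<kappa>1 \<in> {0..\<alpha>1 * A} \<and> \<theta>2 * \<kappa>2 \<in> {0..\<alpha>2 * A}})"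

end

theory Submission
  imports Defs "HOL-Real_Asymp.Real_Asymp"
begin

text \<open>
  Each user draws its symbols as \<open>\<kappa> * T g\<close> with \<open>g\<close> standard Gaussian and \<open>T\<close> the increasing
  map that transports the Gaussian law to the maximum entropy law on \<open>[0, 1]\<close> with mean at most
  \<open>\<theta>\<close>. Treating the interference plus noise as one additive noise of density \<open>w\<close>, the mutual
  information is \<open>h(X + W) - h(W)\<close>. The entropy power inequality bounds the first entropy from
  below; here only one summand pair is needed, for which Rioul's transport proof reduces to
  \<open>ln x \<le> x - 1\<close>. The second entropy is bounded from above by a cross entropy with the density
  of Lapidoth, Moser and Wigger, which produces \<open>Cbar\<close>. These rates are achieved by random
  coding with a threshold decoder, where every error event is controlled by an exponential moment
  that factorises over the letters. Convex combinations come from time sharing over positions; a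
  small fraction of idle positions makes the mean constraints strict, and the loss vanishes in
  the closure.
\<close>

section \<open>Monotone transport between densities\<close>

text \<open>The entropy of \<open>T\<close> applied to a standard Gaussian is the Gaussian entropy
  plus the mean of \<open>ln (T' g)\<close>. Hence \<open>rho \<theta>\<close> is the entropy power
  of the maximum entropy law, while the denominator in \<open>Ffun\<close> bounds the entropy power
  of interference plus noise. \<open>Ffun\<close> is thus half the logarithm of one plus a ratio of
  entropy powers, the shape that the entropy power inequality gives to a bound on mutual
  information. A Gaussian seed for every symbol lets one source drive both the transport argument
  and the codebooks. Input laws are never asked for a density, so the constant idle symbol is
  treated like all others. The obstacle is integrability: entropies and Chernoff bounds need
  logarithms of densities of sums. Each such density is compared with the noise density up to a
  factor \<open>exp (K * (1 + \<bar>v\<bar>))\<close>, a property that survives the addition of a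
  bounded input. Since \<open>Cbar\<close> is an infimum, it suffices to bound the entropy for every
  choice of the parameters of the comparison density.\<close>

lemma cdf_has_real_derivative_density:
  fixes f :: "real \<Rightarrow> real"
  assumes prob: "prob_space (density lborel f)" and cont: "continuous_on UNIV f"
    and nonneg: "\<And>x. 0 \<le> f x"
  shows "(cdf (density lborel f) has_real_derivative f x) (at x)"
proof -
  interpret prob_space "density lborel f" by (fact prob)
  interpret real_distribution "density lborel f"
    by unfold_locales auto
  let ?F = "cdf (density lborel f)"
  have [measurable]: "f \<in> borel_measurable borel"
    using cont by (rule borel_measurable_continuous_onI)
  \<comment> \<open>Anchoring the integral at \<open>x - 1\<close> puts \<open>x\<close> in the
    interior of the interval on which the fundamental theorem is applied.\<close>
  have F: "?F y = ?F (x - 1) + integral {x-1..y} f" if "y \<in> {x-1..x+1}" for y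
  proof (cases "y = x - 1")
    case False
    with that have lt: "x - 1 < y" by auto
    have "?F y - ?F (x-1) = measure (density lborel f) {x-1<..y}"
      using lt by (rule cdf_diff_eq)
    also have "\<dots> = enn2real (\<integral>\<^sup>+t. ennreal (indicator {x-1<..y} t * f t) \<partial>lborel)"
      unfolding measure_def
      by (subst emeasure_density)
        (auto intro!: arg_cong[where f=enn2real] nn_integral_cong split: split_indicator)
    also have "\<dots> = integral\<^sup>L lborel (\<lambda>t. indicator {x-1<..y} t * f t)"
      by (subst integral_eq_nn_integral) (auto simp: nonneg)
    also have "\<dots> = integral\<^sup>L lborel (\<lambda>t. indicator {x-1..y} t *\<^sub>R f t)"
    proof (rule integral_cong_AE)
      have "AE t in lborel. t \<noteq> x - 1" by (rule AE_lborel_singleton)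
      then show "AE t in lborel. indicator {x-1<..y} t * f t = indicator {x-1..y} t *\<^sub>R f t"
        by eventually_elim (auto split: split_indicator)
    qed auto
    also have "\<dots> = integral {x-1..y} f"
      using borel_integrable_compact[of "{x-1..y}" f] continuous_on_subset[OF cont]
      by (subst set_borel_integral_eq_integral(2)[unfolded set_lebesgue_integral_def, symmetric])
         (auto simp: set_integrable_def)
    finally show ?thesis by simp
  qed auto
  have "((\<lambda>y. ?F (x - 1) + integral {x-1..y} f) has_real_derivative f x) (at x within {x-1..x+1})"
    by (auto intro!: derivative_eq_intros integral_has_real_derivative continuous_on_subset[OF cont])
  then have "(?F has_real_derivative f x) (at x within {x-1..x+1})"
    by (rule has_field_derivative_transform_within[where d=1]) (auto intro!: F[symmetric])
  then show ?thesis
    by (simp add: at_within_Icc_at)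
qed

text \<open>Positivity of the density makes the distribution function strictly increasing, which
  excludes the values 0 and 1; continuity and the limits at both infinities supply everything in
  between.\<close>

lemma cdf_density_range:
  fixes f :: "real \<Rightarrow> real"
  assumes prob: "prob_space (density lborel f)" and cont: "continuous_on UNIV f"
    and pos: "\<And>x. 0 < f x"
  shows "strict_mono (cdf (density lborel f))" and "range (cdf (density lborel f)) = {0<..<1}"
proof -
  interpret prob_space "density lborel f" by (fact prob)
  interpret real_distribution "density lborel f"
    by unfold_locales auto
  let ?F = "cdf (density lborel f)"
  have deriv: "(?F has_real_derivative f x) (at x)" for x
    using prob cont less_imp_le[OF pos] by (rule cdf_has_real_derivative_density)
  show mono: "strict_mono ?F"
    by (rule strict_monoI) (use deriv pos in \<open>blast intro: DERIV_pos_imp_increasing\<close>)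
  have "0 < ?F x" for x
    using cdf_nonneg[of "x-1"] strict_monoD[OF mono, of "x-1" x] by auto
  moreover have "?F x < 1" for x
    using cdf_bounded_prob[of "x+1"] strict_monoD[OF mono, of x "x+1"] by auto
  moreover have "p \<in> range ?F" if p: "0 < p" "p < 1" for p
  proof -
    have "eventually (\<lambda>x. ?F x < p) at_bot"
      using order_tendstoD(2)[OF cdf_lim_at_bot p(1)] .
    then obtain a where a: "?F a < p"
      by (meson eventually_at_bot_linorder order_refl)
    have "eventually (\<lambda>x. p < ?F x) at_top"
      using order_tendstoD(1)[OF cdf_lim_at_top_prob p(2)] .
    then obtain b where b: "p < ?F b"
      by (meson eventually_at_top_linorder order_refl)
    have "a < b" using a b strict_mono_less[OF mono, of a b] by auto
    then have "\<exists>x. a \<le> x \<and> x \<le> b \<and> ?F x = p"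
      using a b by (intro IVT) (auto intro: DERIV_isCont[OF deriv])
    then show ?thesis by auto
  qed
  ultimately show "range ?F = {0<..<1}" by auto
qed

text \<open>The map is the quantile function of \<open>g\<close> after the distribution function of
  \<open>f\<close>. Its derivative comes from the inverse function rule, and the laws agree because
  their distribution functions do. It later writes interference plus noise as an increasing function
  of a Gaussian.\<close>

lemma monotone_transport:
  fixes f g :: "real \<Rightarrow> real"
  assumes f: "prob_space (density lborel f)" "continuous_on UNIV f" "\<And>x. 0 < f x"
    and g: "prob_space (density lborel g)" "continuous_on UNIV g" "\<And>x. 0 < g x"
  obtains U where "\<And>x. (U has_real_derivative f x / g (U x)) (at x)"
    and "distr (density lborel f) borel U = density lborel g"
proof -
  interpret f: prob_space "density lborel f" by (fact f)
  interpret f: real_distribution "density lborel f" by unfold_locales auto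
  interpret g: prob_space "density lborel g" by (fact g)
  interpret g: real_distribution "density lborel g" by unfold_locales auto
  let ?F = "cdf (density lborel f)" and ?G = "cdf (density lborel g)"
  have dF: "(?F has_real_derivative f x) (at x)" for x
    using f(1,2) less_imp_le[OF f(3)] by (rule cdf_has_real_derivative_density)
  have dG: "(?G has_real_derivative g x) (at x)" for x
    using g(1,2) less_imp_le[OF g(3)] by (rule cdf_has_real_derivative_density)
  note monoF = cdf_density_range(1)[OF f] and monoG = cdf_density_range(1)[OF g]
  define H where "H = inv ?G"
  have GH: "?G (H p) = p" if "0 < p" "p < 1" for p
    unfolding H_def using that cdf_density_range(2)[OF g] by (intro f_inv_into_f) auto
  have HG: "H (?G y) = y" for y
    unfolding H_def by (rule inv_f_f) (rule strict_mono_imp_inj_on[OF monoG])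
  define U where "U = (\<lambda>x. H (?F x))"
  have Frange: "0 < ?F x" "?F x < 1" for x
    using cdf_density_range(2)[OF f] by (metis greaterThanLessThan_iff rangeI)+
  have Grange: "0 < ?G x" "?G x < 1" for x
    using cdf_density_range(2)[OF g] by (metis greaterThanLessThan_iff rangeI)+
  have GU: "?G (U x) = ?F x" for x
    unfolding U_def by (rule GH) (auto simp: Frange)
  have dU: "(U has_real_derivative f x / g (U x)) (at x)" for x
  proof -
    have contH: "isCont H (?G (U x))"
      by (rule isCont_inverse_function[where d=1]) (auto simp: HG intro: DERIV_isCont[OF dG])
    have "(H has_real_derivative inverse (g (H (?F x)))) (at (?F x))"
      using contH[unfolded GU] Frange[of x] g(3)[of "H (?F x)"]
      by (intro DERIV_inverse_function[where f="?G" and a=0 and b=1])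
         (auto simp: dG GH)
    from DERIV_chain2[OF this dF] show ?thesis
      by (simp add: U_def field_simps)
  qed
  have contU: "continuous_on UNIV U"
    by (intro continuous_at_imp_continuous_on ballI DERIV_isCont[OF dU])
  then have [measurable]: "U \<in> borel_measurable borel"
    by (rule borel_measurable_continuous_onI)
  have "cdf (distr (density lborel f) borel U) = ?G"
  proof
    fix y
    obtain x where x: "?F x = ?G y"
      using cdf_density_range(2)[OF f] Grange[of y]
      by (metis greaterThanLessThan_iff imageE)
    have "U t \<le> y \<longleftrightarrow> t \<le> x" for t
    proof -
      have "U t \<le> y \<longleftrightarrow> ?G (U t) \<le> ?G y"
        by (rule strict_mono_less_eq[OF monoG, symmetric])
      also have "\<dots> \<longleftrightarrow> t \<le> x"
        unfolding GU x[symmetric] by (rule strict_mono_less_eq[OF monoF])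
      finally show ?thesis .
    qed
    then have "U -` {..y} = {..x}" by auto
    then show "cdf (distr (density lborel f) borel U) y = ?G y"
      by (simp add: cdf_def measure_distr x[unfolded cdf_def])
  qed
  moreover have "real_distribution (distr (density lborel f) borel U)"
    by (rule f.real_distribution_distr) auto
  ultimately have "distr (density lborel f) borel U = density lborel g"
    by (intro cdf_unique) (auto intro: g.real_distribution_axioms)
  with dU show ?thesis by (rule that)
qed

section \<open>The entropy power inequality for transported Gaussians\<close>

abbreviation std_gauss :: "real measure" where
  "std_gauss \<equiv> density lborel std_normal_density"

lemma prob_space_std_gauss: "prob_space std_gauss"
  by (rule prob_space_normal_density) simp

text \<open>The rotation is split into two one-dimensional affine substitutions, first
  \<open>y\<close> to \<open>s = a * x + b * y\<close>, then \<open>x\<close> to \<open>r\<close>,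
  with exchanges of the integration order; the factors \<open>1 / b\<close> and \<open>b\<close>
  cancel.\<close>

lemma nn_integral_rotation:
  fixes f :: "real \<Rightarrow> real \<Rightarrow> ennreal" and a b :: real
  assumes [measurable]: "case_prod f \<in> borel_measurable (borel \<Otimes>\<^sub>M borel)"
    and ab: "a\<^sup>2 + b\<^sup>2 = 1" and b: "b > 0"
  shows "(\<integral>\<^sup>+x. \<integral>\<^sup>+y. f x y \<partial>lborel \<partial>lborel)
       = (\<integral>\<^sup>+r. \<integral>\<^sup>+s. f (a * s - b * r) (b * s + a * r) \<partial>lborel \<partial>lborel)"
proof -
  have [measurable]: "(\<lambda>z. f (g z) (h z)) \<in> borel_measurable M"
    if "g \<in> borel_measurable M" "h \<in> borel_measurable M" for g h :: "'a \<Rightarrow> real" and M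
    using measurable_compose[OF measurable_Pair[OF that] assms(1)] by (simp add: comp_def)
  have "(\<integral>\<^sup>+x. \<integral>\<^sup>+y. f x y \<partial>lborel \<partial>lborel)
      = (\<integral>\<^sup>+x. ennreal (1/b) * (\<integral>\<^sup>+s. f x (- (a/b) * x + (1/b) * s) \<partial>lborel) \<partial>lborel)"
    using b by (intro nn_integral_cong) (subst nn_integral_real_affine[where c="1/b" and t="- (a/b) * x" for x], auto)
  also have "\<dots> = ennreal (1/b) * (\<integral>\<^sup>+x. \<integral>\<^sup>+s. f x (- (a/b) * x + (1/b) * s) \<partial>lborel \<partial>lborel)"
    by (intro nn_integral_cmult) measurable
  also have "(\<integral>\<^sup>+x. \<integral>\<^sup>+s. f x (- (a/b) * x + (1/b) * s) \<partial>lborel \<partial>lborel)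
     = (\<integral>\<^sup>+s. \<integral>\<^sup>+x. f x (- (a/b) * x + (1/b) * s) \<partial>lborel \<partial>lborel)"
    by (rule lborel_pair.Fubini') measurable
  also have "\<dots> = (\<integral>\<^sup>+s. ennreal b * (\<integral>\<^sup>+r. f (a * s + (-b) * r) (- (a/b) * (a * s + (-b) * r) + (1/b) * s) \<partial>lborel) \<partial>lborel)"
    using b by (intro nn_integral_cong) (subst nn_integral_real_affine[where c="-b" and t="a * s" for s], auto)
  also have "\<dots> = ennreal b * (\<integral>\<^sup>+s. \<integral>\<^sup>+r. f (a * s - b * r) (b * s + a * r) \<partial>lborel \<partial>lborel)"
  proof -
    have "- (a/b) * (a * s + (-b) * r) + (1/b) * s = b * s + a * r" for s r
    proof -
      have "- (a/b) * (a * s + (-b) * r) + (1/b) * s = ((1 - a\<^sup>2) * s) / b + a * r"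
        using b by (simp add: field_simps power2_eq_square)
      also have "1 - a\<^sup>2 = b\<^sup>2" using ab by simp
      finally show ?thesis using b by (simp add: power2_eq_square)
    qed
    then show ?thesis by (subst nn_integral_cmult) auto
  qed
  also have "(\<integral>\<^sup>+s. \<integral>\<^sup>+r. f (a * s - b * r) (b * s + a * r) \<partial>lborel \<partial>lborel)
      = (\<integral>\<^sup>+r. \<integral>\<^sup>+s. f (a * s - b * r) (b * s + a * r) \<partial>lborel \<partial>lborel)"
    by (rule lborel_pair.Fubini') measurable
  finally show ?thesis
    using b by (simp add: mult.assoc[symmetric] ennreal_mult[symmetric])
qed

text \<open>The change of variables formula yields the integral of \<open>q\<close> over the range
  of \<open>\<theta>\<close>. This range may be smaller than the line, hence only an
  inequality.\<close>

lemma nn_integral_increasing_substitution_le: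
  fixes q \<theta> \<theta>' :: "real \<Rightarrow> real"
  assumes [measurable]: "q \<in> borel_measurable borel" "\<theta>' \<in> borel_measurable borel"
    and q: "\<And>y. 0 \<le> q y" "(\<integral>\<^sup>+y. q y \<partial>lborel) < \<infinity>"
    and deriv: "\<And>s. (\<theta> has_real_derivative \<theta>' s) (at s)" and pos: "\<And>s. 0 < \<theta>' s"
  shows "(\<integral>\<^sup>+s. ennreal (\<theta>' s * q (\<theta> s)) \<partial>lborel) \<le> (\<integral>\<^sup>+y. q y \<partial>lborel)"
proof -
  have mono: "strict_mono \<theta>"
    by (rule strict_monoI) (use deriv pos in \<open>blast intro: DERIV_pos_imp_increasing\<close>)
  then have inj: "inj \<theta>" by (rule strict_mono_imp_inj_on)
  have cont: "continuous_on UNIV \<theta>"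
    by (intro continuous_at_imp_continuous_on ballI DERIV_isCont[OF deriv])
  then have [measurable]: "\<theta> \<in> borel_measurable borel"
    by (rule borel_measurable_continuous_onI)
  have "open (range \<theta>)"
    using injective_eq_1d_open_map_UNIV[of UNIV \<theta>] cont inj by auto
  then have [measurable]: "range \<theta> \<in> sets borel" by auto
  have int_q: "integrable lborel q"
    by (rule integrableI_nonneg) (use q in auto)
  then have "integrable lebesgue q" by (simp add: integrable_completion)
  then have "q absolutely_integrable_on UNIV" by (simp add: set_integrable_def)
  then have "q absolutely_integrable_on range \<theta>"
    by (rule set_integrable_subset) auto
  then have ai: "(\<lambda>s. \<bar>\<theta>' s\<bar> * q (\<theta> s)) absolutely_integrable_on UNIV"
    and eq: "integral UNIV (\<lambda>s. \<bar>\<theta>' s\<bar> * q (\<theta> s)) = integral (range \<theta>) q"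
    using has_absolute_integral_change_of_variables_1'[of UNIV \<theta> \<theta>' q "integral (range \<theta>) q"] inj deriv
    by auto
  have int: "integrable lborel (\<lambda>s. \<theta>' s * q (\<theta> s))"
    using ai pos by (simp add: set_integrable_def integrable_completion abs_of_pos)
  have "integral\<^sup>L lborel (\<lambda>s. \<theta>' s * q (\<theta> s)) = integral UNIV (\<lambda>s. \<theta>' s * q (\<theta> s))"
    using int by (rule integral_lborel[symmetric])
  also have "\<dots> = integral (range \<theta>) q"
    using eq pos by (simp add: abs_of_pos)
  also have "\<dots> \<le> integral UNIV q"
    using q(1) \<open>q absolutely_integrable_on UNIV\<close> \<open>q absolutely_integrable_on range \<theta>\<close>
    by (intro integral_subset_le) (auto intro: set_lebesgue_integral_eq_integral(1))
  also have "\<dots> = integral\<^sup>L lborel q"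
    using int_q by (rule integral_lborel)
  finally have "integral\<^sup>L lborel (\<lambda>s. \<theta>' s * q (\<theta> s)) \<le> integral\<^sup>L lborel q" .
  then show ?thesis
    using int int_q q pos by (simp add: nn_integral_eq_integral less_imp_le)
qed

text \<open>Concavity of the logarithm with weights \<open>a\<^sup>2\<close> and
  \<open>b\<^sup>2\<close> at the points \<open>u / a\<close> and \<open>v / b\<close>. It separates
  the contributions of \<open>T'\<close> and \<open>U'\<close> to the derivative
  \<open>a * T' + b * U'\<close> along a rotated coordinate.\<close>

lemma ln_weighted_sum_ge:
  fixes a b u v :: real
  assumes "a > 0" "b > 0" "a\<^sup>2 + b\<^sup>2 = 1" "u > 0" "v > 0"
  shows "a\<^sup>2 * ln (u / a) + b\<^sup>2 * ln (v / b) \<le> ln (a * u + b * v)"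
proof -
  have "a\<^sup>2 * ln (u / a) + b\<^sup>2 * ln (v / b) \<le> ln (a\<^sup>2 * (u / a) + b\<^sup>2 * (v / b))"
    using ln_concave assms unfolding concave_on_iff by (auto simp del: times_divide_eq_right)
  moreover have "a\<^sup>2 * (u / a) + b\<^sup>2 * (v / b) = a * u + b * v"
    using assms by (simp add: power2_eq_square)
  ultimately show ?thesis by simp
qed

lemma ln_std_normal_density: "ln (std_normal_density t) = - ln (2 * pi) / 2 - t\<^sup>2 / 2"
  by (simp add: std_normal_density_def ln_mult ln_div ln_sqrt add_divide_distrib)

lemma std_gauss_second_moment:
  "integrable std_gauss (\<lambda>x. x\<^sup>2)" "integral\<^sup>L std_gauss (\<lambda>x. x\<^sup>2) = 1"
  "integrable std_gauss (\<lambda>x. x)" "integral\<^sup>L std_gauss (\<lambda>x. x) = 0"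
proof -
  show "integrable std_gauss (\<lambda>x. x\<^sup>2)"
    using integrable_std_normal_moment[of 2] by (simp add: integrable_density)
  show "integral\<^sup>L std_gauss (\<lambda>x. x\<^sup>2) = 1"
    using has_bochner_integral_integral_eq[OF std_normal_moment_even[of 1]]
    by (simp add: integral_density numeral_2_eq_2)
  show "integrable std_gauss (\<lambda>x. x)"
    using integrable_std_normal_moment[of 1] by (simp add: integrable_density)
  show "integral\<^sup>L std_gauss (\<lambda>x. x) = 0"
    using has_bochner_integral_integral_eq[OF std_normal_moment_odd[of 0]]
    by (simp add: integral_density)
qed

lemma (in pair_prob_space) integral_fst_coordinate:
  fixes f :: "'a \<Rightarrow> real"
  assumes "integrable M1 f"
  shows "integrable (M1 \<Otimes>\<^sub>M M2) (\<lambda>z. f (fst z))"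
    and "integral\<^sup>L (M1 \<Otimes>\<^sub>M M2) (\<lambda>z. f (fst z)) = integral\<^sup>L M1 f"
proof -
  have "integrable (distr (M1 \<Otimes>\<^sub>M M2) M1 fst) f"
    using assms by (simp add: M2.distr_pair_fst)
  then show "integrable (M1 \<Otimes>\<^sub>M M2) (\<lambda>z. f (fst z))"
    by (subst (asm) integrable_distr_eq) (use assms in auto)
  have "integral\<^sup>L (M1 \<Otimes>\<^sub>M M2) (\<lambda>z. f (fst z)) = integral\<^sup>L (distr (M1 \<Otimes>\<^sub>M M2) M1 fst) f"
    by (rule integral_distr[symmetric]) (use assms in auto)
  then show "integral\<^sup>L (M1 \<Otimes>\<^sub>M M2) (\<lambda>z. f (fst z)) = integral\<^sup>L M1 f"
    by (simp add: M2.distr_pair_fst)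
qed

lemma (in pair_prob_space) integral_snd_coordinate:
  fixes f :: "'b \<Rightarrow> real"
  assumes "integrable M2 f"
  shows "integrable (M1 \<Otimes>\<^sub>M M2) (\<lambda>z. f (snd z))"
    and "integral\<^sup>L (M1 \<Otimes>\<^sub>M M2) (\<lambda>z. f (snd z)) = integral\<^sup>L M2 f"
proof -
  interpret swap: pair_prob_space M2 M1 ..
  from swap.integral_fst_coordinate[OF assms]
  have i: "integrable (M2 \<Otimes>\<^sub>M M1) (\<lambda>z. f (fst z))"
    and e: "integral\<^sup>L (M2 \<Otimes>\<^sub>M M1) (\<lambda>z. f (fst z)) = integral\<^sup>L M2 f" by auto
  show "integrable (M1 \<Otimes>\<^sub>M M2) (\<lambda>z. f (snd z))"
    using swap.integrable_product_swap[OF i] by (simp add: case_prod_beta')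
  show "integral\<^sup>L (M1 \<Otimes>\<^sub>M M2) (\<lambda>z. f (snd z)) = integral\<^sup>L M2 f"
    using swap.integral_product_swap[of "\<lambda>z. f (fst z)"] i e
    by (auto simp: case_prod_beta')
qed

text \<open>
  Rioul's argument: rotate the two Gaussian variables and condition on one of the new
  coordinates, along which \<open>T x + U y\<close> is an increasing function of the other one.
\<close>

lemma entropy_power_transport:
  fixes T T' U U' q :: "real \<Rightarrow> real" and a b :: real
  assumes ab: "a\<^sup>2 + b\<^sup>2 = 1" "a > 0" "b > 0"
    and dT: "\<And>x. (T has_real_derivative T' x) (at x)" "\<And>x. 0 < T' x"
    and dU: "\<And>x. (U has_real_derivative U' x) (at x)" "\<And>x. 0 < U' x"
    and meas[measurable]: "T' \<in> borel_measurable borel" "U' \<in> borel_measurable borel"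
      "q \<in> borel_measurable borel"
    and q: "\<And>y. 0 < q y" "(\<integral>\<^sup>+y. q y \<partial>lborel) \<le> 1"
    and int_q: "integrable (std_gauss \<Otimes>\<^sub>M std_gauss) (\<lambda>z. ln (q (T (fst z) + U (snd z))))"
    and int_T: "integrable std_gauss (\<lambda>x. ln (T' x))"
    and int_U: "integrable std_gauss (\<lambda>x. ln (U' x))"
  shows "(\<integral>z. ln (q (T (fst z) + U (snd z))) \<partial>(std_gauss \<Otimes>\<^sub>M std_gauss))
      + a\<^sup>2 * ((\<integral>x. ln (T' x) \<partial>std_gauss) - ln a) + b\<^sup>2 * ((\<integral>x. ln (U' x) \<partial>std_gauss) - ln b)
      \<le> - ln (2 * pi) / 2 - 1 / 2"
proof -
  interpret N: prob_space std_gauss by (rule prob_space_std_gauss)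
  interpret NN: pair_prob_space std_gauss std_gauss ..
  let ?NN = "std_gauss \<Otimes>\<^sub>M std_gauss"
  have [measurable]: "T \<in> borel_measurable borel" "U \<in> borel_measurable borel"
    by (intro borel_measurable_continuous_onI continuous_at_imp_continuous_on ballI
        DERIV_isCont[OF dT(1)] DERIV_isCont[OF dU(1)])+
  \<comment> \<open>With \<open>s = a * x + b * y\<close> and \<open>r = - b * x + a * y\<close>,
    this is, for fixed \<open>r\<close>, the density \<open>q\<close> pulled back along
    \<open>s\<close>, divided by the normal density of \<open>s\<close>. Its mean is at most one, so
    \<open>ln K \<le> K - 1\<close> has non-positive integral.\<close>
  define K where "K = (\<lambda>x y. q (T x + U y) * (a * T' x + b * U' y) / std_normal_density (a * x + b * y))"
  have [measurable]: "case_prod K \<in> borel_measurable (borel \<Otimes>\<^sub>M borel)"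
    unfolding K_def by measurable
  have \<phi>_pos: "0 < std_normal_density x" for x
    by (rule normal_density_pos) simp
  have \<theta>_pos: "0 < a * T' x + b * U' y" for x y
    using ab dT(2) dU(2) by (simp add: add_pos_pos)
  have K_pos: "0 < K x y" for x y
    unfolding K_def using q(1) \<phi>_pos \<theta>_pos by simp
  have K_int: "(\<integral>\<^sup>+z. ennreal (K (fst z) (snd z)) \<partial>?NN) \<le> 1"
  proof -
    have "(\<integral>\<^sup>+z. ennreal (K (fst z) (snd z)) \<partial>?NN)
        = (\<integral>\<^sup>+x. \<integral>\<^sup>+y. ennreal (std_normal_density x) * (ennreal (std_normal_density y) * ennreal (K x y)) \<partial>lborel \<partial>lborel)"
      by (subst N.nn_integral_fst[symmetric], measurable)
        (simp add: nn_integral_density nn_integral_cmult)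
    also have "\<dots> = (\<integral>\<^sup>+x. \<integral>\<^sup>+y. ennreal (std_normal_density (- b * x + a * y)) *
         ennreal ((a * T' x + b * U' y) * q (T x + U y)) \<partial>lborel \<partial>lborel)"
    proof (intro nn_integral_cong)
      fix x y :: real
      have e: "x\<^sup>2 + y\<^sup>2 = (a * x + b * y)\<^sup>2 + (- b * x + a * y)\<^sup>2"
      proof -
        have "(a * x + b * y)\<^sup>2 + (- b * x + a * y)\<^sup>2 = (a\<^sup>2 + b\<^sup>2) * (x\<^sup>2 + y\<^sup>2)"
          by (simp add: power2_eq_square algebra_simps)
        then show ?thesis using ab by simp
      qed
      have "std_normal_density x * std_normal_density y
          = 1 / (2 * pi) * exp (- (x\<^sup>2 + y\<^sup>2) / 2)"
        by (simp add: std_normal_density_def mult_exp_exp field_simps)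
      also have "\<dots> = std_normal_density (a * x + b * y) * std_normal_density (- b * x + a * y)"
        unfolding e by (simp add: std_normal_density_def mult_exp_exp field_simps)
      finally have e': "std_normal_density x * std_normal_density y
          = std_normal_density (a * x + b * y) * std_normal_density (- b * x + a * y)" .
      have "std_normal_density x * (std_normal_density y * K x y)
          = std_normal_density (- b * x + a * y) * ((a * T' x + b * U' y) * q (T x + U y))"
        unfolding mult.assoc[symmetric] e' using \<phi>_pos[of "a * x + b * y"]
        by (simp add: K_def del: mult_minus_left)
      then show "ennreal (std_normal_density x) * (ennreal (std_normal_density y) * ennreal (K x y))
          = ennreal (std_normal_density (- b * x + a * y)) * ennreal ((a * T' x + b * U' y) * q (T x + U y))"
        using less_imp_le[OF K_pos] less_imp_le[OF \<theta>_pos] less_imp_le[OF q(1)]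
        by (simp add: ennreal_mult[symmetric])
    qed
    also have "\<dots> = (\<integral>\<^sup>+r. \<integral>\<^sup>+s. ennreal (std_normal_density (- b * (a * s - b * r) + a * (b * s + a * r))) *
         ennreal ((a * T' (a * s - b * r) + b * U' (b * s + a * r)) * q (T (a * s - b * r) + U (b * s + a * r))) \<partial>lborel \<partial>lborel)"
      by (rule nn_integral_rotation) (use ab in \<open>auto, measurable\<close>)
    also have "\<dots> = (\<integral>\<^sup>+r. ennreal (std_normal_density r) * (\<integral>\<^sup>+s.
         ennreal ((a * T' (a * s - b * r) + b * U' (b * s + a * r)) * q (T (a * s - b * r) + U (b * s + a * r))) \<partial>lborel) \<partial>lborel)"
    proof -
      have "- b * (a * s - b * r) + a * (b * s + a * r) = r" for s r
      proof -
        have "- b * (a * s - b * r) + a * (b * s + a * r) = (a\<^sup>2 + b\<^sup>2) * r"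
          by (simp add: power2_eq_square algebra_simps)
        then show ?thesis using ab by simp
      qed
      then show ?thesis by (simp add: nn_integral_cmult)
    qed
    \<comment> \<open>For fixed \<open>r\<close> the inner integral is an increasing substitution
      into \<open>q\<close>, hence at most the mass of \<open>q\<close>.\<close>
    also have "\<dots> \<le> (\<integral>\<^sup>+r. ennreal (std_normal_density r) * 1 \<partial>lborel)"
    proof (intro nn_integral_mono mult_left_mono)
      fix r :: real
      have "((\<lambda>s. T (a * s - b * r) + U (b * s + a * r)) has_real_derivative
          a * T' (a * s - b * r) + b * U' (b * s + a * r)) (at s)" for s
        by (auto intro!: derivative_eq_intros DERIV_chain2[OF dT(1)] DERIV_chain2[OF dU(1)])
      then have "(\<integral>\<^sup>+s. ennreal ((a * T' (a * s - b * r) + b * U' (b * s + a * r)) *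
          q (T (a * s - b * r) + U (b * s + a * r))) \<partial>lborel) \<le> (\<integral>\<^sup>+y. q y \<partial>lborel)"
        using q \<theta>_pos
        by (intro nn_integral_increasing_substitution_le)
          (auto intro: less_imp_le le_less_trans[OF _ ennreal_one_less_top])
      then show "(\<integral>\<^sup>+s. ennreal ((a * T' (a * s - b * r) + b * U' (b * s + a * r)) *
          q (T (a * s - b * r) + U (b * s + a * r))) \<partial>lborel) \<le> 1"
        using q(2) by (rule order_trans)
    qed simp
    also have "\<dots> = 1"
      using N.emeasure_space_1 by (simp add: emeasure_density)
    finally show ?thesis .
  qed
  have int_K: "integrable ?NN (\<lambda>z. K (fst z) (snd z))"
    using K_int less_imp_le[OF K_pos]
    by (intro integrableI_nonneg) (auto intro: le_less_trans[OF _ ennreal_one_less_top])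
  have K_le: "(\<integral>z. K (fst z) (snd z) \<partial>?NN) \<le> 1"
    using K_int less_imp_le[OF K_pos] by (intro integral_real_bounded) auto
  have int_sq: "integrable ?NN (\<lambda>z. (a * fst z + b * snd z)\<^sup>2)"
  proof (rule Bochner_Integration.integrable_bound)
    show "integrable ?NN (\<lambda>z. 2 * a\<^sup>2 * (fst z)\<^sup>2 + 2 * b\<^sup>2 * (snd z)\<^sup>2)"
      by (intro Bochner_Integration.integrable_add integrable_mult_right
          NN.integral_fst_coordinate NN.integral_snd_coordinate std_gauss_second_moment)
    have "(a * x + b * y)\<^sup>2 \<le> 2 * a\<^sup>2 * x\<^sup>2 + 2 * b\<^sup>2 * y\<^sup>2" for x y
      using zero_le_power2[of "a * x - b * y"] by (simp add: power2_eq_square algebra_simps)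
    then show "AE z in ?NN. norm ((a * fst z + b * snd z)\<^sup>2) \<le> norm (2 * a\<^sup>2 * (fst z)\<^sup>2 + 2 * b\<^sup>2 * (snd z)\<^sup>2)"
      by (auto intro!: AE_I2 order_trans[OF _ abs_ge_self])
  qed auto
  have sq: "(\<integral>z. (a * fst z + b * snd z)\<^sup>2 \<partial>?NN) = 1"
  proof -
    have "(\<integral>z. (a * fst z + b * snd z)\<^sup>2 \<partial>?NN) = (\<integral>x. \<integral>y. (a * x + b * y)\<^sup>2 \<partial>std_gauss \<partial>std_gauss)"
      using NN.integral_fst'[OF int_sq] by simp
    also have "(\<lambda>x. \<integral>y. (a * x + b * y)\<^sup>2 \<partial>std_gauss) = (\<lambda>x. a\<^sup>2 * x\<^sup>2 + b\<^sup>2)"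
    proof
      fix x
      have "(\<integral>y. (a * x + b * y)\<^sup>2 \<partial>std_gauss) = (\<integral>y. (a * x)\<^sup>2 + ((2 * a * b * x) * y + b\<^sup>2 * y\<^sup>2) \<partial>std_gauss)"
        by (intro Bochner_Integration.integral_cong) (auto simp: power2_eq_square algebra_simps)
      also have "\<dots> = a\<^sup>2 * x\<^sup>2 + b\<^sup>2"
        using std_gauss_second_moment N.prob_space by (simp add: power_mult_distrib)
      finally show "(\<integral>y. (a * x + b * y)\<^sup>2 \<partial>std_gauss) = a\<^sup>2 * x\<^sup>2 + b\<^sup>2" .
    qed
    finally show ?thesis
      using std_gauss_second_moment N.prob_space ab by simp
  qed
  \<comment> \<open>\<open>L\<close> is the lower bound of \<open>ln K\<close> after the weighted
    logarithm inequality: every term can now be integrated separately. The last bracket is minus the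
    logarithm of the normal density at the rotated coordinate.\<close>
  define L where "L = (\<lambda>z. ln (q (T (fst z) + U (snd z))) + a\<^sup>2 * (ln (T' (fst z)) - ln a)
    + b\<^sup>2 * (ln (U' (snd z)) - ln b) + (ln (2 * pi) / 2 + (a * fst z + b * snd z)\<^sup>2 / 2))"
  note ints = int_q int_sq NN.integral_fst_coordinate[OF int_T] NN.integral_snd_coordinate[OF int_U]
  have int_L: "integrable ?NN L"
    unfolding L_def by (intro Bochner_Integration.integrable_add Bochner_Integration.integrable_diff
        integrable_mult_right integrable_divide ints) auto
  have L_eq: "integral\<^sup>L ?NN L = (\<integral>z. ln (q (T (fst z) + U (snd z))) \<partial>?NN)
      + a\<^sup>2 * ((\<integral>x. ln (T' x) \<partial>std_gauss) - ln a) + b\<^sup>2 * ((\<integral>x. ln (U' x) \<partial>std_gauss) - ln b)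
      + (ln (2 * pi) / 2 + 1 / 2)"
    unfolding L_def using ints sq NN.prob_space by simp
  have "L z \<le> K (fst z) (snd z) - 1" for z
  proof -
    obtain x y where z: "z = (x, y)" by (cases z)
    have "ln (K x y) = ln (q (T x + U y)) + ln (a * T' x + b * U' y) - ln (std_normal_density (a * x + b * y))"
      unfolding K_def using q(1) \<theta>_pos \<phi>_pos
      by (simp add: ln_mult ln_div less_imp_neq[symmetric])
    moreover have "a\<^sup>2 * (ln (T' x) - ln a) + b\<^sup>2 * (ln (U' y) - ln b) \<le> ln (a * T' x + b * U' y)"
      using ln_weighted_sum_ge[OF ab(2,3,1) dT(2) dU(2), of x y] ab dT(2)[of x] dU(2)[of y]
      by (simp add: ln_div)
    ultimately have "L z \<le> ln (K x y)"
      by (simp add: L_def z ln_std_normal_density)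
    also have "\<dots> \<le> K x y - 1" using K_pos by (rule ln_le_minus_one)
    finally show ?thesis by (simp add: z)
  qed
  then have "integral\<^sup>L ?NN L \<le> (\<integral>z. K (fst z) (snd z) - 1 \<partial>?NN)"
    using int_L int_K by (intro integral_mono) auto
  also have "\<dots> \<le> 0"
    using K_le int_K NN.prob_space by simp
  finally show ?thesis unfolding L_eq by simp
qed

section \<open>Maximum entropy inputs\<close>

lemma continuous_normal_density: "continuous_on A (normal_density m s)"
  unfolding normal_density_def by (cases "s = 0") (auto intro!: continuous_intros)

lemma std_gauss_cdf_derivative:
  "(cdf std_gauss has_real_derivative std_normal_density x) (at x)"
  by (rule cdf_has_real_derivative_density)
    (auto simp: prob_space_std_gauss continuous_normal_density)

lemma std_gauss_cdf_range: "cdf std_gauss x \<in> {0<..<1}"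
proof -
  have "range (cdf std_gauss) = {0<..<1}"
    by (rule cdf_density_range)
      (auto simp: prob_space_std_gauss continuous_normal_density normal_density_pos)
  then show ?thesis by auto
qed

lemma std_gauss_real_distribution: "real_distribution std_gauss"
proof -
  interpret prob_space std_gauss by (rule prob_space_std_gauss)
  show ?thesis by unfold_locales auto
qed

text \<open>The Gaussian distribution function of a Gaussian variable is uniform, so the expectation
  is the integral of \<open>h\<close> over the unit interval. The proof uses the antiderivative
  \<open>H\<close> composed with the distribution function and its limits at both
  infinities.\<close>

lemma integral_std_gauss_cdf:
  fixes H h :: "real \<Rightarrow> real"
  assumes deriv: "\<And>u. u \<in> {0..1} \<Longrightarrow> (H has_real_derivative h u) (at u)"
    and cont: "continuous_on {0..1} h" and nonneg: "\<And>u. u \<in> {0..1} \<Longrightarrow> 0 \<le> h u"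
  shows "integrable std_gauss (\<lambda>x. h (cdf std_gauss x))"
    and "integral\<^sup>L std_gauss (\<lambda>x. h (cdf std_gauss x)) = H 1 - H 0"
proof -
  interpret real_distribution std_gauss by (rule std_gauss_real_distribution)
  let ?\<Phi> = "cdf std_gauss"
  have in01: "?\<Phi> x \<in> {0..1}" for x
    using std_gauss_cdf_range[of x] by auto
  have cont\<Phi>: "isCont ?\<Phi> x" for x by (rule DERIV_isCont[OF std_gauss_cdf_derivative])
  have conth: "continuous_on UNIV (\<lambda>x. h (?\<Phi> x))"
    by (rule continuous_on_compose2[OF cont])
      (use cont\<Phi> in01 in \<open>auto intro: continuous_at_imp_continuous_on\<close>)
  then have [measurable]: "(\<lambda>x. h (?\<Phi> x)) \<in> borel_measurable borel"
    by (rule borel_measurable_continuous_onI)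
  have contf: "isCont (\<lambda>x. std_normal_density x * h (?\<Phi> x)) x" for x
    using continuous_on_mult[OF continuous_normal_density[of UNIV 0 1] conth]
    by (simp add: continuous_on_eq_continuous_at)
  have derivF: "((\<lambda>x. H (?\<Phi> x)) has_real_derivative std_normal_density x * h (?\<Phi> x)) (at x)" for x
    using DERIV_chain2[OF deriv[OF in01] std_gauss_cdf_derivative] by (simp add: mult.commute)
  have lim1: "((\<lambda>x. H (?\<Phi> x)) \<longlongrightarrow> H 1) at_top"
    by (rule isCont_tendsto_compose[OF DERIV_isCont[OF deriv] cdf_lim_at_top_prob]) simp
  have lim0: "((\<lambda>x. H (?\<Phi> x)) \<longlongrightarrow> H 0) at_bot"
    by (rule isCont_tendsto_compose[OF DERIV_isCont[OF deriv] cdf_lim_at_bot]) simp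
  have lims: "(((\<lambda>x. H (?\<Phi> x)) \<circ> real_of_ereal) \<longlongrightarrow> H 0) (at_right (-\<infinity>))"
    "(((\<lambda>x. H (?\<Phi> x)) \<circ> real_of_ereal) \<longlongrightarrow> H 1) (at_left \<infinity>)"
    using lim0 lim1 by (simp_all add: ereal_tendsto_simps)
  have nn: "0 \<le> std_normal_density x * h (?\<Phi> x)" for x
    using nonneg[OF in01] by simp
  have FTC: "set_integrable lborel (einterval (-\<infinity>) \<infinity>) (\<lambda>x. std_normal_density x * h (?\<Phi> x))"
    "(LBINT x=-\<infinity>..\<infinity>. std_normal_density x * h (?\<Phi> x)) = H 1 - H 0"
    by (rule interval_integral_FTC_nonneg[where F="\<lambda>x. H (?\<Phi> x)"]; use derivF contf nn lims in auto)+
  show "integrable std_gauss (\<lambda>x. h (?\<Phi> x))"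
    using FTC(1) by (simp add: integrable_density set_integrable_def)
  show "integral\<^sup>L std_gauss (\<lambda>x. h (?\<Phi> x)) = H 1 - H 0"
    using FTC(2) by (simp add: integral_density interval_lebesgue_integral_def set_lebesgue_integral_def)
qed

lemma integral_ln_std_normal_density:
  "integrable std_gauss (\<lambda>x. ln (std_normal_density x))"
  "integral\<^sup>L std_gauss (\<lambda>x. ln (std_normal_density x)) = - ln (2 * pi) / 2 - 1 / 2"
proof -
  interpret prob_space std_gauss by (rule prob_space_std_gauss)
  show "integrable std_gauss (\<lambda>x. ln (std_normal_density x))"
    unfolding ln_std_normal_density using std_gauss_second_moment
    by (intro Bochner_Integration.integrable_diff) auto
  show "integral\<^sup>L std_gauss (\<lambda>x. ln (std_normal_density x)) = - ln (2 * pi) / 2 - 1 / 2"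
    unfolding ln_std_normal_density using std_gauss_second_moment prob_space
    by (subst Bochner_Integration.integral_diff) auto
qed

section \<open>Exponential laws truncated to the unit interval\<close>

definition truncexp_mean :: "real \<Rightarrow> real" where
  "truncexp_mean \<mu> = 1 / \<mu> - exp (- \<mu>) / (1 - exp (- \<mu>))"

text \<open>With \<open>E = exp (- t / 2)\<close> the derivative is
  \<open>E\<^sup>2 / (1 - E\<^sup>2)\<^sup>2 - 1 / t\<^sup>2\<close>, which is negative exactly when
  \<open>t * E < 1 - E\<^sup>2\<close>, that is, when \<open>t\<close> is less than twice the
  hyperbolic sine of \<open>t / 2\<close>.\<close>

lemma truncexp_mean_strict_antimono:
  assumes "0 < x" "x < y"
  shows "truncexp_mean y < truncexp_mean x"
proof (rule DERIV_neg_imp_decreasing[OF assms(2)])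
  fix t assume "x \<le> t" "t \<le> y"
  with assms have t: "t > 0" by simp
  define E where "E = exp (- t / 2)"
  have E: "0 < E" "E < 1" using t by (auto simp: E_def)
  have E2: "exp (- t) = E\<^sup>2" unfolding E_def power2_eq_square by (simp add: mult_exp_exp)
  have "(\<lambda>y. exp (y/2) - exp (-(y/2)) - y) 0 < (\<lambda>y. exp (y/2) - exp (-(y/2)) - y) t"
  proof (rule DERIV_pos_imp_increasing_open[OF t])
    fix s :: real assume s: "0 < s" "s < t"
    \<comment> \<open>The derivative of the difference is half of this square.\<close>
    have "0 < (exp (s/4) - exp (-(s/4)))\<^sup>2" using s by simp
    also have "\<dots> = exp (s/2) + exp (-(s/2)) - 2"
      by (simp add: power2_eq_square algebra_simps mult_exp_exp)
    finally show "\<exists>z. ((\<lambda>y. exp (y/2) - exp (-(y/2)) - y) has_real_derivative z) (at s) \<and> 0 < z"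
      by (intro exI[of _ "exp (s/2) / 2 + exp (-(s/2)) / 2 - 1"] conjI)
        (auto intro!: derivative_eq_intros)
  qed (auto intro!: continuous_intros)
  then have "t < exp (t/2) - exp (-(t/2))" by simp
  also have "\<dots> = (1 - E\<^sup>2) / E"
    unfolding E_def by (simp add: field_simps power2_eq_square mult_exp_exp)
  finally have "t * E < 1 - E\<^sup>2" using E by (simp add: field_simps)
  then have "(t * E)\<^sup>2 < (1 - E\<^sup>2)\<^sup>2" using t E by (intro power_strict_mono) auto
  moreover have "0 < 1 - E\<^sup>2" using E by (simp add: power_less_one_iff abs_square_less_1)
  ultimately have "E\<^sup>2 / (1 - E\<^sup>2)\<^sup>2 - 1 / t\<^sup>2 < 0"
    using t by (simp add: field_simps power_mult_distrib)
  moreover have "(truncexp_mean has_real_derivative E\<^sup>2 / (1 - E\<^sup>2)\<^sup>2 - 1 / t\<^sup>2) (at t)"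
    unfolding truncexp_mean_def using \<open>0 < 1 - E\<^sup>2\<close> t
    by (auto intro!: derivative_eq_intros simp: E2)
      (simp add: field_simps power2_eq_square power4_eq_xxxx)
  ultimately show "\<exists>z. (truncexp_mean has_real_derivative z) (at t) \<and> z < 0" by blast
qed

text \<open>The limits are 1/2 at zero and 0 at infinity; the intermediate value theorem does the
  rest.\<close>

lemma truncexp_mean_surj:
  assumes "0 < \<theta>" "\<theta> < 1 / 2"
  shows "\<exists>\<mu>>0. truncexp_mean \<mu> = \<theta>"
proof -
  have "(truncexp_mean \<longlongrightarrow> 1/2) (at_right 0)"
    unfolding truncexp_mean_def by real_asymp
  from order_tendstoD(1)[OF this assms(2)]
  obtain d where d: "d > 0" "\<And>y. 0 < y \<Longrightarrow> y < d \<Longrightarrow> \<theta> < truncexp_mean y"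
    by (auto simp: eventually_at_right_field)
  have "(truncexp_mean \<longlongrightarrow> 0) at_top"
    unfolding truncexp_mean_def by real_asymp
  from order_tendstoD(2)[OF this assms(1)]
  obtain B where B: "\<And>y. B \<le> y \<Longrightarrow> truncexp_mean y < \<theta>"
    by (auto simp: eventually_at_top_linorder)
  define a where "a = d / 2" define b where "b = max B d"
  have ab: "0 < a" "a < b" using d by (auto simp: a_def b_def)
  have "\<exists>x. a \<le> x \<and> x \<le> b \<and> truncexp_mean x = \<theta>"
  proof (rule IVT2)
    show "\<forall>x. a \<le> x \<and> x \<le> b \<longrightarrow> isCont truncexp_mean x"
      unfolding truncexp_mean_def using ab by (auto intro!: continuous_intros)
    show "\<theta> \<le> truncexp_mean a" using d(2)[of a] d(1) by (simp add: a_def)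
    show "truncexp_mean b \<le> \<theta>" using B[of b] by (simp add: b_def)
  qed (use ab in auto)
  then obtain x where "a \<le> x" "truncexp_mean x = \<theta>" by blast
  with ab show ?thesis by (intro exI[of _ x]) auto
qed

text \<open>Strict monotonicity of \<open>truncexp_mean\<close> makes the definite description in
  \<open>rho\<close> denote the given \<open>\<mu>\<close>.\<close>

lemma rho_less_half:
  assumes "\<mu> > 0" "truncexp_mean \<mu> < 1 / 2"
  shows "rho (truncexp_mean \<mu>)
    = exp (2 * truncexp_mean \<mu> * \<mu> - 1) / (2 * pi) * ((1 - exp (- \<mu>)) / \<mu>)\<^sup>2"
proof -
  have "(THE m. m > 0 \<and> truncexp_mean \<mu> = 1/m - exp (-m) / (1 - exp (-m))) = \<mu>"
  proof (rule the_equality)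
    fix m assume m: "m > 0 \<and> truncexp_mean \<mu> = 1/m - exp (-m) / (1 - exp (-m))"
    then have "truncexp_mean \<mu> = truncexp_mean m" by (simp add: truncexp_mean_def)
    then show "m = \<mu>"
      using truncexp_mean_strict_antimono[of m \<mu>] truncexp_mean_strict_antimono[of \<mu> m] m assms(1)
      by (cases m \<mu> rule: linorder_cases) auto
  qed (use assms in \<open>auto simp: truncexp_mean_def\<close>)
  with assms(2) show ?thesis by (simp add: rho_def Let_def)
qed

text \<open>The law of \<open>T\<close> is uniform for \<open>\<theta> \<ge> 1/2\<close> and truncated exponential otherwise.\<close>

lemma max_entropy_input:
  assumes \<theta>: "0 < \<theta>"
  obtains T T' where "\<And>x. (T has_real_derivative T' x) (at x)" "\<And>x. 0 < T' x"
    "T' \<in> borel_measurable borel" "\<And>x. 0 \<le> T x" "\<And>x. T x \<le> 1"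
    "integral\<^sup>L std_gauss T \<le> \<theta>" "integrable std_gauss (\<lambda>x. ln (T' x))"
    "integral\<^sup>L std_gauss (\<lambda>x. ln (T' x)) = ln (rho \<theta>) / 2" "rho \<theta> > 0"
proof (cases "\<theta> < 1 / 2")
  case False
  have range: "0 \<le> cdf std_gauss x" "cdf std_gauss x \<le> 1" for x
    using std_gauss_cdf_range[of x] by auto
  \<comment> \<open>\<open>T\<close> is the Gaussian distribution function itself, with mean 1/2,
    and \<open>T'\<close> is the normal density, whose expected logarithm is minus the Gaussian
    entropy.\<close>
  have "integral\<^sup>L std_gauss (cdf std_gauss) = 1\<^sup>2 / 2 - 0\<^sup>2 / 2"
    by (rule integral_std_gauss_cdf(2)[where h="\<lambda>u. u" and H="\<lambda>u. u\<^sup>2 / 2"])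
      (auto intro!: derivative_eq_intros)
  with False have "integral\<^sup>L std_gauss (cdf std_gauss) \<le> \<theta>" by simp
  moreover have rho: "rho \<theta> = 1 / (2 * pi * exp 1)" using False by (simp add: rho_def)
  moreover have "integral\<^sup>L std_gauss (\<lambda>x. ln (std_normal_density x)) = ln (rho \<theta>) / 2"
    unfolding integral_ln_std_normal_density rho by (simp add: ln_div ln_mult)
  ultimately show ?thesis
    by (intro that[OF std_gauss_cdf_derivative])
      (auto simp: range normal_density_pos integral_ln_std_normal_density)
next
  case True
  interpret prob_space std_gauss by (rule prob_space_std_gauss)
  obtain \<mu> where \<mu>: "\<mu> > 0" "truncexp_mean \<mu> = \<theta>"
    using truncexp_mean_surj[OF \<theta> True] by blast
  let ?\<Phi> = "cdf std_gauss"
  define c where "c = 1 - exp (- \<mu>)"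
  have c: "0 < c" "c < 1" using \<mu> by (auto simp: c_def)
  have arg: "exp (- \<mu>) \<le> 1 - c * u" "1 - c * u \<le> 1" if "u \<in> {0..1}" for u
  proof -
    have "c * u \<le> c" "0 \<le> c * u" using that c by (auto simp: mult_left_le)
    moreover have "exp (- \<mu>) = 1 - c" by (simp add: c_def)
    ultimately show "exp (- \<mu>) \<le> 1 - c * u" "1 - c * u \<le> 1" by linarith+
  qed
  have arg_pos: "0 < 1 - c * u" if "u \<in> {0..1}" for u
    using arg(1)[OF that] by (rule less_le_trans[OF exp_gt_zero])
  have in01: "?\<Phi> x \<in> {0..1}" for x
    using std_gauss_cdf_range[of x] by auto
  \<comment> \<open>\<open>h\<close> is the quantile function of the truncated exponential law, so
    \<open>T\<close> is \<open>h\<close> after the Gaussian distribution function; \<open>H\<close>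
    is an antiderivative of \<open>h\<close>, used to compute the mean.\<close>
  define h where "h = (\<lambda>u. - ln (1 - c * u) / \<mu>)"
  define H where "H = (\<lambda>u. ((1 - c * u) * ln (1 - c * u) - (1 - c * u)) / (c * \<mu>))"
  have h_nonneg: "0 \<le> h u" if "u \<in> {0..1}" for u
    using arg_pos[OF that] arg(2)[OF that] \<mu> by (simp add: h_def divide_nonpos_pos)
  have h_le: "h u \<le> 1" if "u \<in> {0..1}" for u
  proof -
    have "- \<mu> \<le> ln (1 - c * u)"
      using arg_pos[OF that] arg(1)[OF that] by (simp add: ln_ge_iff)
    then show ?thesis using \<mu> by (simp add: h_def field_simps)
  qed
  have H_deriv: "(H has_real_derivative h u) (at u)" if "u \<in> {0..1}" for u
  proof -
    have "((\<lambda>u. (1 - c * u) * ln (1 - c * u) - (1 - c * u)) has_real_derivative - c * ln (1 - c * u)) (at u)"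
      using arg_pos[OF that] by (auto intro!: derivative_eq_intros)
    from DERIV_cdivide[OF this, of "c * \<mu>"] show ?thesis
      unfolding H_def h_def using c by simp
  qed
  have h_cont: "continuous_on {0..1} h"
    unfolding h_def using arg_pos \<mu> by (auto intro!: continuous_intros simp: less_imp_neq[symmetric])
  note mean = integral_std_gauss_cdf[OF H_deriv h_cont h_nonneg]
  have "H 1 - H 0 = truncexp_mean \<mu>"
    using \<mu> c by (simp add: H_def truncexp_mean_def c_def field_simps)
  then have mean': "integral\<^sup>L std_gauss (\<lambda>x. h (?\<Phi> x)) = \<theta>"
    using mean(2) \<mu> by simp
  define T' where "T' = (\<lambda>x. c / \<mu> * std_normal_density x / (1 - c * ?\<Phi> x))"
  have [measurable]: "?\<Phi> \<in> borel_measurable borel"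
    by (intro borel_measurable_continuous_onI continuous_at_imp_continuous_on ballI
        DERIV_isCont[OF std_gauss_cdf_derivative])
  have phi_pos: "0 < std_normal_density x" for x by (rule normal_density_pos) simp
  \<comment> \<open>The reciprocal of \<open>1 - c * ?\<Phi> x\<close> is
    \<open>exp (\<mu> * T x)\<close>, so the expected logarithm depends on the input only through
    its mean \<open>\<theta>\<close>. This is the origin of the exponent
    \<open>2 * \<theta> * \<mu> - 1\<close> in \<open>rho\<close>.\<close>
  have lnT': "ln (T' x) = ln (c / \<mu>) + (ln (std_normal_density x) + \<mu> * h (?\<Phi> x))" for x
    unfolding T'_def h_def using c \<mu> arg_pos[OF in01, of x] phi_pos[of x]
    by (simp add: ln_mult ln_div)
  have "integral\<^sup>L std_gauss (\<lambda>x. ln (T' x)) = ln (c / \<mu>) + ((- ln (2 * pi) / 2 - 1 / 2) + \<mu> * \<theta>)"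
    unfolding lnT' using integral_ln_std_normal_density mean(1) mean' prob_space by simp
  moreover have rho: "rho \<theta> = exp (2 * \<theta> * \<mu> - 1) / (2 * pi) * (c / \<mu>)\<^sup>2"
    using rho_less_half[OF \<mu>(1)] \<mu>(2) True by (simp add: c_def)
  moreover have "ln (rho \<theta>) = (2 * \<theta> * \<mu> - 1) - ln (2 * pi) + 2 * ln (c / \<mu>)"
    unfolding rho using c \<mu> by (simp add: ln_mult ln_div ln_realpow)
  ultimately have int_ln: "integral\<^sup>L std_gauss (\<lambda>x. ln (T' x)) = ln (rho \<theta>) / 2"
    by (simp add: field_simps)
  show ?thesis
  proof (rule that)
    show "((\<lambda>x. h (?\<Phi> x)) has_real_derivative T' x) (at x)" for x
      unfolding h_def T'_def using arg_pos[OF in01, of x] \<mu>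
      by (auto intro!: derivative_eq_intros std_gauss_cdf_derivative simp: mult.commute)
    show "0 < T' x" for x
      unfolding T'_def using c \<mu> arg_pos[OF in01, of x] phi_pos[of x] by simp
    show "T' \<in> borel_measurable borel" unfolding T'_def by measurable
    show "0 < rho \<theta>" unfolding rho using c \<mu> by simp
    show "integrable std_gauss (\<lambda>x. ln (T' x))"
      unfolding lnT' using integral_ln_std_normal_density mean(1) by simp
  qed (use h_nonneg h_le in01 mean' int_ln in auto)
qed

section \<open>Densities comparable to a Gaussian\<close>

text \<open>The logarithmic distance to the Gaussian may grow linearly because a bounded shift
  changes the Gaussian exponent by a term linear in \<open>v\<close>. This makes the class stable
  under adding independent bounded variables, and strong enough for all exponential moments.\<close>

definition gauss_like :: "real \<Rightarrow> (real \<Rightarrow> real) \<Rightarrow> bool" where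
  "gauss_like \<sigma> f \<longleftrightarrow> continuous_on UNIV f \<and> (\<forall>v. 0 < f v) \<and> (\<exists>B. \<forall>v. f v \<le> B)
     \<and> prob_space (density lborel f)
     \<and> (\<exists>K. \<forall>v. \<bar>ln (f v) - ln (normal_density 0 \<sigma> v)\<bar> \<le> K * (1 + \<bar>v\<bar>))"

text \<open>Density of \<open>X g + V\<close> for a standard Gaussian \<open>g\<close> and an
  independent \<open>V\<close> of density \<open>f\<close>. The law of \<open>X g\<close> may have
  atoms.\<close>

definition smear :: "(real \<Rightarrow> real) \<Rightarrow> (real \<Rightarrow> real) \<Rightarrow> real \<Rightarrow> real" where
  "smear X f v = (\<integral>g. f (v - X g) \<partial>std_gauss)"

lemma gauss_like_normal_density:
  assumes "\<sigma> > 0" shows "gauss_like \<sigma> (normal_density 0 \<sigma>)"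
  unfolding gauss_like_def
proof (intro conjI)
  show "\<exists>B. \<forall>v. normal_density 0 \<sigma> v \<le> B"
    unfolding normal_density_def
    by (intro exI[of _ "1 / sqrt (2 * pi * \<sigma>\<^sup>2)"] allI mult_left_le) auto
  show "\<exists>K. \<forall>v. \<bar>ln (normal_density 0 \<sigma> v) - ln (normal_density 0 \<sigma> v)\<bar> \<le> K * (1 + \<bar>v\<bar>)"
    by (rule exI[of _ 0]) auto
qed (use assms in \<open>auto simp: continuous_normal_density normal_density_pos prob_space_normal_density\<close>)

lemma gauss_likeD:
  assumes "gauss_like \<sigma> f"
  shows "continuous_on UNIV f" "\<And>v. 0 < f v" "prob_space (density lborel f)"
    "f \<in> borel_measurable borel"
proof -
  show *: "continuous_on UNIV f" "\<And>v. 0 < f v" "prob_space (density lborel f)"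
    using assms by (auto simp: gauss_like_def)
  then show "f \<in> borel_measurable borel" by (intro borel_measurable_continuous_onI)
qed

lemma gauss_like_bounded:
  assumes "gauss_like \<sigma> f"
  shows "\<exists>B. \<forall>v. f v \<le> B"
  using assms unfolding gauss_like_def by blast

lemma gauss_like_log_bound:
  assumes "gauss_like \<sigma> f"
  shows "\<exists>K\<ge>0. \<forall>v. \<bar>ln (f v) - ln (normal_density 0 \<sigma> v)\<bar> \<le> K * (1 + \<bar>v\<bar>)"
proof -
  obtain K where K: "\<forall>v. \<bar>ln (f v) - ln (normal_density 0 \<sigma> v)\<bar> \<le> K * (1 + \<bar>v\<bar>)"
    using assms unfolding gauss_like_def by (elim conjE exE)
  have "0 \<le> K" using K[rule_format, of 0] by simp
  with K show ?thesis by (intro exI conjI)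
qed

lemma ln_normal_density:
  assumes "\<sigma> > 0"
  shows "ln (normal_density m \<sigma> v) = - ln (2 * pi * \<sigma>\<^sup>2) / 2 - (v - m)\<^sup>2 / (2 * \<sigma>\<^sup>2)"
proof -
  have "ln (normal_density m \<sigma> v) = ln (1 / sqrt (2 * pi * \<sigma>\<^sup>2)) + ln (exp (- (v - m)\<^sup>2 / (2 * \<sigma>\<^sup>2)))"
    unfolding normal_density_def by (rule ln_mult_pos) (use assms in auto)
  also have "ln (1 / sqrt (2 * pi * \<sigma>\<^sup>2)) = - ln (2 * pi * \<sigma>\<^sup>2) / 2"
    using assms by (subst ln_div) (auto simp: ln_sqrt)
  finally show ?thesis by simp
qed

lemma ln_normal_density_shift:
  assumes "\<sigma> > 0" "\<bar>x\<bar> \<le> b"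
  shows "\<bar>ln (normal_density 0 \<sigma> (v - x)) - ln (normal_density 0 \<sigma> v)\<bar> \<le> (2 * b + b\<^sup>2) / (2 * \<sigma>\<^sup>2) * (1 + \<bar>v\<bar>)"
proof -
  have b: "0 \<le> b" using assms by simp
  have "ln (normal_density 0 \<sigma> (v - x)) - ln (normal_density 0 \<sigma> v) = (2 * v * x - x\<^sup>2) / (2 * \<sigma>\<^sup>2)"
    using assms by (simp add: ln_normal_density power2_eq_square field_simps)
  also have "\<bar>\<dots>\<bar> \<le> (2 * \<bar>v\<bar> * b + b\<^sup>2) / (2 * \<sigma>\<^sup>2)"
  proof -
    have "\<bar>2 * v * x - x\<^sup>2\<bar> \<le> \<bar>2 * v * x\<bar> + \<bar>x\<^sup>2\<bar>" by (rule abs_triangle_ineq4)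
    also have "\<bar>2 * v * x\<bar> \<le> 2 * \<bar>v\<bar> * b"
      using assms by (simp add: abs_mult mult_left_mono)
    also have "\<bar>x\<^sup>2\<bar> \<le> b\<^sup>2" using power_mono[OF assms(2), of 2] by simp
    finally show ?thesis by (simp add: abs_divide divide_right_mono)
  qed
  also have "\<dots> \<le> ((2 * b + b\<^sup>2) * (1 + \<bar>v\<bar>)) / (2 * \<sigma>\<^sup>2)"
    using b by (intro divide_right_mono) (auto simp: algebra_simps)
  finally show ?thesis by simp
qed

lemma gauss_like_shift_bound:
  assumes "\<sigma> > 0" "gauss_like \<sigma> f"
  shows "\<exists>K\<ge>0. \<forall>v x. \<bar>x\<bar> \<le> b \<longrightarrow> \<bar>ln (f (v - x)) - ln (normal_density 0 \<sigma> v)\<bar> \<le> K * (1 + \<bar>v\<bar>)"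
proof (cases "b \<ge> 0")
  case False
  then show ?thesis by (intro exI[of _ 0]) auto
next
  case b: True
  obtain K where K: "K \<ge> 0" "\<forall>v. \<bar>ln (f v) - ln (normal_density 0 \<sigma> v)\<bar> \<le> K * (1 + \<bar>v\<bar>)"
    using gauss_like_log_bound[OF assms(2)] by (elim exE conjE)
  note K = K(1) K(2)[rule_format]
  define L where "L = (2 * b + b\<^sup>2) / (2 * \<sigma>\<^sup>2)"
  have "L \<ge> 0" unfolding L_def using b by simp
  show ?thesis
  proof (intro exI[of _ "K * (1 + b) + L"] conjI allI impI)
    show "0 \<le> K * (1 + b) + L" using K(1) b \<open>L \<ge> 0\<close> by simp
    fix v x :: real assume x: "\<bar>x\<bar> \<le> b"
    have "1 + \<bar>v - x\<bar> \<le> (1 + b) * (1 + \<bar>v\<bar>)"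
      using x b by (simp add: algebra_simps) (smt (verit) mult_nonneg_nonneg)
    then have "K * (1 + \<bar>v - x\<bar>) \<le> K * (1 + b) * (1 + \<bar>v\<bar>)"
      using K(1) by (simp add: mult.assoc mult_left_mono)
    then show "\<bar>ln (f (v - x)) - ln (normal_density 0 \<sigma> v)\<bar> \<le> (K * (1 + b) + L) * (1 + \<bar>v\<bar>)"
      using K(2)[of "v - x"] ln_normal_density_shift[OF assms(1) x, of v]
      unfolding distrib_right[of "K * (1 + b)"] L_def by linarith
  qed
qed

lemma smear_bounds:
  assumes [measurable]: "f \<in> borel_measurable borel" "X \<in> borel_measurable borel"
    and f: "\<And>v. 0 \<le> f v" "\<And>v. f v \<le> B"
  shows "integrable std_gauss (\<lambda>g. f (v - X g))" "0 \<le> smear X f v"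
    "ennreal (smear X f v) = (\<integral>\<^sup>+g. f (v - X g) \<partial>std_gauss)"
    "\<And>l. (\<And>g. l \<le> f (v - X g)) \<Longrightarrow> l \<le> smear X f v"
    "\<And>l. (\<And>g. f (v - X g) \<le> l) \<Longrightarrow> smear X f v \<le> l"
proof -
  interpret prob_space std_gauss by (rule prob_space_std_gauss)
  show i: "integrable std_gauss (\<lambda>g. f (v - X g))"
    by (rule integrable_const_bound[of _ B]) (use f in auto)
  show "0 \<le> smear X f v" unfolding smear_def using f by (intro integral_nonneg_AE) auto
  show "ennreal (smear X f v) = (\<integral>\<^sup>+g. f (v - X g) \<partial>std_gauss)"
    unfolding smear_def using i f by (intro nn_integral_eq_integral[symmetric]) auto
  show "l \<le> smear X f v" if "\<And>g. l \<le> f (v - X g)" for l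
    unfolding smear_def using i that by (intro integral_ge_const) auto
  show "smear X f v \<le> l" if "\<And>g. f (v - X g) \<le> l" for l
    unfolding smear_def using i that by (intro integral_le_const) auto
qed

lemma nn_integral_smear:
  assumes f: "gauss_like \<sigma> f" and [measurable]: "X \<in> borel_measurable borel"
    "smear X f \<in> borel_measurable borel" "F \<in> borel_measurable borel"
  shows "(\<integral>\<^sup>+g. \<integral>\<^sup>+v. F (X g + v) \<partial>density lborel f \<partial>std_gauss) = (\<integral>\<^sup>+y. F y \<partial>density lborel (smear X f))"
proof -
  note [measurable] = gauss_likeD(4)[OF f]
  interpret N: prob_space std_gauss by (rule prob_space_std_gauss)
  obtain B where "\<forall>v. f v \<le> B" using gauss_like_bounded[OF f] by (elim exE)
  then have B: "f v \<le> B" for v by simp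
  have f0: "0 \<le> f v" for v using gauss_likeD(2)[OF f, of v] by simp
  have sm: "ennreal (smear X f y) = (\<integral>\<^sup>+g. f (y - X g) \<partial>std_gauss)" for y
    by (rule smear_bounds(3)[of _ _ B]) (use B f0 in auto)
  interpret pair_sigma_finite std_gauss lborel ..
  have "(\<integral>\<^sup>+g. \<integral>\<^sup>+v. F (X g + v) \<partial>density lborel f \<partial>std_gauss)
      = (\<integral>\<^sup>+g. \<integral>\<^sup>+v. ennreal (f v) * F (X g + v) \<partial>lborel \<partial>std_gauss)"
    by (simp add: nn_integral_density)
  also have "\<dots> = (\<integral>\<^sup>+g. \<integral>\<^sup>+y. ennreal (f (y - X g)) * F y \<partial>lborel \<partial>std_gauss)"
  proof (rule nn_integral_cong)
    fix g
    show "(\<integral>\<^sup>+v. ennreal (f v) * F (X g + v) \<partial>lborel) = (\<integral>\<^sup>+y. ennreal (f (y - X g)) * F y \<partial>lborel)"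
      by (subst (2) nn_integral_real_affine[where c=1 and t="X g"]) auto
  qed
  also have "\<dots> = (\<integral>\<^sup>+y. \<integral>\<^sup>+g. ennreal (f (y - X g)) * F y \<partial>std_gauss \<partial>lborel)"
    by (rule Fubini'[symmetric]) measurable
  also have "\<dots> = (\<integral>\<^sup>+y. ennreal (smear X f y) * F y \<partial>lborel)"
    unfolding sm by (intro nn_integral_cong nn_integral_multc) measurable
  also have "\<dots> = (\<integral>\<^sup>+y. F y \<partial>density lborel (smear X f))"
    by (simp add: nn_integral_density)
  finally show ?thesis .
qed

text \<open>The two-sided bounds on \<open>f (v - X g)\<close> are uniform in \<open>g\<close>
  because \<open>X\<close> is bounded, so they pass to the average. Continuity is dominated
  convergence with the bound on \<open>f\<close>, and total mass one is
  \<open>nn_integral_smear\<close> for the constant one.\<close>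

lemma gauss_like_smear:
  assumes \<sigma>: "\<sigma> > 0" and f: "gauss_like \<sigma> f" and [measurable]: "X \<in> borel_measurable borel"
    and X: "\<And>g. \<bar>X g\<bar> \<le> b"
  shows "gauss_like \<sigma> (smear X f)"
proof -
  note [measurable] = gauss_likeD(4)[OF f]
  interpret N: prob_space std_gauss by (rule prob_space_std_gauss)
  interpret F: prob_space "density lborel f" by (rule gauss_likeD(3)[OF f])
  obtain B where "\<forall>v. f v \<le> B" using gauss_like_bounded[OF f] by (elim exE)
  then have B: "f v \<le> B" for v by simp
  have fpos: "0 < f v" for v by (rule gauss_likeD(2)[OF f])
  note sm = smear_bounds[of f X B, OF _ _ less_imp_le[OF fpos] B, simplified]
  have contf: "isCont f x" for x
    using gauss_likeD(1)[OF f] by (simp add: continuous_on_eq_continuous_at)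
  have cont: "continuous_on UNIV (smear X f)"
  proof (intro continuous_at_imp_continuous_on ballI)
    fix x
    show "isCont (smear X f) x"
      unfolding continuous_at_sequentially comp_def
    proof (intro allI impI)
      fix s :: "nat \<Rightarrow> real" assume s: "s \<longlonglongrightarrow> x"
      show "(\<lambda>n. smear X f (s n)) \<longlonglongrightarrow> smear X f x"
        unfolding smear_def
      proof (rule integral_dominated_convergence[where w="\<lambda>_. B"])
        show "AE g in std_gauss. (\<lambda>n. f (s n - X g)) \<longlonglongrightarrow> f (x - X g)"
          by (intro AE_I2 isCont_tendsto_compose[OF contf] tendsto_intros s)
        show "AE g in std_gauss. norm (f (s n - X g)) \<le> B" for n
          using B less_imp_le[OF fpos] by auto
      qed auto
    qed
  qed
  then have [measurable]: "smear X f \<in> borel_measurable borel"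
    by (rule borel_measurable_continuous_onI)
  have prob: "prob_space (density lborel (smear X f))"
  proof
    have "emeasure (density lborel (smear X f)) (space (density lborel (smear X f)))
        = (\<integral>\<^sup>+y. 1 \<partial>density lborel (smear X f))" by simp
    also have "\<dots> = (\<integral>\<^sup>+g. \<integral>\<^sup>+v. 1 \<partial>density lborel f \<partial>std_gauss)"
      by (rule nn_integral_smear[symmetric, OF f]) auto
    also have "\<dots> = 1" using F.emeasure_space_1 N.emeasure_space_1 by simp
    finally show "emeasure (density lborel (smear X f)) (space (density lborel (smear X f))) = 1" .
  qed
  obtain K where K: "K \<ge> 0"
    "\<forall>v x. \<bar>x\<bar> \<le> b \<longrightarrow> \<bar>ln (f (v - x)) - ln (normal_density 0 \<sigma> v)\<bar> \<le> K * (1 + \<bar>v\<bar>)"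
    using gauss_like_shift_bound[OF \<sigma> f, of b] by (elim exE conjE)
  note K = K(1) K(2)[rule_format]
  have phi: "0 < normal_density 0 \<sigma> v" for v using \<sigma> by (rule normal_density_pos)
  have lower: "normal_density 0 \<sigma> v * exp (- (K * (1 + \<bar>v\<bar>))) \<le> smear X f v" for v
  proof (rule sm(4))
    fix g
    have "ln (normal_density 0 \<sigma> v * exp (- (K * (1 + \<bar>v\<bar>)))) \<le> ln (f (v - X g))"
      using K(2)[OF X, of v g] phi[of v] by (simp add: ln_mult)
    then show "normal_density 0 \<sigma> v * exp (- (K * (1 + \<bar>v\<bar>))) \<le> f (v - X g)"
      using phi[of v] fpos by (subst (asm) ln_le_cancel_iff) auto
  qed
  have upper: "smear X f v \<le> normal_density 0 \<sigma> v * exp (K * (1 + \<bar>v\<bar>))" for v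
  proof (rule sm(5))
    fix g
    have "ln (f (v - X g)) \<le> ln (normal_density 0 \<sigma> v * exp (K * (1 + \<bar>v\<bar>)))"
      using K(2)[OF X, of v g] phi[of v] by (simp add: ln_mult)
    then show "f (v - X g) \<le> normal_density 0 \<sigma> v * exp (K * (1 + \<bar>v\<bar>))"
      using phi[of v] fpos by (subst (asm) ln_le_cancel_iff) auto
  qed
  have pos: "0 < smear X f v" for v
    by (rule less_le_trans[OF _ lower]) (simp add: phi)
  have "\<bar>ln (smear X f v) - ln (normal_density 0 \<sigma> v)\<bar> \<le> K * (1 + \<bar>v\<bar>)" for v
  proof -
    have "ln (normal_density 0 \<sigma> v * exp (- (K * (1 + \<bar>v\<bar>)))) \<le> ln (smear X f v)"
      using lower[of v] pos[of v] phi[of v] by (subst ln_le_cancel_iff) auto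
    moreover have "ln (smear X f v) \<le> ln (normal_density 0 \<sigma> v * exp (K * (1 + \<bar>v\<bar>)))"
      using upper[of v] pos[of v] phi[of v] by (subst ln_le_cancel_iff) auto
    ultimately show ?thesis using phi[of v] by (simp add: ln_mult abs_le_iff)
  qed
  moreover have "smear X f v \<le> B" for v using B by (intro sm(5))
  ultimately show ?thesis
    unfolding gauss_like_def using cont pos prob by blast
qed

text \<open>Half of the Gaussian exponent absorbs the linear terms by completing a square. What
  remains is a multiple of the normal density of doubled variance; the factor \<open>sqrt 2\<close>
  in \<open>M\<close> is the ratio of the normalising constants.\<close>

lemma gauss_like_exp_moment:
  assumes \<sigma>: "\<sigma> > 0" and f: "gauss_like \<sigma> f"
  shows "integrable (density lborel f) (\<lambda>v. exp (c * \<bar>v\<bar>))"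
proof -
  note [measurable] = gauss_likeD(4)[OF f]
  have fpos: "0 < f v" for v by (rule gauss_likeD(2)[OF f])
  obtain K where K: "K \<ge> 0" "\<forall>v. \<bar>ln (f v) - ln (normal_density 0 \<sigma> v)\<bar> \<le> K * (1 + \<bar>v\<bar>)"
    using gauss_like_log_bound[OF f] by (elim exE conjE)
  note K = K(1) K(2)[rule_format]
  define d where "d = K + c"
  define M where "M = sqrt 2 * exp (K + d\<^sup>2 * \<sigma>\<^sup>2)"
  have phi: "0 < normal_density 0 \<sigma> v" for v using \<sigma> by (rule normal_density_pos)
  have phi2: "0 < normal_density 0 (sqrt 2 * \<sigma>) v" for v using \<sigma> by (intro normal_density_pos) simp
  have bound: "f v * exp (c * \<bar>v\<bar>) \<le> M * normal_density 0 (sqrt 2 * \<sigma>) v" for v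
  proof -
    have "0 \<le> (\<bar>v\<bar> / (2 * \<sigma>) - d * \<sigma>)\<^sup>2" by simp
    also have "\<dots> = v\<^sup>2 / (4 * \<sigma>\<^sup>2) - d * \<bar>v\<bar> + d\<^sup>2 * \<sigma>\<^sup>2"
      using \<sigma> by (simp add: power2_diff power_divide power_mult_distrib)
    finally have sq: "d * \<bar>v\<bar> \<le> v\<^sup>2 / (4 * \<sigma>\<^sup>2) + d\<^sup>2 * \<sigma>\<^sup>2" by simp
    have half: "v\<^sup>2 / (2 * \<sigma>\<^sup>2) = v\<^sup>2 / (4 * \<sigma>\<^sup>2) + v\<^sup>2 / (4 * \<sigma>\<^sup>2)" by simp
    have "ln (f v * exp (c * \<bar>v\<bar>)) = ln (f v) + c * \<bar>v\<bar>"
      using fpos[of v] by (simp add: ln_mult)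
    also have "\<dots> \<le> - ln (2 * pi * \<sigma>\<^sup>2) / 2 - v\<^sup>2 / (2 * \<sigma>\<^sup>2) + K * (1 + \<bar>v\<bar>) + c * \<bar>v\<bar>"
      using K(2)[of v] ln_normal_density[OF \<sigma>, of 0 v] by simp
    also have "\<dots> \<le> - ln (2 * pi * \<sigma>\<^sup>2) / 2 - v\<^sup>2 / (4 * \<sigma>\<^sup>2) + K + d\<^sup>2 * \<sigma>\<^sup>2"
      using sq half by (simp add: d_def algebra_simps)
    also have "\<dots> = ln (M * normal_density 0 (sqrt 2 * \<sigma>) v)"
    proof -
      have "ln (normal_density 0 (sqrt 2 * \<sigma>) v) = - ln (2 * pi * \<sigma>\<^sup>2) / 2 - ln 2 / 2 - v\<^sup>2 / (4 * \<sigma>\<^sup>2)"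
      proof -
        have "2 * pi * (sqrt 2 * \<sigma>)\<^sup>2 = 2 * (2 * pi * \<sigma>\<^sup>2)"
          by (simp add: power_mult_distrib)
        then have "ln (2 * pi * (sqrt 2 * \<sigma>)\<^sup>2) = ln 2 + ln (2 * pi * \<sigma>\<^sup>2)"
          using \<sigma> by (simp only:) (rule ln_mult_pos; simp)
        then show ?thesis
          using \<sigma> ln_normal_density[of "sqrt 2 * \<sigma>" 0 v] by (simp add: power_mult_distrib)
      qed
      moreover have "ln M = ln 2 / 2 + (K + d\<^sup>2 * \<sigma>\<^sup>2)"
        by (simp add: M_def ln_mult ln_sqrt)
      moreover have "M > 0" by (simp add: M_def)
      ultimately show ?thesis using phi2[of v] by (simp add: ln_mult)
    qed
    finally show ?thesis
      using fpos[of v] phi2[of v] by (subst (asm) ln_le_cancel_iff) (auto simp: M_def)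
  qed
  have "M > 0" by (simp add: M_def)
  have "integrable lborel (\<lambda>v. f v * exp (c * \<bar>v\<bar>))"
  proof (rule Bochner_Integration.integrable_bound)
    show "integrable lborel (\<lambda>v. M * normal_density 0 (sqrt 2 * \<sigma>) v)"
      using \<sigma> by (intro integrable_mult_right integrable_normal_density) auto
    show "AE v in lborel. norm (f v * exp (c * \<bar>v\<bar>)) \<le> norm (M * normal_density 0 (sqrt 2 * \<sigma>) v)"
      using bound fpos \<open>M > 0\<close> by (auto intro!: AE_I2 simp: abs_mult abs_of_pos)
  qed auto
  then show ?thesis
    by (subst integrable_density) (use less_imp_le[OF fpos] in auto)
qed

text \<open>The quadratic growth of the logarithm is traded for the cruder
  \<open>exp \<bar>v\<bar>\<close>, so that a single exponential moment settles the integrability of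
  all logarithms.\<close>

lemma gauss_like_ln_bound:
  assumes \<sigma>: "\<sigma> > 0" and f: "gauss_like \<sigma> f"
  shows "\<exists>C\<ge>0. \<forall>v x. \<bar>x\<bar> \<le> b \<longrightarrow> \<bar>ln (f (v - x))\<bar> \<le> C * exp \<bar>v\<bar>"
proof -
  obtain K where K: "K \<ge> 0"
    "\<forall>v x. \<bar>x\<bar> \<le> b \<longrightarrow> \<bar>ln (f (v - x)) - ln (normal_density 0 \<sigma> v)\<bar> \<le> K * (1 + \<bar>v\<bar>)"
    using gauss_like_shift_bound[OF \<sigma> f, of b] by (elim exE conjE)
  note K = K(1) K(2)[rule_format]
  define l where "l = \<bar>ln (2 * pi * \<sigma>\<^sup>2)\<bar> / 2"
  have "l \<ge> 0" by (simp add: l_def)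
  show ?thesis
  proof (intro exI[of _ "K + l + 1 / \<sigma>\<^sup>2"] conjI allI impI)
    show "0 \<le> K + l + 1 / \<sigma>\<^sup>2" using K(1) \<open>l \<ge> 0\<close> by simp
    fix v x :: real assume x: "\<bar>x\<bar> \<le> b"
    have e1: "1 + \<bar>v\<bar> \<le> exp \<bar>v\<bar>" by (rule exp_ge_add_one_self)
    have e2: "v\<^sup>2 \<le> 2 * exp \<bar>v\<bar>" using exp_lower_Taylor_quadratic[of "\<bar>v\<bar>"] by simp
    have "\<bar>ln (f (v - x))\<bar> \<le> K * (1 + \<bar>v\<bar>) + \<bar>ln (normal_density 0 \<sigma> v)\<bar>"
      using K(2)[OF x, of v] by linarith
    also have "\<bar>ln (normal_density 0 \<sigma> v)\<bar> \<le> l + v\<^sup>2 / (2 * \<sigma>\<^sup>2)"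
    proof -
      have "\<bar>- x / 2 - t\<bar> \<le> \<bar>x\<bar> / 2 + t" if "0 \<le> t" for x t :: real
        using that by (simp add: abs_if)
      then show ?thesis
        unfolding l_def ln_normal_density[OF \<sigma>] by simp
    qed
    also have "K * (1 + \<bar>v\<bar>) \<le> K * exp \<bar>v\<bar>" using e1 K(1) by (rule mult_left_mono)
    also have "l \<le> l * exp \<bar>v\<bar>" using \<open>l \<ge> 0\<close> e1 by (simp add: mult_le_cancel_left1)
    also have "v\<^sup>2 / (2 * \<sigma>\<^sup>2) \<le> 1 / \<sigma>\<^sup>2 * exp \<bar>v\<bar>"
      using divide_right_mono[OF e2, of "2 * \<sigma>\<^sup>2"] by simp
    finally show "\<bar>ln (f (v - x))\<bar> \<le> (K + l + 1 / \<sigma>\<^sup>2) * exp \<bar>v\<bar>"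
      by (simp add: algebra_simps)
  qed
qed

section \<open>Mutual information of a user\<close>

definition diff_entropy :: "(real \<Rightarrow> real) \<Rightarrow> real" where
  "diff_entropy w = - (\<integral>v. ln (w v) \<partial>density lborel w)"

text \<open>Log-likelihood ratio between the output density given the sent symbol and the marginal
  output density. It is indexed by the seed \<open>g\<close> rather than by the symbol, since the
  codebooks are made of seeds.\<close>

definition info_density :: "(real \<Rightarrow> real) \<Rightarrow> (real \<Rightarrow> real) \<Rightarrow> real \<Rightarrow> real \<Rightarrow> real" where
  "info_density X w g y = ln (w (y - X g)) - ln (smear X w y)"

definition mutual_info :: "(real \<Rightarrow> real) \<Rightarrow> (real \<Rightarrow> real) \<Rightarrow> real" where
  "mutual_info X w = (\<integral>z. info_density X w (fst z) (X (fst z) + snd z) \<partial>(std_gauss \<Otimes>\<^sub>M density lborel w))"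

lemma pair_prob_space_gauss_like:
  assumes "gauss_like \<sigma> w"
  shows "pair_prob_space std_gauss (density lborel w)"
proof -
  interpret N: prob_space std_gauss by (rule prob_space_std_gauss)
  interpret W: prob_space "density lborel w" by (rule gauss_likeD(3)[OF assms])
  show ?thesis ..
qed

text \<open>Both logarithms are compared with the same Gaussian at \<open>v\<close>, so their
  quadratic parts cancel. Linear growth is what gives the score exponential moments of every
  order.\<close>

lemma info_density_bound:
  assumes \<sigma>: "\<sigma> > 0" and w: "gauss_like \<sigma> w"
    and X: "X \<in> borel_measurable borel" "\<And>g. \<bar>X g\<bar> \<le> b"
  shows "\<exists>C\<ge>0. \<forall>g v. \<bar>info_density X w g (X g + v)\<bar> \<le> C * (1 + \<bar>v\<bar>)"
proof -
  have q: "gauss_like \<sigma> (smear X w)" using \<sigma> w X by (rule gauss_like_smear)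
  obtain K where K: "K \<ge> 0" "\<forall>v. \<bar>ln (w v) - ln (normal_density 0 \<sigma> v)\<bar> \<le> K * (1 + \<bar>v\<bar>)"
    using gauss_like_log_bound[OF w] by (elim exE conjE)
  obtain L where L: "L \<ge> 0" "\<forall>v x. \<bar>x\<bar> \<le> b \<longrightarrow> \<bar>ln (smear X w (v - x)) - ln (normal_density 0 \<sigma> v)\<bar> \<le> L * (1 + \<bar>v\<bar>)"
    using gauss_like_shift_bound[OF \<sigma> q, of b] by (elim exE conjE)
  show ?thesis
  proof (intro exI[of _ "K + L"] conjI allI)
    fix g v
    have "\<bar>ln (smear X w (v - - X g)) - ln (normal_density 0 \<sigma> v)\<bar> \<le> L * (1 + \<bar>v\<bar>)"
      using X(2)[of g] L(2) by (metis abs_minus_cancel)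
    then show "\<bar>info_density X w g (X g + v)\<bar> \<le> (K + L) * (1 + \<bar>v\<bar>)"
      using K(2)[rule_format, of v] by (simp add: info_density_def distrib_right add.commute)
  qed (use K L in auto)
qed

lemma integrable_ln_gauss_like:
  assumes \<sigma>: "\<sigma> > 0" and w: "gauss_like \<sigma> w" and q: "gauss_like \<sigma> q"
    and [measurable]: "X \<in> borel_measurable borel" and X: "\<And>g. \<bar>X g\<bar> \<le> b"
  shows "integrable (std_gauss \<Otimes>\<^sub>M density lborel w) (\<lambda>z. ln (q (X (fst z) + snd z)))"
    and "integrable (density lborel w) (\<lambda>v. ln (q v))"
proof -
  note [measurable] = gauss_likeD(4)[OF q]
  interpret pair_prob_space std_gauss "density lborel w"
    by (rule pair_prob_space_gauss_like[OF w])
  obtain C where C: "C \<ge> 0" "\<forall>v x. \<bar>x\<bar> \<le> b \<longrightarrow> \<bar>ln (q (v - x))\<bar> \<le> C * exp \<bar>v\<bar>"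
    using gauss_like_ln_bound[OF \<sigma> q, of b] by (elim exE conjE)
  have e: "integrable (density lborel w) (\<lambda>v. C * exp \<bar>v\<bar>)"
    using gauss_like_exp_moment[OF \<sigma> w, of 1] by simp
  show "integrable (std_gauss \<Otimes>\<^sub>M density lborel w) (\<lambda>z. ln (q (X (fst z) + snd z)))"
  proof (rule Bochner_Integration.integrable_bound)
    show "integrable (std_gauss \<Otimes>\<^sub>M density lborel w) (\<lambda>z. C * exp \<bar>snd z\<bar>)"
      by (rule integral_snd_coordinate(1)[OF e])
    have "\<bar>ln (q (X g + v))\<bar> \<le> C * exp \<bar>v\<bar>" for g v
      using C(2)[rule_format, of "- X g" v] X[of g] by (simp add: add.commute)
    then show "AE z in std_gauss \<Otimes>\<^sub>M density lborel w.
        norm (ln (q (X (fst z) + snd z))) \<le> norm (C * exp \<bar>snd z\<bar>)"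
      using C(1) by (auto intro!: AE_I2)
  qed simp
  have "0 \<le> b" using X[of 0] by linarith
  then have "\<bar>ln (q v)\<bar> \<le> C * exp \<bar>v\<bar>" for v
    using C(2)[rule_format, of 0 v] by simp
  then show "integrable (density lborel w) (\<lambda>v. ln (q v))"
    by (intro Bochner_Integration.integrable_bound[OF e]) (use C(1) in \<open>auto intro!: AE_I2\<close>)
qed

lemma mutual_info_eq:
  assumes \<sigma>: "\<sigma> > 0" and w: "gauss_like \<sigma> w"
    and X: "X \<in> borel_measurable borel" "\<And>g. \<bar>X g\<bar> \<le> b"
  shows "mutual_info X w = - diff_entropy w
    - (\<integral>z. ln (smear X w (X (fst z) + snd z)) \<partial>(std_gauss \<Otimes>\<^sub>M density lborel w))"
proof -
  interpret pair_prob_space std_gauss "density lborel w"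
    by (rule pair_prob_space_gauss_like[OF w])
  have q: "gauss_like \<sigma> (smear X w)" using \<sigma> w X by (rule gauss_like_smear)
  have i: "integrable (density lborel w) (\<lambda>v. ln (w v))"
    by (rule integrable_ln_gauss_like(2)[OF \<sigma> w w X])
  show ?thesis
    unfolding mutual_info_def info_density_def
    using integral_snd_coordinate[OF i] integrable_ln_gauss_like(1)[OF \<sigma> w q X]
    by (simp add: diff_entropy_def)
qed

text \<open>The noise is realised as an increasing function \<open>U\<close> of a second Gaussian,
  so \<open>entropy_power_transport\<close> applies to \<open>a * T\<close> and \<open>U\<close>. A
  suitable choice of its weights turns the result into the entropy power inequality.\<close>

lemma mutual_info_ge:
  fixes T T' w :: "real \<Rightarrow> real" and a \<sigma> r :: real
  assumes \<sigma>: "\<sigma> > 0" and w: "gauss_like \<sigma> w" and a: "a \<ge> 0"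
    and dT: "\<And>x. (T has_real_derivative T' x) (at x)" "\<And>x. 0 < T' x"
    and T'[measurable]: "T' \<in> borel_measurable borel" and T: "\<And>x. 0 \<le> T x" "\<And>x. T x \<le> 1"
    and ln_T': "integrable std_gauss (\<lambda>x. ln (T' x))"
      "integral\<^sup>L std_gauss (\<lambda>x. ln (T' x)) = ln r / 2" and r: "r > 0"
  shows "ln (1 + r * a\<^sup>2 * (2 * pi * exp 1) / exp (2 * diff_entropy w)) / 2
    \<le> mutual_info (\<lambda>g. a * T g) w"
proof -
  interpret N: prob_space std_gauss by (rule prob_space_std_gauss)
  interpret W: prob_space "density lborel w" by (rule gauss_likeD(3)[OF w])
  interpret NW: pair_prob_space std_gauss "density lborel w"
    by (rule pair_prob_space_gauss_like[OF w])
  interpret NN: pair_prob_space std_gauss std_gauss ..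
  note [measurable] = gauss_likeD(4)[OF w]
  have [measurable]: "T \<in> borel_measurable borel"
    by (intro borel_measurable_continuous_onI continuous_at_imp_continuous_on ballI DERIV_isCont[OF dT(1)])
  define X where "X = (\<lambda>g. a * T g)"
  have X[measurable]: "X \<in> borel_measurable borel" unfolding X_def by measurable
  have Xb: "\<bar>X g\<bar> \<le> a" for g
    using a T[of g] by (simp add: X_def abs_mult mult_left_le)
  have wpos: "0 < w v" for v by (rule gauss_likeD(2)[OF w])
  show ?thesis
  proof (cases "a = 0")
    case True
    have "smear X w = w"
      using True N.prob_space by (auto simp: smear_def X_def fun_eq_iff)
    then have "info_density X w g (X g + v) = 0" for g v
      using True by (simp add: info_density_def X_def)
    then have "mutual_info X w = 0" unfolding mutual_info_def by simp
    then show ?thesis using True by (simp add: X_def)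
  next
    case False
    with a have a: "a > 0" by simp
    define q where "q = smear X w"
    have q: "gauss_like \<sigma> q" unfolding q_def using \<sigma> w X Xb by (rule gauss_like_smear)
    note [measurable] = gauss_likeD(4)[OF q]
    interpret Q: prob_space "density lborel q" by (rule gauss_likeD(3)[OF q])
    have phi: "0 < std_normal_density x" for x by (rule normal_density_pos) simp
    obtain U where U: "\<And>x. (U has_real_derivative std_normal_density x / w (U x)) (at x)"
      "distr std_gauss borel U = density lborel w"
      using monotone_transport[OF prob_space_std_gauss continuous_normal_density phi
          gauss_likeD(3,1)[OF w] wpos] by metis
    have [measurable]: "U \<in> borel_measurable borel"
      by (intro borel_measurable_continuous_onI continuous_at_imp_continuous_on ballI DERIV_isCont[OF U(1)])
    have int_w: "integrable (density lborel w) (\<lambda>v. ln (w v))"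
      by (rule integrable_ln_gauss_like(2)[OF \<sigma> w w X Xb])
    then have int_wU: "integrable std_gauss (\<lambda>x. ln (w (U x)))"
      unfolding U(2)[symmetric] by (subst (asm) integrable_distr_eq) auto
    have "- diff_entropy w = (\<integral>v. ln (w v) \<partial>distr std_gauss borel U)"
      by (simp add: diff_entropy_def U(2))
    also have "\<dots> = (\<integral>x. ln (w (U x)) \<partial>std_gauss)"
      by (rule integral_distr) auto
    finally have h_eq: "(\<integral>x. ln (w (U x)) \<partial>std_gauss) = - diff_entropy w" ..
    \<comment> \<open>Entropy powers of the input and of the noise, in the normalisation that gives
      a standard Gaussian the value one.\<close>
    define s1 s2 where "s1 = r * a\<^sup>2" and "s2 = exp (2 * diff_entropy w) / (2 * pi * exp 1)"
    have s: "s1 > 0" "s2 > 0" using r a by (auto simp: s1_def s2_def)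
    have ln_s2: "ln s2 = 2 * diff_entropy w - ln (2 * pi) - 1"
      unfolding s2_def by (subst ln_div) (auto simp: ln_mult)
    have ln_s1: "ln s1 = ln r + 2 * ln a"
      unfolding s1_def using r a by (simp add: ln_mult ln_realpow)
    have ln_U': "ln (std_normal_density x / w (U x)) = ln (std_normal_density x) - ln (w (U x))" for x
      using phi[of x] wpos[of "U x"] by (simp add: ln_div)
    have int_U': "integrable std_gauss (\<lambda>x. ln (std_normal_density x / w (U x)))"
      "(\<integral>x. ln (std_normal_density x / w (U x)) \<partial>std_gauss) = ln s2 / 2"
      unfolding ln_U' using integral_ln_std_normal_density int_wU h_eq ln_s2
      by (auto simp: field_simps)
    have ln_aT': "ln (a * T' x) = ln a + ln (T' x)" for x
      using a dT(2)[of x] by (rule ln_mult_pos)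
    have int_aT': "integrable std_gauss (\<lambda>x. ln (a * T' x))"
      "(\<integral>x. ln (a * T' x) \<partial>std_gauss) = ln s1 / 2"
      unfolding ln_aT' using ln_T' N.prob_space ln_s1 by (auto simp: field_simps)
    \<comment> \<open>Squared weights proportional to the entropy powers make both brackets of
      \<open>entropy_power_transport\<close> equal to \<open>ln (s1 + s2) / 2\<close>, so the
      weighted sum collapses to this value.\<close>
    define \<alpha> \<beta> where "\<alpha> = sqrt (s1 / (s1 + s2))" and "\<beta> = sqrt (s2 / (s1 + s2))"
    have \<alpha>\<beta>: "\<alpha> > 0" "\<beta> > 0" "\<alpha>\<^sup>2 + \<beta>\<^sup>2 = 1"
      using s by (auto simp: \<alpha>_def \<beta>_def add_divide_distrib[symmetric])
    have ln_\<alpha>\<beta>: "ln s1 / 2 - ln \<alpha> = ln (s1 + s2) / 2" "ln s2 / 2 - ln \<beta> = ln (s1 + s2) / 2"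
      using s by (auto simp: \<alpha>_def \<beta>_def ln_sqrt ln_div field_simps)
    have pair_eq: "std_gauss \<Otimes>\<^sub>M density lborel w
        = distr (std_gauss \<Otimes>\<^sub>M std_gauss) (borel \<Otimes>\<^sub>M borel) (\<lambda>(x, y). (x, U y))"
    proof -
      have "distr std_gauss borel (\<lambda>x. x) \<Otimes>\<^sub>M distr std_gauss borel U
          = distr (std_gauss \<Otimes>\<^sub>M std_gauss) (borel \<Otimes>\<^sub>M borel) (\<lambda>(x, y). (x, U y))"
        by (rule pair_measure_distr) (auto simp: U(2) W.sigma_finite_measure_axioms)
      moreover have "distr std_gauss borel (\<lambda>x. x) = std_gauss"
        by (rule distr_id2) simp
      ultimately show ?thesis by (simp add: U(2))
    qed
    have int_q: "integrable (std_gauss \<Otimes>\<^sub>M density lborel w) (\<lambda>z. ln (q (X (fst z) + snd z)))"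
      by (rule integrable_ln_gauss_like(1)[OF \<sigma> w q X Xb])
    then have int_q': "integrable (std_gauss \<Otimes>\<^sub>M std_gauss) (\<lambda>z. ln (q (X (fst z) + U (snd z))))"
      unfolding pair_eq by (subst (asm) integrable_distr_eq) (auto simp: case_prod_beta')
    have "(\<integral>z. ln (q (X (fst z) + snd z)) \<partial>(std_gauss \<Otimes>\<^sub>M density lborel w))
        = (\<integral>z. ln (q (X (fst z) + U (snd z))) \<partial>(std_gauss \<Otimes>\<^sub>M std_gauss))"
      unfolding pair_eq by (subst integral_distr) (auto simp: case_prod_beta')
    moreover have "(\<integral>z. ln (q (X (fst z) + U (snd z))) \<partial>(std_gauss \<Otimes>\<^sub>M std_gauss))
        + \<alpha>\<^sup>2 * ((\<integral>x. ln (a * T' x) \<partial>std_gauss) - ln \<alpha>)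
        + \<beta>\<^sup>2 * ((\<integral>x. ln (std_normal_density x / w (U x)) \<partial>std_gauss) - ln \<beta>)
        \<le> - ln (2 * pi) / 2 - 1 / 2"
    proof (rule entropy_power_transport[where T=X and U=U])
      show "(X has_real_derivative a * T' x) (at x)" for x
        unfolding X_def by (rule DERIV_cmult[OF dT(1)])
      show "(\<integral>\<^sup>+y. ennreal (q y) \<partial>lborel) \<le> 1"
        using Q.emeasure_space_1 by (simp add: emeasure_density)
    qed (use \<alpha>\<beta> a dT(2) U(1) phi wpos gauss_likeD(2)[OF q] int_q' int_aT'(1) int_U'(1) in auto)
    moreover have "\<alpha>\<^sup>2 * (ln (s1 + s2) / 2) + \<beta>\<^sup>2 * (ln (s1 + s2) / 2) = ln (s1 + s2) / 2"
      using \<alpha>\<beta>(3) by (simp add: distrib_right[symmetric])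
    ultimately have "(\<integral>z. ln (q (X (fst z) + snd z)) \<partial>(std_gauss \<Otimes>\<^sub>M density lborel w))
        \<le> - ln (2 * pi) / 2 - 1 / 2 - ln (s1 + s2) / 2"
      unfolding int_aT' int_U' ln_\<alpha>\<beta> by linarith
    then have "ln (s1 + s2) / 2 - ln s2 / 2 \<le> mutual_info X w"
      unfolding mutual_info_eq[OF \<sigma> w X Xb] q_def[symmetric] using ln_s2 by (simp add: field_simps)
    moreover have "ln (1 + s1 / s2) = ln (s1 + s2) - ln s2"
    proof -
      have "1 + s1 / s2 = (s1 + s2) / s2" using s by (simp add: field_simps)
      then show ?thesis using s by (simp add: ln_div)
    qed
    moreover have "r * a\<^sup>2 * (2 * pi * exp 1) / exp (2 * diff_entropy w) = s1 / s2"
      by (simp add: s1_def s2_def)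
    ultimately show ?thesis by (simp add: X_def diff_divide_distrib)
  qed
qed

section \<open>The comparison density bound on the interference entropy\<close>

abbreviation \<Phi> :: "real \<Rightarrow> real" where "\<Phi> \<equiv> cdf std_gauss"

lemma Phi_minus: "\<Phi> (- x) = 1 - \<Phi> x"
proof -
  interpret real_distribution std_gauss by (rule std_gauss_real_distribution)
  have "((\<lambda>x. \<Phi> x + \<Phi> (- x)) has_real_derivative 0) (at x)" for x
  proof -
    have "((\<lambda>x. \<Phi> (- x)) has_real_derivative std_normal_density (- x) * - 1) (at x)"
      by (rule DERIV_chain2[OF std_gauss_cdf_derivative]) (auto intro!: derivative_eq_intros)
    from DERIV_add[OF std_gauss_cdf_derivative this] show ?thesis
      by (simp add: std_normal_density_def)
  qed
  then have const: "\<Phi> y + \<Phi> (- y) = \<Phi> x + \<Phi> (- x)" for x y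
    by (intro DERIV_isconst_all[rule_format]) auto
  have "((\<lambda>y. \<Phi> y + \<Phi> (- y)) \<longlongrightarrow> 1 + 0) at_top"
    by (intro tendsto_add cdf_lim_at_top_prob filterlim_compose[OF cdf_lim_at_bot filterlim_uminus_at_bot_at_top])
  moreover have "(\<lambda>y. \<Phi> y + \<Phi> (- y)) = (\<lambda>_. \<Phi> x + \<Phi> (- x))"
    using const by auto
  ultimately have "\<Phi> x + \<Phi> (- x) = 1"
    by (simp add: tendsto_const_iff)
  then show ?thesis by simp
qed

lemma Qf_eq: "Qf x = 1 - \<Phi> x"
proof -
  interpret real_distribution std_gauss by (rule std_gauss_real_distribution)
  have "set_integrable lborel {x..} std_normal_density"
    unfolding set_integrable_def by (intro integrable_mult_indicator) auto
  then have "integral {x..} std_normal_density = (LINT t:{x..}|lborel. std_normal_density t)"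
    by (rule set_borel_integral_eq_integral(2)[symmetric])
  also have "\<dots> = measure std_gauss {x..}"
    unfolding measure_def
    by (subst emeasure_density)
      (auto simp: set_lebesgue_integral_def integral_eq_nn_integral ennreal_indicator ennreal_mult'
        intro!: arg_cong[where f=enn2real] nn_integral_cong split: split_indicator)
  also have "\<dots> = 1 - measure std_gauss {..<x}"
    by (subst prob_compl[symmetric]) (auto intro!: arg_cong[where f="measure std_gauss"])
  also have "measure std_gauss {..<x} = \<Phi> x"
  proof -
    have "measure std_gauss {..x} = measure std_gauss {..<x}"
      by (rule measure_eq_AE)
        (use AE_lborel_singleton[of x] in \<open>auto simp: AE_density elim!: eventually_mono\<close>)
    then show ?thesis by (simp add: cdf_def)
  qed
  finally show ?thesis
    by (simp add: Qf_def std_normal_density_def field_simps)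
qed

lemma normal_density_scale:
  "\<sigma> > 0 \<Longrightarrow> normal_density 0 \<sigma> x = std_normal_density (x / \<sigma>) / \<sigma>"
  by (simp add: normal_density_def real_sqrt_mult power_divide)

lemma integral_normal_interval:
  fixes F f :: "real \<Rightarrow> real"
  assumes "u \<le> v" and [measurable]: "f \<in> borel_measurable borel"
    and "\<And>x. (F has_real_derivative f x * normal_density 0 \<sigma> x) (at x)"
    and "\<And>x. isCont f x"
  shows "(\<integral>x. indicator {u..v} x * f x \<partial>density lborel (normal_density 0 \<sigma>)) = F v - F u"
    and "integrable (density lborel (normal_density 0 \<sigma>)) (\<lambda>x. indicator {u..v} x * f x)"
proof -
  have c: "isCont (\<lambda>x. f x * normal_density 0 \<sigma> x) x" for x
    using continuous_normal_density[of UNIV 0 \<sigma>] assms(4)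
    by (auto simp: continuous_on_eq_continuous_at intro!: continuous_intros)
  have "integrable lborel (\<lambda>x. f x * normal_density 0 \<sigma> x * indicator {u..v} x)"
    using borel_integrable_atLeastAtMost[of u v "\<lambda>x. f x * normal_density 0 \<sigma> x"] c by simp
  then show "integrable (density lborel (normal_density 0 \<sigma>)) (\<lambda>x. indicator {u..v} x * f x)"
    by (subst integrable_density) (auto simp: mult_ac)
  have "(\<integral>x. f x * normal_density 0 \<sigma> x * indicator {u..v} x \<partial>lborel) = F v - F u"
    using assms c by (intro integral_FTC_Icc_real) auto
  then show "(\<integral>x. indicator {u..v} x * f x \<partial>density lborel (normal_density 0 \<sigma>)) = F v - F u"
    by (subst integral_density) (auto simp: mult_ac)
qed

lemma Phi_scale_derivative:
  assumes "\<sigma> > 0"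
  shows "((\<lambda>x. \<Phi> (x / \<sigma>)) has_real_derivative normal_density 0 \<sigma> x) (at x)"
  unfolding normal_density_scale[OF assms]
  by (rule DERIV_chain2[OF std_gauss_cdf_derivative, THEN DERIV_cong])
     (use assms in \<open>auto intro!: derivative_eq_intros\<close>)

lemma normal_density_derivative:
  assumes "\<sigma> > 0"
  shows "(normal_density 0 \<sigma> has_real_derivative - (x / \<sigma>\<^sup>2) * normal_density 0 \<sigma> x) (at x)"
  unfolding normal_density_def
  using assms by (auto intro!: derivative_eq_intros simp: field_simps power2_eq_square)

lemma normal_interval_moments:
  assumes \<sigma>: "\<sigma> > 0" and "u \<le> v"
  defines "Z \<equiv> density lborel (normal_density 0 \<sigma>)"
  shows "(\<integral>x. indicator {u..v} x \<partial>Z) = \<Phi> (v / \<sigma>) - \<Phi> (u / \<sigma>)"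
    and "(\<integral>x. indicator {u..v} x * x \<partial>Z) = \<sigma>\<^sup>2 * (normal_density 0 \<sigma> u - normal_density 0 \<sigma> v)"
    and "(\<integral>x. indicator {u..v} x * x\<^sup>2 \<partial>Z) = \<sigma>\<^sup>2 * (\<Phi> (v / \<sigma>) - \<Phi> (u / \<sigma>)
        - v * normal_density 0 \<sigma> v + u * normal_density 0 \<sigma> u)"
    and "integrable Z (\<lambda>x. indicator {u..v} x * x)" "integrable Z (\<lambda>x. indicator {u..v} x * x\<^sup>2)"
    and "integrable Z (\<lambda>x. indicator {u..v} x :: real)"
proof -
  note d = Phi_scale_derivative[OF \<sigma>] normal_density_derivative[OF \<sigma>]
  have d1: "((\<lambda>x. - \<sigma>\<^sup>2 * normal_density 0 \<sigma> x) has_real_derivative x * normal_density 0 \<sigma> x) (at x)" for x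
    using \<sigma> by (auto intro!: derivative_eq_intros d(2))
  have d2: "((\<lambda>x. \<sigma>\<^sup>2 * (\<Phi> (x / \<sigma>) - x * normal_density 0 \<sigma> x)) has_real_derivative x\<^sup>2 * normal_density 0 \<sigma> x) (at x)" for x
    using \<sigma> by (auto intro!: derivative_eq_intros d simp: field_simps power2_eq_square)
  show "(\<integral>x. indicator {u..v} x \<partial>Z) = \<Phi> (v / \<sigma>) - \<Phi> (u / \<sigma>)"
    and "integrable Z (\<lambda>x. indicator {u..v} x :: real)"
    using integral_normal_interval[OF assms(2), of "\<lambda>_. 1" "\<lambda>x. \<Phi> (x / \<sigma>)" \<sigma>] d(1) by (auto simp: Z_def)
  show "(\<integral>x. indicator {u..v} x * x \<partial>Z) = \<sigma>\<^sup>2 * (normal_density 0 \<sigma> u - normal_density 0 \<sigma> v)"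
    and "integrable Z (\<lambda>x. indicator {u..v} x * x)"
    using integral_normal_interval[OF assms(2) _ d1] by (auto simp: Z_def algebra_simps)
  show "(\<integral>x. indicator {u..v} x * x\<^sup>2 \<partial>Z) = \<sigma>\<^sup>2 * (\<Phi> (v / \<sigma>) - \<Phi> (u / \<sigma>)
        - v * normal_density 0 \<sigma> v + u * normal_density 0 \<sigma> u)"
    and "integrable Z (\<lambda>x. indicator {u..v} x * x\<^sup>2)"
    using integral_normal_interval[OF assms(2) _ d2] by (auto simp: Z_def algebra_simps)
qed

lemma normal_second_moment:
  assumes \<sigma>: "\<sigma> > 0"
  shows "integrable (density lborel (normal_density 0 \<sigma>)) (\<lambda>x. x\<^sup>2)"
    and "(\<integral>x. x\<^sup>2 \<partial>density lborel (normal_density 0 \<sigma>)) = \<sigma>\<^sup>2"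
proof -
  show "integrable (density lborel (normal_density 0 \<sigma>)) (\<lambda>x. x\<^sup>2)"
    using integrable_normal_moment[OF \<sigma>, of 0 2] by (simp add: integrable_density)
  show "(\<integral>x. x\<^sup>2 \<partial>density lborel (normal_density 0 \<sigma>)) = \<sigma>\<^sup>2"
    using integral_normal_moment_even[OF \<sigma>, of 0 1]
    by (simp add: integral_density numeral_2_eq_2[symmetric])
qed

text \<open>Non-negativity of relative entropy: \<open>ln t \<le> t - 1\<close> at
  \<open>t = r x / w x\<close>, whose mean under the density \<open>w\<close> is the mass of
  \<open>r\<close>.\<close>

lemma Gibbs_inequality:
  fixes w r :: "real \<Rightarrow> real"
  assumes W: "prob_space (density lborel w)" and w: "\<And>x. 0 < w x" "w \<in> borel_measurable borel"
    and r: "\<And>x. 0 < r x" "r \<in> borel_measurable borel" "(\<integral>\<^sup>+x. r x \<partial>lborel) \<le> 1"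
    and iw: "integrable (density lborel w) (\<lambda>x. ln (w x))"
    and ir: "integrable (density lborel w) (\<lambda>x. ln (r x))"
  shows "diff_entropy w \<le> - (\<integral>x. ln (r x) \<partial>density lborel w)"
proof -
  interpret prob_space "density lborel w" by (fact W)
  note [measurable] = w(2) r(2)
  have "(\<integral>\<^sup>+x. ennreal (r x / w x) \<partial>density lborel w) = (\<integral>\<^sup>+x. r x \<partial>lborel)"
    using less_imp_le[OF w(1)] less_imp_le[OF r(1)] less_imp_neq[OF w(1), symmetric]
    by (simp add: nn_integral_density ennreal_mult[symmetric])
  then have n: "(\<integral>\<^sup>+x. ennreal (r x / w x) \<partial>density lborel w) \<le> 1" using r(3) by simp
  have i: "integrable (density lborel w) (\<lambda>x. r x / w x)"
    by (rule integrableI_nonneg)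
      (use n less_imp_le[OF w(1)] less_imp_le[OF r(1)] in
        \<open>auto intro: le_less_trans[OF _ ennreal_one_less_top]\<close>)
  have le: "(\<integral>x. r x / w x \<partial>density lborel w) \<le> 1"
    using n less_imp_le[OF w(1)] less_imp_le[OF r(1)] by (intro integral_real_bounded) auto
  have "(\<integral>x. ln (r x) - ln (w x) \<partial>density lborel w) \<le> (\<integral>x. r x / w x - 1 \<partial>density lborel w)"
  proof (intro integral_mono)
    fix x
    have "ln (r x / w x) \<le> r x / w x - 1"
      using w(1)[of x] r(1)[of x] by (intro ln_le_minus_one) simp
    then show "ln (r x) - ln (w x) \<le> r x / w x - 1"
      using w(1)[of x] r(1)[of x] by (simp add: ln_div)
  qed (use iw ir i in auto)
  then show ?thesis
    using iw ir i le prob_space by (simp add: diff_entropy_def)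
qed

lemma distr_smear:
  assumes \<sigma>: "\<sigma> > 0" and f: "gauss_like \<sigma> f" and X[measurable]: "X \<in> borel_measurable borel"
    and b: "\<And>g. \<bar>X g\<bar> \<le> b"
  shows "distr (std_gauss \<Otimes>\<^sub>M density lborel f) borel (\<lambda>z. X (fst z) + snd z) = density lborel (smear X f)"
proof (rule measure_eqI)
  note [measurable] = gauss_likeD(4)[OF f] gauss_likeD(4)[OF gauss_like_smear[OF \<sigma> f X b]]
  interpret pair_prob_space std_gauss "density lborel f"
    by (rule pair_prob_space_gauss_like[OF f])
  fix A assume "A \<in> sets (distr (std_gauss \<Otimes>\<^sub>M density lborel f) borel (\<lambda>z. X (fst z) + snd z))"
  then have [measurable]: "A \<in> sets borel" by simp
  have "emeasure (distr (std_gauss \<Otimes>\<^sub>M density lborel f) borel (\<lambda>z. X (fst z) + snd z)) A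
      = (\<integral>\<^sup>+z. indicator A (X (fst z) + snd z) \<partial>(std_gauss \<Otimes>\<^sub>M density lborel f))"
    by (subst nn_integral_indicator[symmetric], simp, subst nn_integral_distr) auto
  also have "\<dots> = (\<integral>\<^sup>+g. \<integral>\<^sup>+v. indicator A (X g + v) \<partial>density lborel f \<partial>std_gauss)"
    by (subst M2.nn_integral_fst[symmetric]) auto
  also have "\<dots> = (\<integral>\<^sup>+y. indicator A y \<partial>density lborel (smear X f))"
    by (rule nn_integral_smear[OF f]) auto
  also have "\<dots> = emeasure (density lborel (smear X f)) A" by (rule nn_integral_indicator) simp
  finally show "emeasure (distr (std_gauss \<Otimes>\<^sub>M density lborel f) borel (\<lambda>z. X (fst z) + snd z)) A
    = emeasure (density lborel (smear X f)) A" .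
qed simp

lemma gauss_like_moments:
  assumes \<sigma>: "\<sigma> > 0" and f: "gauss_like \<sigma> f"
  shows "integrable (density lborel f) (\<lambda>v. v\<^sup>2)" "integrable (density lborel f) (\<lambda>v. \<bar>v\<bar>)"
proof -
  have e: "integrable (density lborel f) (\<lambda>v. 2 * exp \<bar>v\<bar>)"
    using gauss_like_exp_moment[OF \<sigma> f, of 1] by simp
  have b: "v\<^sup>2 \<le> 2 * exp \<bar>v\<bar>" "\<bar>v\<bar> \<le> 2 * exp \<bar>v\<bar>" for v :: real
  proof -
    have "0 \<le> v\<^sup>2" "1 + \<bar>v\<bar> + v\<^sup>2 / 2 \<le> exp \<bar>v\<bar>"
      using exp_lower_Taylor_quadratic[of "\<bar>v\<bar>"] by simp_all
    then show "v\<^sup>2 \<le> 2 * exp \<bar>v\<bar>" "\<bar>v\<bar> \<le> 2 * exp \<bar>v\<bar>"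
      using exp_ge_add_one_self[of "\<bar>v\<bar>"] by - linarith+
  qed
  show "integrable (density lborel f) (\<lambda>v. v\<^sup>2)" "integrable (density lborel f) (\<lambda>v. \<bar>v\<bar>)"
    by (rule Bochner_Integration.integrable_bound[OF e], use b in auto)+
qed

text \<open>For non-negative \<open>a\<close> and \<open>\<delta>\<close>, the probability that
  \<open>x\<close> plus noise falls into \<open>{- \<delta>..a + \<delta>}\<close>, written with the
  tail function as in \<open>c1_expr\<close> and \<open>c2_expr\<close>.\<close>

definition mid_prob :: "real \<Rightarrow> real \<Rightarrow> real \<Rightarrow> real \<Rightarrow> real" where
  "mid_prob \<sigma> a \<delta> x = 1 - Qf ((\<delta> + x) / \<sigma>) - Qf ((\<delta> + a - x) / \<sigma>)"

lemma mid_prob_eq: "mid_prob \<sigma> a \<delta> x = \<Phi> ((a + \<delta> - x) / \<sigma>) - \<Phi> ((- \<delta> - x) / \<sigma>)"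
proof -
  have "(- \<delta> - x) / \<sigma> = - ((\<delta> + x) / \<sigma>)" by (simp add: add_divide_distrib diff_divide_distrib)
  then have "\<Phi> ((- \<delta> - x) / \<sigma>) = 1 - \<Phi> ((\<delta> + x) / \<sigma>)" by (simp only: Phi_minus)
  then show ?thesis by (simp add: mid_prob_def Qf_eq add.commute)
qed

lemma mid_prob_derivative:
  assumes "\<sigma> > 0"
  shows "(mid_prob \<sigma> a \<delta> has_real_derivative
    normal_density 0 \<sigma> (\<delta> + x) - normal_density 0 \<sigma> (a + \<delta> - x)) (at x)"
proof -
  have "((\<lambda>x. \<Phi> ((a + \<delta> - x) / \<sigma>)) has_real_derivative normal_density 0 \<sigma> (a + \<delta> - x) * (-1)) (at x)"
    by (rule DERIV_chain2[OF Phi_scale_derivative[OF assms]]) (auto intro!: derivative_eq_intros)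
  moreover have "((\<lambda>x. \<Phi> ((- \<delta> - x) / \<sigma>)) has_real_derivative normal_density 0 \<sigma> (- \<delta> - x) * (-1)) (at x)"
    by (rule DERIV_chain2[OF Phi_scale_derivative[OF assms]]) (auto intro!: derivative_eq_intros)
  moreover have "normal_density 0 \<sigma> (- \<delta> - x) = normal_density 0 \<sigma> (\<delta> + x)"
    by (simp add: normal_density_def power2_eq_square algebra_simps)
  ultimately show ?thesis
    unfolding mid_prob_eq[abs_def] by (auto intro!: derivative_eq_intros)
qed

lemma normal_density_antimono:
  assumes "0 \<le> u" "u \<le> v"
  shows "normal_density 0 \<sigma> v \<le> normal_density 0 \<sigma> u"
proof -
  have "u\<^sup>2 \<le> v\<^sup>2" using assms by (intro power_mono) auto
  then have "exp (- (v - 0)\<^sup>2 / (2 * \<sigma>\<^sup>2)) \<le> exp (- (u - 0)\<^sup>2 / (2 * \<sigma>\<^sup>2))"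
    by (simp add: divide_right_mono)
  then show ?thesis unfolding normal_density_def by (rule mult_left_mono) simp
qed

text \<open>The derivative is decreasing on \<open>{0..a}\<close>, since there both normal densities
  are taken at non-negative arguments. The function is therefore concave and lies below its
  tangents.\<close>

lemma mid_prob_tangent:
  assumes \<sigma>: "\<sigma> > 0" and \<delta>: "\<delta> > 0" and m: "0 \<le> m" "m \<le> a" and x: "0 \<le> x" "x \<le> a"
  shows "mid_prob \<sigma> a \<delta> x \<le> mid_prob \<sigma> a \<delta> m
    + (normal_density 0 \<sigma> (\<delta> + m) - normal_density 0 \<sigma> (a + \<delta> - m)) * (x - m)"
proof -
  define D where "D = (\<lambda>x. normal_density 0 \<sigma> (\<delta> + x) - normal_density 0 \<sigma> (a + \<delta> - x))"
  have deriv: "(mid_prob \<sigma> a \<delta> has_real_derivative D t) (at t)" for t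
    unfolding D_def using \<sigma> by (rule mid_prob_derivative)
  have anti: "D v \<le> D u" if "0 \<le> u" "u \<le> v" "v \<le> a" for u v
    unfolding D_def using that \<delta> by (intro diff_mono normal_density_antimono) auto
  have Dm: "normal_density 0 \<sigma> (\<delta> + m) - normal_density 0 \<sigma> (a + \<delta> - m) = D m"
    by (simp add: D_def)
  consider "x = m" | "x < m" | "m < x" by linarith
  then show ?thesis
  proof cases
    case 2
    obtain z where z: "x < z" "z < m" "mid_prob \<sigma> a \<delta> m - mid_prob \<sigma> a \<delta> x = (m - x) * D z"
      using MVT2[OF 2, of "mid_prob \<sigma> a \<delta>" D] deriv by blast
    have "(m - x) * D m \<le> (m - x) * D z" using z x m by (intro mult_left_mono anti) auto
    with z show ?thesis unfolding Dm by (simp add: algebra_simps)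
  next
    case 3
    obtain z where z: "m < z" "z < x" "mid_prob \<sigma> a \<delta> x - mid_prob \<sigma> a \<delta> m = (x - m) * D z"
      using MVT2[OF 3, of "mid_prob \<sigma> a \<delta>" D] deriv by blast
    have "(x - m) * D z \<le> (x - m) * D m" using z x m by (intro mult_left_mono anti) auto
    with z show ?thesis unfolding Dm by (simp add: algebra_simps)
  qed simp
qed

text \<open>By symmetry the tangent at the midpoint is horizontal.\<close>

lemma mid_prob_le_half:
  assumes "\<sigma> > 0" "\<delta> > 0" "0 \<le> x" "x \<le> a"
  shows "mid_prob \<sigma> a \<delta> x \<le> mid_prob \<sigma> a \<delta> (a / 2)"
  using mid_prob_tangent[OF assms(1,2) _ _ assms(3,4), of "a / 2"] assms by (simp add: algebra_simps)

lemma mid_prob_borel_measurable[measurable]: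
  assumes "\<sigma> > 0" shows "mid_prob \<sigma> a \<delta> \<in> borel_measurable borel"
  by (intro borel_measurable_continuous_onI continuous_at_imp_continuous_on ballI
      DERIV_isCont[OF mid_prob_derivative[OF assms]])

lemma mid_prob_range: "0 \<le> mid_prob \<sigma> a \<delta> x + 1" "mid_prob \<sigma> a \<delta> x \<le> 1"
  using std_gauss_cdf_range[of "(a + \<delta> - x) / \<sigma>"] std_gauss_cdf_range[of "(- \<delta> - x) / \<sigma>"]
  unfolding mid_prob_eq by auto

lemma integrable_mid_prob:
  assumes "\<sigma> > 0" "X \<in> borel_measurable borel"
  shows "integrable std_gauss (\<lambda>g. mid_prob \<sigma> a \<delta> (X g))"
proof -
  interpret prob_space std_gauss by (rule prob_space_std_gauss)
  note [measurable] = mid_prob_borel_measurable[OF assms(1)] assms(2)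
  show ?thesis
    by (rule integrable_const_bound[of _ 1])
      (use mid_prob_range in \<open>auto intro!: AE_I2 simp: abs_le_iff\<close>, use mid_prob_range in \<open>smt (verit)\<close>)
qed

text \<open>Jensen's inequality through the tangent at \<open>\<theta> * a\<close>. For
  \<open>\<theta> < 1 / 2\<close> its slope is non-negative, so a mean smaller than
  \<open>\<theta>\<close> only lowers the bound.\<close>

lemma expectation_mid_prob_le:
  assumes \<sigma>: "\<sigma> > 0" and \<delta>: "\<delta> > 0" and \<theta>: "0 < \<theta>" "\<theta> < 1 / 2" and a: "a > 0"
    and [measurable]: "X \<in> borel_measurable borel" and X: "\<And>g. 0 \<le> X g" "\<And>g. X g \<le> 1"
    and mean: "integral\<^sup>L std_gauss X \<le> \<theta>"
  shows "(\<integral>g. mid_prob \<sigma> a \<delta> (a * X g) \<partial>std_gauss) \<le> mid_prob \<sigma> a \<delta> (\<theta> * a)"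
proof -
  interpret prob_space std_gauss by (rule prob_space_std_gauss)
  define D where "D = normal_density 0 \<sigma> (\<delta> + \<theta> * a) - normal_density 0 \<sigma> (a + \<delta> - \<theta> * a)"
  have ta: "\<theta> * a \<le> a / 2" using \<theta> a by (simp add: field_simps)
  have "D \<ge> 0" unfolding D_def using \<delta> \<theta> a ta by (simp add: normal_density_antimono)
  have iX: "integrable std_gauss X"
    by (rule integrable_const_bound[of _ 1]) (use X in auto)
  have "(\<integral>g. mid_prob \<sigma> a \<delta> (a * X g) \<partial>std_gauss)
      \<le> (\<integral>g. mid_prob \<sigma> a \<delta> (\<theta> * a) + D * (a * X g - \<theta> * a) \<partial>std_gauss)"
  proof (rule integral_mono)
    show "mid_prob \<sigma> a \<delta> (a * X g) \<le> mid_prob \<sigma> a \<delta> (\<theta> * a) + D * (a * X g - \<theta> * a)" for g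
      unfolding D_def by (rule mid_prob_tangent[OF \<sigma> \<delta>]) (use \<theta> a ta X[of g] in \<open>auto simp: mult_left_le\<close>)
  qed (use iX in \<open>auto intro!: integrable_mid_prob \<sigma>\<close>)
  also have "\<dots> = mid_prob \<sigma> a \<delta> (\<theta> * a) + D * (a * (integral\<^sup>L std_gauss X - \<theta>))"
    using iX prob_space by (simp add: algebra_simps)
  also have "\<dots> \<le> mid_prob \<sigma> a \<delta> (\<theta> * a)"
    using \<open>D \<ge> 0\<close> a mean by (simp add: mult_nonneg_nonpos)
  finally show ?thesis .
qed

lemma normal_tail_mass:
  assumes \<sigma>: "\<sigma> > 0" and \<delta>: "\<delta> > 0"
  defines "Z \<equiv> density lborel (normal_density 0 \<sigma>)"
  shows "emeasure Z {..<-\<delta>} + emeasure Z {\<delta><..} = ennreal (2 * Qf (\<delta> / \<sigma>))"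
proof -
  interpret prob_space Z unfolding Z_def using \<sigma> by (rule prob_space_normal_density)
  have [simp]: "sets Z = sets borel" "space Z = UNIV" by (simp_all add: Z_def)
  have "\<Phi> (\<delta> / \<sigma>) - \<Phi> (- (\<delta> / \<sigma>)) = measure Z {- \<delta>..\<delta>}"
    using normal_interval_moments(1)[OF \<sigma>, of "- \<delta>" \<delta>] \<delta> by (simp add: Z_def)
  also have "{- \<delta>..\<delta>} = space Z - ({..<-\<delta>} \<union> {\<delta><..})" by auto
  also have "measure Z \<dots> = 1 - measure Z ({..<-\<delta>} \<union> {\<delta><..})"
    by (rule prob_compl) auto
  also have "measure Z ({..<-\<delta>} \<union> {\<delta><..}) = measure Z {..<-\<delta>} + measure Z {\<delta><..}"
    by (rule finite_measure_Union) (use \<delta> in auto)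
  finally have "measure Z {..<-\<delta>} + measure Z {\<delta><..} = 2 * Qf (\<delta> / \<sigma>)"
    by (simp add: Phi_minus Qf_eq)
  then show ?thesis
    by (simp add: emeasure_eq_measure ennreal_plus[symmetric] del: ennreal_plus)
qed

text \<open>The central mass is the length \<open>2 * \<delta>\<close> times the normal density at
  an intermediate point, which is positive and at most its peak value. The upper bound later fixes
  the sign of a logarithm.\<close>

lemma Qf_mid:
  assumes \<sigma>: "\<sigma> > 0" and \<delta>: "\<delta> > 0"
  shows "0 < 1 - 2 * Qf (\<delta> / \<sigma>)" "1 - 2 * Qf (\<delta> / \<sigma>) \<le> 2 * \<delta> / (sqrt (2 * pi) * \<sigma>)"
proof -
  have e: "1 - 2 * Qf (\<delta> / \<sigma>) = \<Phi> (\<delta> / \<sigma>) - \<Phi> (- \<delta> / \<sigma>)"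
    by (simp add: Phi_minus Qf_eq)
  obtain z where z: "\<Phi> (\<delta> / \<sigma>) - \<Phi> (- \<delta> / \<sigma>) = (\<delta> - - \<delta>) * normal_density 0 \<sigma> z"
    using MVT2[of "- \<delta>" \<delta> "\<lambda>x. \<Phi> (x / \<sigma>)" "normal_density 0 \<sigma>"] Phi_scale_derivative[OF \<sigma>] \<delta> by auto
  show "0 < 1 - 2 * Qf (\<delta> / \<sigma>)"
    unfolding e z using \<delta> normal_density_pos[OF \<sigma>, of 0 z] by simp
  have "normal_density 0 \<sigma> z \<le> 1 / (sqrt (2 * pi) * \<sigma>)"
    using normal_density_antimono[of 0 "\<bar>z\<bar>" \<sigma>] \<sigma>
    by (simp add: normal_density_def real_sqrt_mult)
  then have "2 * \<delta> * normal_density 0 \<sigma> z \<le> 2 * \<delta> * (1 / (sqrt (2 * pi) * \<sigma>))"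
    using \<delta> by (intro mult_left_mono) auto
  then show "1 - 2 * Qf (\<delta> / \<sigma>) \<le> 2 * \<delta> / (sqrt (2 * pi) * \<sigma>)"
    unfolding e z by simp
qed

text \<open>
  The comparison density is the one of Lapidoth, Moser and Wigger: Gaussian tails outside
  \<open>[-\<delta>, a + \<delta>]\<close> and an exponential profile \<open>K * exp (- \<nu> * y)\<close> inside. The rate \<open>\<nu> = 0\<close>
  yields the bound of \<open>c2_expr\<close>, a positive rate the one of \<open>c1_expr\<close>.
\<close>

lemma diff_entropy_smear_le:
  fixes X F :: "real \<Rightarrow> real" and \<sigma> a \<delta> \<nu> \<theta> p :: real
  assumes \<sigma>: "\<sigma> > 0" and a: "a > 0" and \<delta>: "\<delta> > 0" and \<nu>: "\<nu> \<ge> 0"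
    and F: "\<And>y. (F has_real_derivative exp (- \<nu> * y)) (at y)"
    and X[measurable]: "X \<in> borel_measurable borel" and X01: "\<And>g. 0 \<le> X g" "\<And>g. X g \<le> 1"
    and mean: "integral\<^sup>L std_gauss X \<le> \<theta>"
    and p: "(\<integral>g. mid_prob \<sigma> a \<delta> (a * X g) \<partial>std_gauss) \<le> p"
  shows "diff_entropy (smear (\<lambda>g. a * X g) (normal_density 0 \<sigma>))
    \<le> ln (2 * pi * \<sigma>\<^sup>2) / 2
      + p * ln ((F (a + \<delta>) - F (- \<delta>)) / (sqrt (2 * pi) * \<sigma> * (1 - 2 * Qf (\<delta> / \<sigma>))))
      + Qf (\<delta> / \<sigma>) + \<delta> * normal_density 0 \<sigma> \<delta>
      + \<nu> * (\<sigma>\<^sup>2 * (normal_density 0 \<sigma> \<delta> - normal_density 0 \<sigma> (a + \<delta>)))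
      + \<nu> * (\<theta> * a) * mid_prob \<sigma> a \<delta> (a / 2)"
proof -
  define w where "w = smear (\<lambda>g. a * X g) (normal_density 0 \<sigma>)"
  define Z where "Z = density lborel (normal_density 0 \<sigma>)"
  have aX[measurable]: "(\<lambda>g. a * X g) \<in> borel_measurable borel" by measurable
  have aX01: "0 \<le> a * X g" "a * X g \<le> a" for g
    using a X01[of g] by (auto simp: mult_left_le)
  have aXb: "\<bar>a * X g\<bar> \<le> a" for g using aX01[of g] by simp
  have n: "gauss_like \<sigma> (normal_density 0 \<sigma>)" using \<sigma> by (rule gauss_like_normal_density)
  have w: "gauss_like \<sigma> w" unfolding w_def using \<sigma> n aX aXb by (rule gauss_like_smear)
  interpret N: prob_space std_gauss by (rule prob_space_std_gauss)
  interpret Z: prob_space Z unfolding Z_def using \<sigma> by (rule prob_space_normal_density)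
  interpret W: prob_space "density lborel w" by (rule gauss_likeD(3)[OF w])
  interpret NZ: pair_prob_space std_gauss Z
    unfolding Z_def by (rule pair_prob_space_gauss_like[OF n])
  have sets_Z[measurable_cong, simp]: "sets Z = sets borel" by (simp add: Z_def)
  have W_eq: "density lborel w = distr (std_gauss \<Otimes>\<^sub>M Z) borel (\<lambda>z. a * X (fst z) + snd z)"
    unfolding w_def Z_def by (rule distr_smear[OF \<sigma> n aX aXb, symmetric])

  \<comment> \<open>\<open>M\<close> is the integral of the exponential profile over the middle
    interval, and \<open>K\<close> scales that piece to the mass \<open>1 - 2 * Q\<close> which the
    Gaussian tails leave.\<close>
  define M where "M = F (a + \<delta>) - F (- \<delta>)"
  define s where "s = sqrt (2 * pi) * \<sigma>"
  define Q where "Q = Qf (\<delta> / \<sigma>)"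
  define K where "K = (1 - 2 * Q) / M"
  define L where "L = ln (M / (s * (1 - 2 * Q)))"
  have s: "s > 0" using \<sigma> by (simp add: s_def)
  have ln_s: "ln s = ln (2 * pi * \<sigma>\<^sup>2) / 2"
  proof -
    have "2 * pi * \<sigma>\<^sup>2 = s\<^sup>2" by (simp add: s_def power_mult_distrib)
    then show ?thesis using s by (simp add: ln_realpow)
  qed
  \<comment> \<open>Integrate \<open>exp (- \<nu> * y) \<ge> 1 - \<nu> * y\<close> over
    \<open>{- \<delta>..\<delta>}\<close>, where the linear term cancels. Combined with the bound on
    \<open>1 - 2 * Q\<close> this gives \<open>L \<ge> 0\<close>, which later allows the averaged
    \<open>mid_prob\<close> to be replaced by its upper bound \<open>p\<close>.\<close>
  have M_ge: "2 * \<delta> \<le> M"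
  proof -
    have "F (- \<delta>) - (- \<delta>) + \<nu> * (- \<delta>)\<^sup>2 / 2 \<le> F \<delta> - \<delta> + \<nu> * \<delta>\<^sup>2 / 2"
    proof (rule DERIV_nonneg_imp_nondecreasing[where f="\<lambda>y. F y - y + \<nu> * y\<^sup>2 / 2"])
      fix y
      have "0 \<le> exp (- \<nu> * y) - 1 + \<nu> * y" using exp_ge_add_one_self[of "- \<nu> * y"] by simp
      moreover have "((\<lambda>y. F y - y + \<nu> * y\<^sup>2 / 2) has_real_derivative exp (- \<nu> * y) - 1 + \<nu> * y) (at y)"
        by (auto intro!: derivative_eq_intros F)
      ultimately show "\<exists>z. ((\<lambda>y. F y - y + \<nu> * y\<^sup>2 / 2) has_real_derivative z) (at y) \<and> 0 \<le> z" by blast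
    qed (use \<delta> in simp)
    moreover have "F \<delta> \<le> F (a + \<delta>)"
      by (rule DERIV_nonneg_imp_nondecreasing) (use a F in \<open>auto intro!: exI conjI\<close>)
    ultimately show ?thesis by (simp add: M_def)
  qed
  then have M: "M > 0" using \<delta> by simp
  have Q: "0 < 1 - 2 * Q" "1 - 2 * Q \<le> 2 * \<delta> / s"
    using Qf_mid[OF \<sigma> \<delta>] by (simp_all add: Q_def s_def)
  have K: "K > 0" using M Q by (simp add: K_def)
  have L: "L \<ge> 0"
  proof -
    have "s * (1 - 2 * Q) \<le> M" using Q(2) s M_ge by (simp add: field_simps)
    then have "1 \<le> M / (s * (1 - 2 * Q))" using s Q(1) by (simp add: field_simps)
    then show ?thesis unfolding L_def by simp
  qed
  have ln_K: "ln K = - L - ln s"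
    unfolding K_def L_def using M Q s by (simp add: ln_div ln_mult)

  \<comment> \<open>Each tail is the noise density centred at the nearer end of
    \<open>{0..a}\<close>, so together the tails have exactly the mass of the noise outside
    \<open>{- \<delta>..\<delta>}\<close>.\<close>
  define r where "r = (\<lambda>y. if y < - \<delta> then normal_density 0 \<sigma> y
    else if y \<le> a + \<delta> then K * exp (- \<nu> * y) else normal_density 0 \<sigma> (y - a))"
  have r_meas[measurable]: "r \<in> borel_measurable borel" unfolding r_def by measurable
  have phi: "0 < normal_density 0 \<sigma> v" for v using \<sigma> by (rule normal_density_pos)
  have r_pos: "0 < r y" for y using K phi by (simp add: r_def)
  have r_mass: "(\<integral>\<^sup>+y. r y \<partial>lborel) \<le> 1"
  proof -
    have left: "(\<integral>\<^sup>+y. ennreal (indicator {..<-\<delta>} y * normal_density 0 \<sigma> y) \<partial>lborel) = emeasure Z {..<-\<delta>}"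
      unfolding Z_def by (subst emeasure_density)
        (auto intro!: nn_integral_cong split: split_indicator)
    have right: "(\<integral>\<^sup>+y. ennreal (indicator {a+\<delta><..} y * normal_density 0 \<sigma> (y - a)) \<partial>lborel) = emeasure Z {\<delta><..}"
      unfolding Z_def
      by (subst emeasure_density, simp, simp, subst nn_integral_real_affine[where c=1 and t=a])
        (auto intro!: nn_integral_cong split: split_indicator)
    have "(\<integral>\<^sup>+y. ennreal (K * exp (- \<nu> * y)) * indicator {-\<delta>..a+\<delta>} y \<partial>lborel) = ennreal (K * F (a + \<delta>) - K * F (- \<delta>))"
      by (rule nn_integral_FTC_Icc) (use K a \<delta> in \<open>auto intro!: DERIV_cmult F[simplified]\<close>)
    also have "K * F (a + \<delta>) - K * F (- \<delta>) = 1 - 2 * Q"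
    proof -
      have "K * F (a + \<delta>) - K * F (- \<delta>) = K * M" by (simp add: M_def right_diff_distrib)
      then show ?thesis using M by (simp add: K_def)
    qed
    finally have mid0: "(\<integral>\<^sup>+y. ennreal (K * exp (- \<nu> * y)) * indicator {-\<delta>..a+\<delta>} y \<partial>lborel) = ennreal (1 - 2 * Q)" .
    have mid: "(\<integral>\<^sup>+y. ennreal (indicator {-\<delta>..a+\<delta>} y * (K * exp (- \<nu> * y))) \<partial>lborel) = ennreal (1 - 2 * Q)"
      unfolding mid0[symmetric] by (intro nn_integral_cong) (simp split: split_indicator)
    have "(\<integral>\<^sup>+y. r y \<partial>lborel) = (\<integral>\<^sup>+y. ennreal (indicator {..<-\<delta>} y * normal_density 0 \<sigma> y)
        + ennreal (indicator {a+\<delta><..} y * normal_density 0 \<sigma> (y - a))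
        + ennreal (indicator {-\<delta>..a+\<delta>} y * (K * exp (- \<nu> * y))) \<partial>lborel)"
      using \<delta> a by (intro nn_integral_cong) (auto simp: r_def split: split_indicator)
    also have "\<dots> = emeasure Z {..<-\<delta>} + emeasure Z {\<delta><..} + ennreal (1 - 2 * Q)"
      by (simp add: nn_integral_add left right mid[unfolded mult_minus_left])
    also have "\<dots> = ennreal (2 * Q) + ennreal (1 - 2 * Q)"
      using normal_tail_mass[OF \<sigma> \<delta>] by (simp add: Z_def Q_def)
    also have "\<dots> = 1"
    proof -
      have "0 \<le> Q" using std_gauss_cdf_range[of "\<delta> / \<sigma>"] by (simp add: Q_def Qf_eq)
      then show ?thesis using Q by (simp add: ennreal_plus[symmetric] del: ennreal_plus)
    qed
    finally show ?thesis by simp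
  qed

  have ln_n: "ln (normal_density 0 \<sigma> v) = - ln s - v\<^sup>2 / (2 * \<sigma>\<^sup>2)" for v
    using ln_normal_density[OF \<sigma>, of 0 v] by (simp add: ln_s)
  have ln_r: "- ln (r y) = ln s + (if y < - \<delta> then y\<^sup>2 / (2 * \<sigma>\<^sup>2)
      else if y \<le> a + \<delta> then L + \<nu> * y else (y - a)\<^sup>2 / (2 * \<sigma>\<^sup>2))" for y
    using K by (simp add: r_def ln_n ln_mult ln_K)
  have ir: "integrable (density lborel w) (\<lambda>y. ln (r y))"
  proof (rule Bochner_Integration.integrable_bound)
    show "integrable (density lborel w) (\<lambda>y. \<bar>ln s\<bar> + L + \<nu> * \<bar>y\<bar> + (y\<^sup>2 + a\<^sup>2) / \<sigma>\<^sup>2)"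
      using gauss_like_moments[OF \<sigma> w] by (auto simp: add_divide_distrib)
    have "\<bar>ln (r y)\<bar> \<le> \<bar>ln s\<bar> + L + \<nu> * \<bar>y\<bar> + (y\<^sup>2 + a\<^sup>2) / \<sigma>\<^sup>2" for y
    proof -
      have sq: "(y - a)\<^sup>2 \<le> 2 * (y\<^sup>2 + a\<^sup>2)"
        using zero_le_power2[of "y + a"] by (simp add: power2_eq_square algebra_simps)
      have "(y - a)\<^sup>2 / (2 * \<sigma>\<^sup>2) \<le> 2 * (y\<^sup>2 + a\<^sup>2) / (2 * \<sigma>\<^sup>2)"
        using sq by (rule divide_right_mono) simp
      moreover have "y\<^sup>2 / (2 * \<sigma>\<^sup>2) \<le> 2 * (y\<^sup>2 + a\<^sup>2) / (2 * \<sigma>\<^sup>2)"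
        by (rule divide_right_mono) auto
      moreover have "0 \<le> y\<^sup>2 / (2 * \<sigma>\<^sup>2)" "0 \<le> (y - a)\<^sup>2 / (2 * \<sigma>\<^sup>2)" by auto
      moreover have "\<bar>\<nu> * y\<bar> = \<nu> * \<bar>y\<bar>" "0 \<le> \<nu> * \<bar>y\<bar>" using \<nu> by (auto simp: abs_mult)
      moreover have "2 * (y\<^sup>2 + a\<^sup>2) / (2 * \<sigma>\<^sup>2) = (y\<^sup>2 + a\<^sup>2) / \<sigma>\<^sup>2"
        by (rule mult_divide_mult_cancel_left) simp
      moreover note abs_ge_self[of "ln s"] abs_ge_minus_self[of "ln s"]
        abs_ge_self[of "\<nu> * y"] abs_ge_minus_self[of "\<nu> * y"]
      moreover have "- ln (r y) = ln s + y\<^sup>2 / (2 * \<sigma>\<^sup>2) \<or> - ln (r y) = ln s + (L + \<nu> * y)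
          \<or> - ln (r y) = ln s + (y - a)\<^sup>2 / (2 * \<sigma>\<^sup>2)"
        using ln_r[of y] by presburger
      ultimately show ?thesis
        using L unfolding abs_le_iff[of "ln (r y)"] by (elim disjE) linarith+
    qed
    then show "AE y in density lborel w. norm (ln (r y)) \<le> norm (\<bar>ln s\<bar> + L + \<nu> * \<bar>y\<bar> + (y\<^sup>2 + a\<^sup>2) / \<sigma>\<^sup>2)"
      by (auto intro!: AE_I2 order_trans[OF _ abs_ge_self])
  qed (use gauss_likeD(4)[OF w] in simp)
  have iw: "integrable (density lborel w) (\<lambda>y. ln (w y))"
    by (rule integrable_ln_gauss_like(2)[OF \<sigma> w w aX aXb])
  have gibbs: "diff_entropy w \<le> - (\<integral>y. ln (r y) \<partial>density lborel w)"
    by (rule Gibbs_inequality[OF gauss_likeD(3)[OF w] gauss_likeD(2)[OF w] gauss_likeD(4)[OF w]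
          r_pos r_meas r_mass iw ir])

  define c0 where "c0 = ln s + \<nu> * (\<sigma>\<^sup>2 * (normal_density 0 \<sigma> \<delta> - normal_density 0 \<sigma> (a + \<delta>)))
      + (Q + \<delta> * normal_density 0 \<sigma> \<delta>)"
  have iN: "integrable (std_gauss \<Otimes>\<^sub>M Z) (\<lambda>z. - ln (r (a * X (fst z) + snd z)))"
    using ir unfolding W_eq by (subst (asm) integrable_distr_eq) auto
  have inner: "(\<integral>z. - ln (r (x + z)) \<partial>Z) \<le> c0 + mid_prob \<sigma> a \<delta> x * L + \<nu> * x * mid_prob \<sigma> a \<delta> (a / 2)"
    if i: "integrable Z (\<lambda>z. - ln (r (x + z)))" and x: "0 \<le> x" "x \<le> a" for x
  proof -
    define I where "I = {- \<delta> - x..a + \<delta> - x}"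
    have uv: "- \<delta> - x \<le> a + \<delta> - x" "- \<delta> \<le> \<delta>" using a \<delta> by auto
    note mom = normal_interval_moments[OF \<sigma> uv(1), folded I_def Z_def]
    note mom\<delta> = normal_interval_moments[OF \<sigma> uv(2), folded Z_def]
    note sm = normal_second_moment[OF \<sigma>, folded Z_def]
    \<comment> \<open>In a tail, the output is no farther from the nearer end of
      \<open>{0..a}\<close> than \<open>z\<close> is from 0, and \<open>z\<close> lies outside
      \<open>{- \<delta>..\<delta>}\<close>. The quadratic terms are thus bounded by a truncated
      second moment that does not depend on \<open>x\<close>.\<close>
    have "(\<integral>z. - ln (r (x + z)) \<partial>Z) \<le> (\<integral>z. ln s + (L + \<nu> * x) * indicator I z + \<nu> * (indicator I z * z)
        + (z\<^sup>2 - indicator {- \<delta>..\<delta>} z * z\<^sup>2) / (2 * \<sigma>\<^sup>2) \<partial>Z)"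
    proof (rule integral_mono[OF i])
      show "integrable Z (\<lambda>z. ln s + (L + \<nu> * x) * indicator I z + \<nu> * (indicator I z * z)
        + (z\<^sup>2 - indicator {- \<delta>..\<delta>} z * z\<^sup>2) / (2 * \<sigma>\<^sup>2))"
        using mom mom\<delta> sm by (intro Bochner_Integration.integrable_add integrable_mult_right
            integrable_divide Bochner_Integration.integrable_diff) auto
      fix z
      have nn: "0 \<le> (z\<^sup>2 - indicator {- \<delta>..\<delta>} z * z\<^sup>2) / (2 * \<sigma>\<^sup>2)"
        by (intro divide_nonneg_nonneg) (auto split: split_indicator)
      consider "x + z < - \<delta>" | "- \<delta> \<le> x + z" "x + z \<le> a + \<delta>" | "a + \<delta> < x + z" by linarith
      then show "- ln (r (x + z)) \<le> ln s + (L + \<nu> * x) * indicator I z + \<nu> * (indicator I z * z)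
        + (z\<^sup>2 - indicator {- \<delta>..\<delta>} z * z\<^sup>2) / (2 * \<sigma>\<^sup>2)"
      proof cases
        case 1
        then have "z \<notin> I" "z \<notin> {-\<delta>..\<delta>}" using x by (auto simp: I_def)
        moreover have "(x + z)\<^sup>2 \<le> z\<^sup>2" using 1 x \<delta> by (intro abs_le_square_iff[THEN iffD1]) auto
        ultimately show ?thesis using 1 by (simp add: ln_r divide_right_mono)
      next
        case 2
        then have "z \<in> I" by (auto simp: I_def)
        then show ?thesis using 2 nn by (simp add: ln_r algebra_simps)
      next
        case 3
        then have "z \<notin> I" "z \<notin> {-\<delta>..\<delta>}" using x by (auto simp: I_def)
        moreover have "(x + z - a)\<^sup>2 \<le> z\<^sup>2" using 3 x \<delta> by (intro power_mono) auto
        ultimately show ?thesis using 3 a \<delta> by (simp add: ln_r divide_right_mono)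
      qed
    qed
    also have "\<dots> = ln s + (L + \<nu> * x) * mid_prob \<sigma> a \<delta> x
        + \<nu> * (\<sigma>\<^sup>2 * (normal_density 0 \<sigma> (\<delta> + x) - normal_density 0 \<sigma> (a + \<delta> - x)))
        + (\<sigma>\<^sup>2 - \<sigma>\<^sup>2 * (1 - 2 * Q - 2 * \<delta> * normal_density 0 \<sigma> \<delta>)) / (2 * \<sigma>\<^sup>2)"
    proof -
      have e1: "normal_density 0 \<sigma> (- \<delta> - x) = normal_density 0 \<sigma> (\<delta> + x)"
        "normal_density 0 \<sigma> (- \<delta>) = normal_density 0 \<sigma> \<delta>"
        by (simp_all add: normal_density_def power2_eq_square algebra_simps)
      have e2: "\<Phi> (\<delta> / \<sigma>) - \<Phi> (- \<delta> / \<sigma>) - \<delta> * normal_density 0 \<sigma> \<delta> + - \<delta> * normal_density 0 \<sigma> (- \<delta>)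
        = 1 - 2 * Q - 2 * \<delta> * normal_density 0 \<sigma> \<delta>"
        by (simp add: Q_def Qf_eq Phi_minus e1)
      have e3: "\<Phi> (\<delta> / \<sigma>) - \<Phi> (- (\<delta> / \<sigma>)) = 1 - 2 * Q"
        by (simp add: Q_def Qf_eq Phi_minus)
      show ?thesis
        using e3 mom mom\<delta> sm Z.prob_space unfolding mid_prob_eq e1[symmetric] e2[symmetric]
        by simp
    qed
    \<comment> \<open>The difference of normal densities decreases in \<open>x\<close> and is
      replaced by its value at 0. The probability next to \<open>\<nu> * x\<close> is replaced by
      its maximum, which leaves a term linear in the input, ready for the mean constraint.\<close>
    also have "\<dots> \<le> c0 + mid_prob \<sigma> a \<delta> x * L + \<nu> * x * mid_prob \<sigma> a \<delta> (a / 2)"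
    proof -
      have "normal_density 0 \<sigma> (\<delta> + x) - normal_density 0 \<sigma> (a + \<delta> - x)
          \<le> normal_density 0 \<sigma> \<delta> - normal_density 0 \<sigma> (a + \<delta>)"
        using x \<delta> by (intro diff_mono normal_density_antimono) auto
      then have "\<nu> * (\<sigma>\<^sup>2 * (normal_density 0 \<sigma> (\<delta> + x) - normal_density 0 \<sigma> (a + \<delta> - x)))
          \<le> \<nu> * (\<sigma>\<^sup>2 * (normal_density 0 \<sigma> \<delta> - normal_density 0 \<sigma> (a + \<delta>)))"
        using \<nu> by (intro mult_left_mono) auto
      moreover have "\<nu> * x * mid_prob \<sigma> a \<delta> x \<le> \<nu> * x * mid_prob \<sigma> a \<delta> (a / 2)"
        using \<nu> x by (intro mult_left_mono mid_prob_le_half[OF \<sigma> \<delta>]) auto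
      moreover have "(\<sigma>\<^sup>2 - \<sigma>\<^sup>2 * (1 - 2 * Q - 2 * \<delta> * normal_density 0 \<sigma> \<delta>)) / (2 * \<sigma>\<^sup>2)
          = Q + \<delta> * normal_density 0 \<sigma> \<delta>"
        using \<sigma> by (simp add: field_simps)
      ultimately show ?thesis by (simp add: c0_def distrib_right mult.commute)
    qed
    finally show ?thesis .
  qed
  \<comment> \<open>The sign is needed when the mean of \<open>X\<close> is replaced by its upper
    bound \<open>\<theta>\<close>.\<close>
  have half: "0 \<le> mid_prob \<sigma> a \<delta> (a / 2)"
  proof -
    have "\<Phi> ((- \<delta> - a / 2) / \<sigma>) \<le> \<Phi> ((a + \<delta> - a / 2) / \<sigma>)"
      using real_distribution.finite_borel_measure_M[OF std_gauss_real_distribution] a \<delta> \<sigma>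
      by (intro finite_borel_measure.cdf_nondecreasing divide_right_mono) auto
    then show ?thesis by (simp add: mid_prob_eq)
  qed
  have iX: "integrable std_gauss X"
    by (rule N.integrable_const_bound[of _ 1]) (use X01 in auto)
  have imp: "integrable std_gauss (\<lambda>g. mid_prob \<sigma> a \<delta> (a * X g))"
    by (rule integrable_mid_prob[OF \<sigma> aX])
  have "- (\<integral>y. ln (r y) \<partial>density lborel w) = (\<integral>z. - ln (r (a * X (fst z) + snd z)) \<partial>(std_gauss \<Otimes>\<^sub>M Z))"
    unfolding W_eq by (subst integral_distr) auto
  also have "\<dots> = (\<integral>g. \<integral>z. - ln (r (a * X g + z)) \<partial>Z \<partial>std_gauss)"
    using NZ.integral_fst'[OF iN] by simp
  also have "\<dots> \<le> (\<integral>g. c0 + mid_prob \<sigma> a \<delta> (a * X g) * L + \<nu> * (a * X g) * mid_prob \<sigma> a \<delta> (a / 2) \<partial>std_gauss)"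
  proof (rule integral_mono_AE)
    show "integrable std_gauss (\<lambda>g. \<integral>z. - ln (r (a * X g + z)) \<partial>Z)"
      using NZ.integrable_fst'[OF iN] by simp
    show "integrable std_gauss (\<lambda>g. c0 + mid_prob \<sigma> a \<delta> (a * X g) * L + \<nu> * (a * X g) * mid_prob \<sigma> a \<delta> (a / 2))"
      using iX imp by auto
    have "AE g in std_gauss. integrable Z (\<lambda>z. - ln (r (a * X g + z)))"
      using NZ.AE_integrable_fst'[OF iN] by simp
    then show "AE g in std_gauss. (\<integral>z. - ln (r (a * X g + z)) \<partial>Z)
        \<le> c0 + mid_prob \<sigma> a \<delta> (a * X g) * L + \<nu> * (a * X g) * mid_prob \<sigma> a \<delta> (a / 2)"
      by eventually_elim (rule inner[OF _ aX01])
  qed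
  also have "\<dots> = c0 + (\<integral>g. mid_prob \<sigma> a \<delta> (a * X g) \<partial>std_gauss) * L
      + \<nu> * (a * integral\<^sup>L std_gauss X) * mid_prob \<sigma> a \<delta> (a / 2)"
    using iX imp N.prob_space by simp
  also have "\<dots> \<le> c0 + p * L + \<nu> * (a * \<theta>) * mid_prob \<sigma> a \<delta> (a / 2)"
    using p L mean a \<nu> half by (intro add_mono mult_right_mono mult_left_mono) auto
  finally show ?thesis
    using gibbs unfolding w_def[symmetric] c0_def ln_s mult.commute[of a \<theta>]
    unfolding L_def M_def s_def Q_def by linarith
qed

section \<open>From the interference entropy to \<open>Cbar\<close> and \<open>Ffun\<close>\<close>

lemma diff_entropy_normal:
  assumes \<sigma>: "\<sigma> > 0"
  shows "diff_entropy (normal_density 0 \<sigma>) = (ln (2 * pi * \<sigma>\<^sup>2) + 1) / 2"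
proof -
  interpret prob_space "density lborel (normal_density 0 \<sigma>)"
    using \<sigma> by (rule prob_space_normal_density)
  have "(\<integral>v. ln (normal_density 0 \<sigma> v) \<partial>density lborel (normal_density 0 \<sigma>))
      = - ln (2 * pi * \<sigma>\<^sup>2) / 2 - \<sigma>\<^sup>2 / (2 * \<sigma>\<^sup>2)"
    unfolding ln_normal_density[OF \<sigma>] using normal_second_moment[OF \<sigma>] prob_space by simp
  then show ?thesis using \<sigma> by (simp add: diff_entropy_def add_divide_distrib)
qed

lemma normal_density_alt:
  "\<sigma> > 0 \<Longrightarrow> normal_density 0 \<sigma> x = exp (- (x\<^sup>2) / (2 * \<sigma>\<^sup>2)) / (sqrt (2 * pi) * \<sigma>)"
  by (simp add: normal_density_def real_sqrt_mult)

text \<open>Every choice of parameters in the comparison density bounds the entropy. The excess over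
  the noise entropy, converted to bits as \<open>d\<close>, is therefore a lower bound of the set
  whose infimum is \<open>Cbar\<close>.\<close>

lemma diff_entropy_le_Cbar:
  fixes X :: "real \<Rightarrow> real" and \<sigma> a \<theta> :: real
  assumes \<sigma>: "\<sigma> > 0" and a: "a \<ge> 0" and \<theta>: "0 < \<theta>"
    and X[measurable]: "X \<in> borel_measurable borel" and X01: "\<And>g. 0 \<le> X g" "\<And>g. X g \<le> 1"
    and mean: "integral\<^sup>L std_gauss X \<le> \<theta>"
  shows "diff_entropy (smear (\<lambda>g. a * X g) (normal_density 0 \<sigma>))
    \<le> (ln (2 * pi * \<sigma>\<^sup>2) + 1) / 2 + ln 2 * Cbar \<sigma> a \<theta>"
proof (cases "a = 0")
  \<comment> \<open>Without amplitude the smeared density is the noise density, in agreement with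
    the value 0 given to \<open>Cbar\<close>.\<close>
  case True
  interpret prob_space std_gauss by (rule prob_space_std_gauss)
  have "smear (\<lambda>g. a * X g) (normal_density 0 \<sigma>) = normal_density 0 \<sigma>"
    using True prob_space by (simp add: smear_def fun_eq_iff)
  then show ?thesis using True diff_entropy_normal[OF \<sigma>] by (simp add: Cbar_def)
next
  case False
  with a have a: "a > 0" by simp
  interpret prob_space std_gauss by (rule prob_space_std_gauss)
  define h where "h = diff_entropy (smear (\<lambda>g. a * X g) (normal_density 0 \<sigma>))"
  define d where "d = (h - (ln (2 * pi * \<sigma>\<^sup>2) + 1) / 2) / ln 2"
  have aX: "(\<lambda>g. a * X g) \<in> borel_measurable borel" by measurable
  have d_le: "d \<le> c" if "h \<le> ln (2 * pi * \<sigma>\<^sup>2) / 2 + (ln 2 * c + 1 / 2)" for c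
    using that unfolding d_def by (simp add: field_simps)
  have "d \<le> Cbar \<sigma> a \<theta>"
  proof (cases "\<theta> < 1 / 2")
    case True
    have "d \<le> c1_expr \<sigma> a \<theta> \<mu> \<xi>" if \<mu>: "\<mu> > 0" and \<xi>: "\<xi> > 0" for \<mu> \<xi>
    proof (rule d_le)
      \<comment> \<open>\<open>c1_expr\<close> measures the exponential rate on the unit interval,
        the comparison density on \<open>{0..a}\<close>; hence the factor
        \<open>1 / a\<close>.\<close>
      define \<nu> where "\<nu> = \<mu> / a"
      define F where "F = (\<lambda>y. - exp (- \<nu> * y) / \<nu>)"
      have \<nu>: "\<nu> > 0" using \<mu> a by (simp add: \<nu>_def)
      define B where "B = ln (a / \<sigma> * (exp (\<mu> * \<xi> / a) - exp (- \<mu> * (1 + \<xi> / a)))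
                 / (sqrt (2 * pi) * \<mu> * (1 - 2 * Qf (\<xi> / \<sigma>))))"
      have "h \<le> ln (2 * pi * \<sigma>\<^sup>2) / 2
        + mid_prob \<sigma> a \<xi> (\<theta> * a) * ln ((F (a + \<xi>) - F (- \<xi>)) / (sqrt (2 * pi) * \<sigma> * (1 - 2 * Qf (\<xi> / \<sigma>))))
        + Qf (\<xi> / \<sigma>) + \<xi> * normal_density 0 \<sigma> \<xi>
        + \<nu> * (\<sigma>\<^sup>2 * (normal_density 0 \<sigma> \<xi> - normal_density 0 \<sigma> (a + \<xi>)))
        + \<nu> * (\<theta> * a) * mid_prob \<sigma> a \<xi> (a / 2)"
        unfolding h_def
      proof (rule diff_entropy_smear_le[OF \<sigma> a \<xi> _ _ X X01 mean])
        show "(F has_real_derivative exp (- \<nu> * y)) (at y)" for y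
          unfolding F_def using \<nu> by (auto intro!: derivative_eq_intros)
        show "(\<integral>g. mid_prob \<sigma> a \<xi> (a * X g) \<partial>std_gauss) \<le> mid_prob \<sigma> a \<xi> (\<theta> * a)"
          by (rule expectation_mid_prob_le[OF \<sigma> \<xi> \<theta> True a X X01 mean])
      qed (use \<nu> in simp)
      also have "(F (a + \<xi>) - F (- \<xi>)) / (sqrt (2 * pi) * \<sigma> * (1 - 2 * Qf (\<xi> / \<sigma>)))
          = a / \<sigma> * (exp (\<mu> * \<xi> / a) - exp (- \<mu> * (1 + \<xi> / a)))
                 / (sqrt (2 * pi) * \<mu> * (1 - 2 * Qf (\<xi> / \<sigma>)))"
      proof -
        have e: "- \<nu> * (a + \<xi>) = - \<mu> * (1 + \<xi> / a)" "- \<nu> * (- \<xi>) = \<mu> * \<xi> / a"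
          using a by (simp_all add: \<nu>_def field_simps)
        have "F (a + \<xi>) - F (- \<xi>) = a / \<mu> * (exp (\<mu> * \<xi> / a) - exp (- \<mu> * (1 + \<xi> / a)))"
          unfolding F_def e using \<mu> a by (simp add: \<nu>_def field_simps)
        then show ?thesis by (simp add: mult_ac)
      qed
      also have "mid_prob \<sigma> a \<xi> (\<theta> * a) = 1 - Qf ((\<xi> + \<theta> * a) / \<sigma>) - Qf ((\<xi> + (1 - \<theta>) * a) / \<sigma>)"
        unfolding mid_prob_def by (simp add: algebra_simps)
      also have "mid_prob \<sigma> a \<xi> (a / 2) = 1 - 2 * Qf ((\<xi> + a / 2) / \<sigma>)"
        unfolding mid_prob_def by (simp add: algebra_simps)
      also have "\<xi> * normal_density 0 \<sigma> \<xi> = \<xi> / (sqrt (2 * pi) * \<sigma>) * exp (- (\<xi>\<^sup>2) / (2 * \<sigma>\<^sup>2))"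
        using \<sigma> by (simp add: normal_density_alt)
      also have "\<nu> * (\<sigma>\<^sup>2 * (normal_density 0 \<sigma> \<xi> - normal_density 0 \<sigma> (a + \<xi>)))
          = \<sigma> / a * \<mu> / sqrt (2 * pi) * (exp (- (\<xi>\<^sup>2) / (2 * \<sigma>\<^sup>2)) - exp (- ((a + \<xi>)\<^sup>2) / (2 * \<sigma>\<^sup>2)))"
        unfolding normal_density_alt[OF \<sigma>] diff_divide_distrib[symmetric] using \<sigma>
        by (simp add: \<nu>_def power2_eq_square)
      also have "\<nu> * (\<theta> * a) = \<mu> * \<theta>" using a by (simp add: \<nu>_def)
      finally show "h \<le> ln (2 * pi * \<sigma>\<^sup>2) / 2 + (ln 2 * c1_expr \<sigma> a \<theta> \<mu> \<xi> + 1 / 2)"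
        unfolding c1_expr_def log_def B_def[symmetric] by (simp add: distrib_left) 
    qed
    then have "d \<le> Inf {c1_expr \<sigma> a \<theta> \<mu> \<xi> |\<mu> \<xi>. \<mu> > 0 \<and> \<xi> > 0}"
      by (intro cInf_greatest) (use zero_less_one in blast)+
    then show ?thesis using True a by (simp add: Cbar_def)
  next
    case False
    have "d \<le> c2_expr \<sigma> a \<xi>" if \<xi>: "\<xi> > 0" for \<xi>
    proof (rule d_le)
      \<comment> \<open>At rate zero the terms with the mean disappear, and the probability of the
        middle interval is bounded by its value at the centre.\<close>
      have "h \<le> ln (2 * pi * \<sigma>\<^sup>2) / 2
        + mid_prob \<sigma> a \<xi> (a / 2) * ln (((a + \<xi>) - (- \<xi>)) / (sqrt (2 * pi) * \<sigma> * (1 - 2 * Qf (\<xi> / \<sigma>))))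
        + Qf (\<xi> / \<sigma>) + \<xi> * normal_density 0 \<sigma> \<xi>
        + 0 * (\<sigma>\<^sup>2 * (normal_density 0 \<sigma> \<xi> - normal_density 0 \<sigma> (a + \<xi>)))
        + 0 * (\<theta> * a) * mid_prob \<sigma> a \<xi> (a / 2)"
        unfolding h_def
      proof (rule diff_entropy_smear_le[OF \<sigma> a \<xi> _ _ X X01 mean])
        show "((\<lambda>y. y) has_real_derivative exp (- 0 * y)) (at y)" for y :: real by simp
        have "mid_prob \<sigma> a \<xi> (a * X g) \<le> mid_prob \<sigma> a \<xi> (a / 2)" for g
          by (rule mid_prob_le_half[OF \<sigma> \<xi>]) (use a X01[of g] in \<open>auto simp: mult_left_le\<close>)
        then show "(\<integral>g. mid_prob \<sigma> a \<xi> (a * X g) \<partial>std_gauss) \<le> mid_prob \<sigma> a \<xi> (a / 2)"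
          by (intro integral_le_const integrable_mid_prob[OF \<sigma> aX]) auto
      qed simp
      also have "mid_prob \<sigma> a \<xi> (a / 2) = 1 - 2 * Qf ((\<xi> + a / 2) / \<sigma>)"
        unfolding mid_prob_def by (simp add: algebra_simps)
      also have "\<xi> * normal_density 0 \<sigma> \<xi> = \<xi> / (sqrt (2 * pi) * \<sigma>) * exp (- (\<xi>\<^sup>2) / (2 * \<sigma>\<^sup>2))"
        using \<sigma> by (simp add: normal_density_alt)
      also have "((a + \<xi>) - (- \<xi>)) / (sqrt (2 * pi) * \<sigma> * (1 - 2 * Qf (\<xi> / \<sigma>)))
          = (a + 2 * \<xi>) / (\<sigma> * sqrt (2 * pi) * (1 - 2 * Qf (\<xi> / \<sigma>)))"
        by (simp add: mult_ac)
      finally show "h \<le> ln (2 * pi * \<sigma>\<^sup>2) / 2 + (ln 2 * c2_expr \<sigma> a \<xi> + 1 / 2)"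
        unfolding c2_expr_def log_def by (simp add: distrib_left)
    qed
    then have "d \<le> Inf {c2_expr \<sigma> a \<xi> |\<xi>. \<xi> > 0}"
      by (intro cInf_greatest) (use zero_less_one in blast)+
    then show ?thesis using False a by (simp add: Cbar_def)
  qed
  then show ?thesis
    unfolding d_def h_def[symmetric] by (simp add: field_simps)
qed

text \<open>The entropy power of interference plus noise is at most the denominator in
  \<open>Ffun\<close>, so the entropy power bound on the mutual information dominates. The factor
  \<open>ln 2\<close> converts bits to nats.\<close>

lemma Ffun_le_mutual_info:
  fixes T1 T1' T2 :: "real \<Rightarrow> real" and \<sigma> a b \<theta>1 \<theta>2 :: real
  assumes \<sigma>: "\<sigma> > 0" and a: "a \<ge> 0" and b: "b \<ge> 0" and \<theta>2: "0 < \<theta>2"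
    and T1: "\<And>x. (T1 has_real_derivative T1' x) (at x)" "\<And>x. 0 < T1' x"
      "T1' \<in> borel_measurable borel" "\<And>x. 0 \<le> T1 x" "\<And>x. T1 x \<le> 1"
      "integrable std_gauss (\<lambda>x. ln (T1' x))"
      "integral\<^sup>L std_gauss (\<lambda>x. ln (T1' x)) = ln (rho \<theta>1) / 2" "rho \<theta>1 > 0"
    and T2: "T2 \<in> borel_measurable borel" "\<And>x. 0 \<le> T2 x" "\<And>x. T2 x \<le> 1"
      "integral\<^sup>L std_gauss T2 \<le> \<theta>2"
  shows "ln 2 * Ffun \<sigma> 0 a b 1 \<theta>1 \<theta>2
    \<le> mutual_info (\<lambda>g. a * T1 g) (smear (\<lambda>g. b * T2 g) (normal_density 0 \<sigma>))"
proof -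
  define w where "w = smear (\<lambda>g. b * T2 g) (normal_density 0 \<sigma>)"
  have w: "gauss_like \<sigma> w"
    unfolding w_def
    by (rule gauss_like_smear[OF \<sigma> gauss_like_normal_density[OF \<sigma>], where b=b])
      (use T2 b in \<open>auto simp: abs_mult mult_left_le\<close>)
  have h: "2 * diff_entropy w \<le> ln (2 * pi * \<sigma>\<^sup>2) + 1 + ln 2 * (2 * Cbar \<sigma> b \<theta>2)"
    using diff_entropy_le_Cbar[OF \<sigma> b \<theta>2 T2] by (simp add: w_def field_simps)
  have "exp (2 * diff_entropy w) \<le> exp (ln (2 * pi * \<sigma>\<^sup>2) + 1 + ln 2 * (2 * Cbar \<sigma> b \<theta>2))"
    using h by simp
  also have "\<dots> = (2 * pi * exp 1) * (\<sigma>\<^sup>2 * 2 powr (2 * Cbar \<sigma> b \<theta>2))"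
    using \<sigma> by (simp add: exp_add powr_def mult_ac)
  finally have e: "exp (2 * diff_entropy w) / (2 * pi * exp 1) \<le> \<sigma>\<^sup>2 * 2 powr (2 * Cbar \<sigma> b \<theta>2)"
    by (simp add: field_simps)
  have "rho \<theta>1 * a\<^sup>2 / (\<sigma>\<^sup>2 * 2 powr (2 * Cbar \<sigma> b \<theta>2))
      \<le> rho \<theta>1 * a\<^sup>2 / (exp (2 * diff_entropy w) / (2 * pi * exp 1))"
    using e T1(8) \<sigma> by (intro divide_left_mono) auto
  then have "ln (1 + rho \<theta>1 * a\<^sup>2 / (\<sigma>\<^sup>2 * 2 powr (2 * Cbar \<sigma> b \<theta>2)))
      \<le> ln (1 + rho \<theta>1 * a\<^sup>2 * (2 * pi * exp 1) / exp (2 * diff_entropy w))"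
    using T1(8) \<sigma> by (subst ln_le_cancel_iff) (auto intro!: add_pos_nonneg divide_nonneg_nonneg mult_nonneg_nonneg)
  moreover have "ln 2 * Ffun \<sigma> 0 a b 1 \<theta>1 \<theta>2
      = ln (1 + rho \<theta>1 * a\<^sup>2 / (\<sigma>\<^sup>2 * 2 powr (2 * Cbar \<sigma> b \<theta>2))) / 2"
    by (simp add: Ffun_def log_def)
  ultimately show ?thesis
    using mutual_info_ge[OF \<sigma> w a T1] unfolding w_def[symmetric] by linarith
qed

section \<open>Exponential bounds and product measures\<close>

lemma exp_le_quadratic:
  fixes x :: real
  shows "exp x \<le> 1 + x + x\<^sup>2 * exp \<bar>x\<bar>"
proof -
  obtain t where t: "\<bar>t\<bar> \<le> \<bar>x\<bar>" "exp x = (\<Sum>m<2. x ^ m / fact m) + exp t / fact 2 * x ^ 2"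
    using Maclaurin_exp_le[of x 2] by blast
  have "exp t / 2 * x\<^sup>2 \<le> exp \<bar>x\<bar> * x\<^sup>2"
    using t(1) by (intro mult_right_mono) (auto intro: order_trans[OF _ exp_le_cancel_iff[THEN iffD2]]
        simp: field_simps intro!: order_trans[of "exp t" "exp \<bar>x\<bar>"])
  then show ?thesis using t(2) by (simp add: eval_nat_numeral mult.commute)
qed

text \<open>A second-order bound on the exponential gives at most
  \<open>1 - s * m + s * (s * K)\<close>, and for \<open>s < m / (2 * K)\<close> the quadratic term
  costs no more than half of the linear one. Validity for all small \<open>s\<close> lets finitely
  many such bounds share one exponent.\<close>

lemma (in prob_space) chernoff_eventually:
  fixes u :: "'a \<Rightarrow> real"
  assumes [measurable]: "u \<in> borel_measurable M"
    and int: "integrable M (\<lambda>x. exp (2 * \<bar>u x\<bar>))" and m: "0 < m" "m \<le> expectation u"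
  shows "\<forall>\<^sub>F s in at_right 0. (\<integral>\<^sup>+x. ennreal (exp (- s * u x)) \<partial>M) \<le> ennreal (exp (- s * m / 2))"
proof -
  define K where "K = 2 * expectation (\<lambda>x. exp (2 * \<bar>u x\<bar>))"
  have "1 \<le> expectation (\<lambda>x. exp (2 * \<bar>u x\<bar>))"
    using int by (intro integral_ge_const) auto
  then have K: "K > 0" by (simp add: K_def)
  have iu: "integrable M u"
    by (rule Bochner_Integration.integrable_bound[OF int])
      (auto intro!: AE_I2 order_trans[OF _ exp_ge_add_one_self[THEN order_trans[rotated]]])
  have bound: "(\<integral>\<^sup>+x. ennreal (exp (- s * u x)) \<partial>M) \<le> ennreal (exp (- s * m / 2))"
    if s: "0 < s" "s < min 1 (m / (2 * K))" for s
  proof -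
    have pw: "exp (- s * u x) \<le> 1 - s * u x + s\<^sup>2 * (2 * exp (2 * \<bar>u x\<bar>))" for x
    proof -
      have "exp (- s * u x) \<le> 1 + - s * u x + (- s * u x)\<^sup>2 * exp \<bar>- s * u x\<bar>"
        by (rule exp_le_quadratic)
      also have "(- s * u x)\<^sup>2 * exp \<bar>- s * u x\<bar> \<le> s\<^sup>2 * ((u x)\<^sup>2 * exp \<bar>u x\<bar>)"
        using s by (auto simp: power_mult_distrib abs_mult mult_left_le_one_le mult.assoc intro!: mult_left_mono)
      also have "(u x)\<^sup>2 * exp \<bar>u x\<bar> \<le> (2 * exp \<bar>u x\<bar>) * exp \<bar>u x\<bar>"
      proof (rule mult_right_mono)
        have "1 + \<bar>u x\<bar> + \<bar>u x\<bar>\<^sup>2 / 2 \<le> exp \<bar>u x\<bar>" by (rule exp_lower_Taylor_quadratic) simp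
        then show "(u x)\<^sup>2 \<le> 2 * exp \<bar>u x\<bar>" by simp
      qed simp
      also have "(2 * exp \<bar>u x\<bar>) * exp \<bar>u x\<bar> = 2 * exp (2 * \<bar>u x\<bar>)"
        by (simp add: mult_exp_exp)
      finally show ?thesis using s by (simp add: mult_left_mono)
    qed
    have iexp: "integrable M (\<lambda>x. exp (- s * u x))"
    proof (rule Bochner_Integration.integrable_bound[OF int])
      have "- s * u x \<le> 2 * \<bar>u x\<bar>" for x
      proof -
        have "- s * u x \<le> s * \<bar>u x\<bar>" using s mult_left_mono[of "- u x" "\<bar>u x\<bar>" s] by simp
        also have "\<dots> \<le> 2 * \<bar>u x\<bar>" using s by (intro mult_right_mono) auto
        finally show ?thesis .
      qed
      then show "AE x in M. norm (exp (- s * u x)) \<le> norm (exp (2 * \<bar>u x\<bar>))" by (auto intro!: AE_I2)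
    qed simp
    have "expectation (\<lambda>x. exp (- s * u x)) \<le> expectation (\<lambda>x. 1 - s * u x + s\<^sup>2 * (2 * exp (2 * \<bar>u x\<bar>)))"
      using iexp iu int pw by (intro integral_mono) auto
    also have "\<dots> = 1 - s * expectation u + s * (s * K)"
      using iu int prob_space by (simp add: K_def power2_eq_square)
    also have "\<dots> \<le> 1 + (- s * m / 2)"
    proof -
      have "s * K \<le> m / 2" using s K by (simp add: field_simps)
      then have "s * (s * K) \<le> s * (m / 2)" "s * m \<le> s * expectation u"
        using s m by (auto intro!: mult_left_mono)
      then show ?thesis by simp
    qed
    also have "\<dots> \<le> exp (- s * m / 2)" by (rule exp_ge_add_one_self)
    finally have "expectation (\<lambda>x. exp (- s * u x)) \<le> exp (- s * m / 2)" .
    then show ?thesis using iexp by (subst nn_integral_eq_integral) auto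
  qed
  show ?thesis
    unfolding eventually_at_right_field using bound K m
    by (intro exI[of _ "min 1 (m / (2 * K))"]) auto
qed

section \<open>Integrals over finite product measures\<close>

lemma nn_integral_PiM_component:
  assumes G: "prob_space G" and "i \<in> I" and [measurable]: "f \<in> borel_measurable G"
  shows "(\<integral>\<^sup>+\<omega>. f (\<omega> i) \<partial>PiM I (\<lambda>_. G)) = (\<integral>\<^sup>+x. f x \<partial>G)"
proof -
  have "(\<integral>\<^sup>+x. f x \<partial>G) = (\<integral>\<^sup>+x. f x \<partial>distr (PiM I (\<lambda>_. G)) G (\<lambda>\<omega>. \<omega> i))"
    using assms by (subst distr_PiM_component[where M="\<lambda>_. G"]) auto
  also have "\<dots> = (\<integral>\<^sup>+\<omega>. f (\<omega> i) \<partial>PiM I (\<lambda>_. G))"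
    using assms by (subst nn_integral_distr) auto
  finally show ?thesis ..
qed

lemma nn_integral_PiM_two_components:
  assumes G: "prob_space G" and I: "finite I" "i \<in> I" "j \<in> I" "i \<noteq> j"
    and f[measurable]: "case_prod f \<in> borel_measurable (G \<Otimes>\<^sub>M G)"
  shows "(\<integral>\<^sup>+\<omega>. f (\<omega> i) (\<omega> j) \<partial>PiM I (\<lambda>_. G)) = (\<integral>\<^sup>+x. \<integral>\<^sup>+y. f x y \<partial>G \<partial>G)"
proof -
  interpret G: prob_space G by (fact G)
  interpret product_sigma_finite "\<lambda>_. G" by (rule product_sigma_finite.intro) (rule G.sigma_finite_measure_axioms)
  define J where "J = I - {i}"
  have J: "I = insert i J" "i \<notin> J" "finite J" "j \<in> J" using I by (auto simp: J_def)
  have meas: "(\<lambda>\<omega>. f (\<omega> i) (\<omega> j)) \<in> borel_measurable (PiM (insert i J) (\<lambda>_. G))"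
  proof -
    have "(\<lambda>\<omega>. (\<omega> i, \<omega> j)) \<in> measurable (PiM (insert i J) (\<lambda>_. G)) (G \<Otimes>\<^sub>M G)"
      using J by (intro measurable_Pair measurable_component_singleton) auto
    from measurable_compose[OF this f] show ?thesis by simp
  qed
  have "(\<integral>\<^sup>+\<omega>. f (\<omega> i) (\<omega> j) \<partial>PiM I (\<lambda>_. G))
      = (\<integral>\<^sup>+y. (\<integral>\<^sup>+x. f ((x(i := y)) i) ((x(i := y)) j) \<partial>PiM J (\<lambda>_. G)) \<partial>G)"
    unfolding J(1) by (rule product_nn_integral_insert_rev) (use J meas in auto)
  also have "\<dots> = (\<integral>\<^sup>+y. \<integral>\<^sup>+x. f y (x j) \<partial>PiM J (\<lambda>_. G) \<partial>G)"
    using I(4) by simp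
  also have "\<dots> = (\<integral>\<^sup>+y. \<integral>\<^sup>+x. f y x \<partial>G \<partial>G)"
  proof (rule nn_integral_cong)
    fix y assume "y \<in> space G"
    then have "(\<lambda>x. f y x) \<in> borel_measurable G"
      using measurable_compose[OF measurable_Pair1' f, of y] by simp
    then show "(\<integral>\<^sup>+x. f y (x j) \<partial>PiM J (\<lambda>_. G)) = (\<integral>\<^sup>+x. f y x \<partial>G)"
      using G J(4) by (intro nn_integral_PiM_component)
  qed
  finally show ?thesis .
qed

lemma nn_integral_PiM_prod:
  assumes "finite I" and G: "prob_space G" and "\<And>i. i \<in> I \<Longrightarrow> f i \<in> borel_measurable G"
  shows "(\<integral>\<^sup>+x. (\<Prod>i\<in>I. f i (x i)) \<partial>PiM I (\<lambda>_. G)) = (\<Prod>i\<in>I. integral\<^sup>N G (f i))"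
proof -
  interpret G: prob_space G by (fact G)
  interpret product_sigma_finite "\<lambda>_. G" by (rule product_sigma_finite.intro) (rule G.sigma_finite_measure_axioms)
  show ?thesis using assms by (intro product_nn_integral_prod)
qed

lemma (in prob_space) nn_integral_exists_le:
  assumes "(\<integral>\<^sup>+x. f x \<partial>M) \<le> ennreal e" "e < e'" and [measurable]: "f \<in> borel_measurable M"
    and "0 \<le> e"
  shows "\<exists>x\<in>space M. f x \<le> ennreal e'"
proof (rule ccontr)
  assume "\<not> ?thesis"
  then have "\<And>x. x \<in> space M \<Longrightarrow> ennreal e' \<le> f x" by force
  then have "(\<integral>\<^sup>+x. ennreal e' \<partial>M) \<le> (\<integral>\<^sup>+x. f x \<partial>M)" by (rule nn_integral_mono)
  then have "ennreal e' \<le> ennreal e" using assms(1) emeasure_space_1 by simp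
  then show False using assms by (simp add: ennreal_le_iff)
qed

section \<open>Random codebooks and threshold decoding\<close>

lemma sum_sum_ennreal:
  assumes "\<And>i j. 0 \<le> f i j"
  shows "(\<Sum>i\<in>I. \<Sum>j\<in>J. ennreal (f i j)) = ennreal (\<Sum>i\<in>I. \<Sum>j\<in>J. f i j)"
  using assms by (simp add: sum_ennreal sum_nonneg)

text \<open>Union bound for threshold decoding, averaged over the messages: \<open>A\<close>
  collects the failures caused by the sent pair, \<open>B\<close> the acceptance of a competitor.
  Abstract words allow one averaging lemma for both receivers.\<close>

definition codebook_avg :: "nat \<Rightarrow> nat \<Rightarrow> ('w \<Rightarrow> 'w \<Rightarrow> ennreal) \<Rightarrow> ('w \<Rightarrow> 'w \<Rightarrow> 'w \<Rightarrow> ennreal)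
    \<Rightarrow> (nat \<Rightarrow> 'w) \<Rightarrow> (nat \<Rightarrow> 'w) \<Rightarrow> ennreal" where
  "codebook_avg M M' A B u v = ennreal (1 / (real M * real M')) *
     (\<Sum>m\<in>{1..M}. \<Sum>m'\<in>{1..M'}. A (u m) (v m') + (\<Sum>l\<in>{1..M}-{m}. B (u l) (u m) (v m')))"

lemma codebook_avg_measurable:
  assumes A: "case_prod A \<in> borel_measurable (G \<Otimes>\<^sub>M G)"
    and B: "(\<lambda>(l, a, b). B l a b) \<in> borel_measurable (G \<Otimes>\<^sub>M (G \<Otimes>\<^sub>M G))"
  shows "(\<lambda>z. codebook_avg M M' A B (fst z) (snd z))
    \<in> borel_measurable (PiM {1..M} (\<lambda>_. G) \<Otimes>\<^sub>M PiM {1..M'} (\<lambda>_. G))"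
proof -
  let ?P = "PiM {1..M} (\<lambda>_. G) \<Otimes>\<^sub>M PiM {1..M'} (\<lambda>_. G)"
  have u: "(\<lambda>z. fst z m) \<in> measurable ?P G" if "m \<in> {1..M}" for m
    using that by (intro measurable_compose[OF measurable_fst measurable_component_singleton])
  have v: "(\<lambda>z. snd z m) \<in> measurable ?P G" if "m \<in> {1..M'}" for m
    using that by (intro measurable_compose[OF measurable_snd measurable_component_singleton])
  have "(\<lambda>z. A (fst z m) (snd z m')) \<in> borel_measurable ?P" if "m \<in> {1..M}" "m' \<in> {1..M'}" for m m'
    using measurable_compose[OF measurable_Pair[OF u[OF that(1)] v[OF that(2)]] A] by simp
  moreover have "(\<lambda>z. B (fst z l) (fst z m) (snd z m')) \<in> borel_measurable ?P"
    if "l \<in> {1..M}" "m \<in> {1..M}" "m' \<in> {1..M'}" for l m m'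
    using measurable_compose[OF measurable_Pair[OF u[OF that(1)] measurable_Pair[OF u[OF that(2)] v[OF that(3)]]] B]
    by simp
  ultimately show ?thesis
    unfolding codebook_avg_def
    by (intro borel_measurable_times_ennreal borel_measurable_const borel_measurable_sum borel_measurable_add) auto
qed

text \<open>Words at distinct indices are independent, so each term reduces to an integral over two
  or three words: \<open>\<alpha>\<close> for the sent pair and \<open>\<beta>\<close> for each of
  the \<open>M - 1\<close> competitors.\<close>

lemma expected_codebook_avg:
  fixes G :: "'w measure"
  assumes G: "prob_space G" and M: "M \<ge> 1" "M' \<ge> 1"
    and A: "case_prod A \<in> borel_measurable (G \<Otimes>\<^sub>M G)"
    and B: "(\<lambda>(l, a, b). B l a b) \<in> borel_measurable (G \<Otimes>\<^sub>M (G \<Otimes>\<^sub>M G))"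
    and A_le: "(\<integral>\<^sup>+a. \<integral>\<^sup>+b. A a b \<partial>G \<partial>G) \<le> ennreal \<alpha>" "0 \<le> \<alpha>"
    and B_le: "(\<integral>\<^sup>+l. \<integral>\<^sup>+a. \<integral>\<^sup>+b. B l a b \<partial>G \<partial>G \<partial>G) \<le> ennreal \<beta>" "0 \<le> \<beta>"
  shows "(\<integral>\<^sup>+u. \<integral>\<^sup>+v. codebook_avg M M' A B u v \<partial>PiM {1..M'} (\<lambda>_. G) \<partial>PiM {1..M} (\<lambda>_. G))
    \<le> ennreal (\<alpha> + (real M - 1) * \<beta>)"
proof -
  interpret G: prob_space G by (fact G)
  let ?U = "PiM {1..M} (\<lambda>_. G)" and ?V = "PiM {1..M'} (\<lambda>_. G)"
  interpret U: prob_space ?U by (rule prob_space_PiM) (rule G)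
  interpret V: prob_space ?V by (rule prob_space_PiM) (rule G)
  interpret UV: pair_prob_space ?U ?V ..
  let ?P = "?U \<Otimes>\<^sub>M ?V"
  have u: "(\<lambda>z. fst z m) \<in> measurable ?P G" if "m \<in> {1..M}" for m
    using that by (intro measurable_compose[OF measurable_fst measurable_component_singleton])
  have v: "(\<lambda>z. snd z m) \<in> measurable ?P G" if "m \<in> {1..M'}" for m
    using that by (intro measurable_compose[OF measurable_snd measurable_component_singleton])
  have mA: "(\<lambda>z. A (fst z m) (snd z m')) \<in> borel_measurable ?P" if "m \<in> {1..M}" "m' \<in> {1..M'}" for m m'
    using measurable_compose[OF measurable_Pair[OF u[OF that(1)] v[OF that(2)]] A] by simp
  have mB: "(\<lambda>z. B (fst z l) (fst z m) (snd z m')) \<in> borel_measurable ?P"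
    if "l \<in> {1..M}" "m \<in> {1..M}" "m' \<in> {1..M'}" for l m m'
    using measurable_compose[OF measurable_Pair[OF u[OF that(1)] measurable_Pair[OF u[OF that(2)] v[OF that(3)]]] B]
    by simp
  have A1: "(\<lambda>b. A a b) \<in> borel_measurable G" if "a \<in> space G" for a
    using measurable_compose[OF measurable_Pair1'[OF that] A] by simp
  have B1: "(\<lambda>b. B l a b) \<in> borel_measurable G" if "l \<in> space G" "a \<in> space G" for l a
    using measurable_compose[OF measurable_Pair1'[OF that(2)] measurable_compose[OF measurable_Pair1'[OF that(1)] B]]
    by simp
  have A2: "(\<lambda>a. \<integral>\<^sup>+b. A a b \<partial>G) \<in> borel_measurable G"
    using A by (rule G.borel_measurable_nn_integral)
  have B2: "case_prod (\<lambda>l a. \<integral>\<^sup>+b. B l a b \<partial>G) \<in> borel_measurable (G \<Otimes>\<^sub>M G)"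
  proof -
    have "(\<lambda>z. ((fst (fst z)), snd (fst z), snd z)) \<in> measurable ((G \<Otimes>\<^sub>M G) \<Otimes>\<^sub>M G) (G \<Otimes>\<^sub>M (G \<Otimes>\<^sub>M G))"
      by measurable
    from measurable_compose[OF this B]
    have "case_prod (\<lambda>z b. B (fst z) (snd z) b) \<in> borel_measurable ((G \<Otimes>\<^sub>M G) \<Otimes>\<^sub>M G)"
      by (simp add: case_prod_beta')
    then have "(\<lambda>z. \<integral>\<^sup>+b. B (fst z) (snd z) b \<partial>G) \<in> borel_measurable (G \<Otimes>\<^sub>M G)"
      by (rule G.borel_measurable_nn_integral)
    then show ?thesis by (simp add: case_prod_beta')
  qed
  have spU: "\<omega> m \<in> space G" if "\<omega> \<in> space ?U" "m \<in> {1..M}" for \<omega> m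
    using that by (auto simp: space_PiM PiE_iff)
  have int_A: "(\<integral>\<^sup>+z. A (fst z m) (snd z m') \<partial>?P) \<le> ennreal \<alpha>" if m: "m \<in> {1..M}" "m' \<in> {1..M'}" for m m'
  proof -
    have "(\<integral>\<^sup>+z. A (fst z m) (snd z m') \<partial>?P) = (\<integral>\<^sup>+u. \<integral>\<^sup>+v. A (u m) (v m') \<partial>?V \<partial>?U)"
      using V.nn_integral_fst[OF mA[OF m]] by simp
    also have "\<dots> = (\<integral>\<^sup>+u. \<integral>\<^sup>+b. A (u m) b \<partial>G \<partial>?U)"
      using m spU by (intro nn_integral_cong nn_integral_PiM_component[OF G] A1) auto
    also have "\<dots> = (\<integral>\<^sup>+a. \<integral>\<^sup>+b. A a b \<partial>G \<partial>G)"
      using m by (intro nn_integral_PiM_component[OF G] A2) auto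
    finally show ?thesis using A_le by simp
  qed
  have int_B: "(\<integral>\<^sup>+z. B (fst z l) (fst z m) (snd z m') \<partial>?P) \<le> ennreal \<beta>"
    if m: "l \<in> {1..M}" "m \<in> {1..M}" "m' \<in> {1..M'}" "l \<noteq> m" for l m m'
  proof -
    have "(\<integral>\<^sup>+z. B (fst z l) (fst z m) (snd z m') \<partial>?P) = (\<integral>\<^sup>+u. \<integral>\<^sup>+v. B (u l) (u m) (v m') \<partial>?V \<partial>?U)"
      using V.nn_integral_fst[OF mB[OF m(1-3)]] by simp
    also have "\<dots> = (\<integral>\<^sup>+u. \<integral>\<^sup>+b. B (u l) (u m) b \<partial>G \<partial>?U)"
      using m spU by (intro nn_integral_cong nn_integral_PiM_component[OF G] B1) auto
    also have "\<dots> = (\<integral>\<^sup>+l. \<integral>\<^sup>+a. \<integral>\<^sup>+b. B l a b \<partial>G \<partial>G \<partial>G)"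
      using m by (intro nn_integral_PiM_two_components[OF G _ _ _ _ B2]) auto
    finally show ?thesis using B_le by simp
  qed
  have "(\<integral>\<^sup>+u. \<integral>\<^sup>+v. codebook_avg M M' A B u v \<partial>?V \<partial>?U) = (\<integral>\<^sup>+z. codebook_avg M M' A B (fst z) (snd z) \<partial>?P)"
    using V.nn_integral_fst[OF codebook_avg_measurable[OF A B]] by simp
  also have "\<dots> = ennreal (1 / (real M * real M')) * (\<Sum>m\<in>{1..M}. \<Sum>m'\<in>{1..M'}.
      (\<integral>\<^sup>+z. A (fst z m) (snd z m') \<partial>?P) + (\<Sum>l\<in>{1..M}-{m}. \<integral>\<^sup>+z. B (fst z l) (fst z m) (snd z m') \<partial>?P))"
  proof -
    have mBs: "(\<lambda>z. \<Sum>l\<in>{1..M}-{m}. B (fst z l) (fst z m) (snd z m')) \<in> borel_measurable ?P"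
      if "m \<in> {1..M}" "m' \<in> {1..M'}" for m m'
      using mB that by (intro borel_measurable_sum) auto
    have mS: "(\<lambda>z. A (fst z m) (snd z m') + (\<Sum>l\<in>{1..M}-{m}. B (fst z l) (fst z m) (snd z m'))) \<in> borel_measurable ?P"
      if "m \<in> {1..M}" "m' \<in> {1..M'}" for m m'
      using mA mBs that by (intro borel_measurable_add) auto
    have "(\<integral>\<^sup>+z. codebook_avg M M' A B (fst z) (snd z) \<partial>?P)
        = ennreal (1 / (real M * real M')) * (\<integral>\<^sup>+z. (\<Sum>m\<in>{1..M}. \<Sum>m'\<in>{1..M'}.
            A (fst z m) (snd z m') + (\<Sum>l\<in>{1..M}-{m}. B (fst z l) (fst z m) (snd z m'))) \<partial>?P)"
      unfolding codebook_avg_def using mS by (intro nn_integral_cmult borel_measurable_sum) auto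
    also have "(\<integral>\<^sup>+z. (\<Sum>m\<in>{1..M}. \<Sum>m'\<in>{1..M'}.
            A (fst z m) (snd z m') + (\<Sum>l\<in>{1..M}-{m}. B (fst z l) (fst z m) (snd z m'))) \<partial>?P)
        = (\<Sum>m\<in>{1..M}. \<integral>\<^sup>+z. (\<Sum>m'\<in>{1..M'}.
            A (fst z m) (snd z m') + (\<Sum>l\<in>{1..M}-{m}. B (fst z l) (fst z m) (snd z m'))) \<partial>?P)"
      using mS by (intro nn_integral_sum borel_measurable_sum) auto
    also have "\<dots> = (\<Sum>m\<in>{1..M}. \<Sum>m'\<in>{1..M'}. \<integral>\<^sup>+z.
            A (fst z m) (snd z m') + (\<Sum>l\<in>{1..M}-{m}. B (fst z l) (fst z m) (snd z m')) \<partial>?P)"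
      using mS by (intro sum.cong refl nn_integral_sum) auto
    also have "\<dots> = (\<Sum>m\<in>{1..M}. \<Sum>m'\<in>{1..M'}. (\<integral>\<^sup>+z. A (fst z m) (snd z m') \<partial>?P)
          + (\<integral>\<^sup>+z. (\<Sum>l\<in>{1..M}-{m}. B (fst z l) (fst z m) (snd z m')) \<partial>?P))"
      using mA mBs by (intro sum.cong refl nn_integral_add) auto
    also have "\<dots> = (\<Sum>m\<in>{1..M}. \<Sum>m'\<in>{1..M'}. (\<integral>\<^sup>+z. A (fst z m) (snd z m') \<partial>?P)
          + (\<Sum>l\<in>{1..M}-{m}. \<integral>\<^sup>+z. B (fst z l) (fst z m) (snd z m') \<partial>?P))"
      using mB by (intro sum.cong refl arg_cong2[where f="(+)"] nn_integral_sum) auto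
    finally show ?thesis .
  qed
  also have "\<dots> \<le> ennreal (1 / (real M * real M')) * (\<Sum>m\<in>{1..M}. \<Sum>m'\<in>{1..M'}.
      ennreal \<alpha> + (\<Sum>l\<in>{1..M}-{m}. ennreal \<beta>))"
    by (intro mult_left_mono sum_mono add_mono int_A int_B) auto
  also have "\<dots> = ennreal (1 / (real M * real M')) * ennreal (real M * real M' * (\<alpha> + (real M - 1) * \<beta>))"
  proof -
    have "(\<Sum>m\<in>{1..M}. \<Sum>m'\<in>{1..M'}. ennreal \<alpha> + (\<Sum>l\<in>{1..M}-{m}. ennreal \<beta>))
        = (\<Sum>m\<in>{1..M}. \<Sum>m'\<in>{1..M'}. ennreal (\<alpha> + (real M - 1) * \<beta>))"
    proof (intro sum.cong refl)
      fix m assume m: "m \<in> {1..M}"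
      have "(\<Sum>l\<in>{1..M}-{m}. ennreal \<beta>) = ennreal (\<Sum>l\<in>{1..M}-{m}. \<beta>)"
        using B_le(2) by (intro sum_ennreal) auto
      also have "(\<Sum>l\<in>{1..M}-{m}. \<beta>) = (real M - 1) * \<beta>"
        using m M by (simp add: of_nat_diff)
      finally show "ennreal \<alpha> + (\<Sum>l\<in>{1..M}-{m}. ennreal \<beta>) = ennreal (\<alpha> + (real M - 1) * \<beta>)"
        using A_le(2) B_le(2) M by simp
    qed
    also have "\<dots> = ennreal (\<Sum>m\<in>{1..M}. \<Sum>m'\<in>{1..M'}. \<alpha> + (real M - 1) * \<beta>)"
      using A_le(2) B_le(2) M by (intro sum_sum_ennreal) auto
    finally show ?thesis by (simp add: mult.assoc)
  qed
  also have "\<dots> = ennreal (\<alpha> + (real M - 1) * \<beta>)"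
    using M A_le(2) B_le(2) by (subst ennreal_mult[symmetric]) auto
  finally show ?thesis .
qed

text \<open>Both receivers depend on the same pair of codebooks, so their bounds are added before
  averaging; a single realisation is then good for both.\<close>

lemma random_codebooks:
  fixes G :: "'w measure"
  assumes G: "prob_space G" and M: "M1 \<ge> 1" "M2 \<ge> 1"
    and A1: "case_prod A1 \<in> borel_measurable (G \<Otimes>\<^sub>M G)"
    and B1: "(\<lambda>(l, a, b). B1 l a b) \<in> borel_measurable (G \<Otimes>\<^sub>M (G \<Otimes>\<^sub>M G))"
    and A2: "case_prod A2 \<in> borel_measurable (G \<Otimes>\<^sub>M G)"
    and B2: "(\<lambda>(l, a, b). B2 l a b) \<in> borel_measurable (G \<Otimes>\<^sub>M (G \<Otimes>\<^sub>M G))"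
    and A1_le: "(\<integral>\<^sup>+a. \<integral>\<^sup>+b. A1 a b \<partial>G \<partial>G) \<le> ennreal \<alpha>1" "0 \<le> \<alpha>1"
    and B1_le: "(\<integral>\<^sup>+l. \<integral>\<^sup>+a. \<integral>\<^sup>+b. B1 l a b \<partial>G \<partial>G \<partial>G) \<le> ennreal \<beta>1" "0 \<le> \<beta>1"
    and A2_le: "(\<integral>\<^sup>+a. \<integral>\<^sup>+b. A2 a b \<partial>G \<partial>G) \<le> ennreal \<alpha>2" "0 \<le> \<alpha>2"
    and B2_le: "(\<integral>\<^sup>+l. \<integral>\<^sup>+a. \<integral>\<^sup>+b. B2 l a b \<partial>G \<partial>G \<partial>G) \<le> ennreal \<beta>2" "0 \<le> \<beta>2"
    and \<eta>: "0 < \<eta>"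
  shows "\<exists>u v. codebook_avg M1 M2 A1 B1 u v + codebook_avg M2 M1 A2 B2 v u
    \<le> ennreal (\<alpha>1 + (real M1 - 1) * \<beta>1 + (\<alpha>2 + (real M2 - 1) * \<beta>2) + \<eta>)"
proof -
  let ?U = "PiM {1..M1} (\<lambda>_. G)" and ?V = "PiM {1..M2} (\<lambda>_. G)"
  interpret U: prob_space ?U by (rule prob_space_PiM) (rule G)
  interpret V: prob_space ?V by (rule prob_space_PiM) (rule G)
  interpret UV: pair_prob_space ?U ?V ..
  interpret VU: pair_prob_space ?V ?U ..
  define e where "e = \<alpha>1 + (real M1 - 1) * \<beta>1 + (\<alpha>2 + (real M2 - 1) * \<beta>2)"
  have e: "0 \<le> \<alpha>1 + (real M1 - 1) * \<beta>1" "0 \<le> \<alpha>2 + (real M2 - 1) * \<beta>2"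
    using A1_le A2_le B1_le B2_le M by auto
  define J where "J = (\<lambda>u v. codebook_avg M1 M2 A1 B1 u v + codebook_avg M2 M1 A2 B2 v u)"
  note m1 = codebook_avg_measurable[OF A1 B1, of M1 M2]
  have m2: "(\<lambda>z. codebook_avg M2 M1 A2 B2 (snd z) (fst z)) \<in> borel_measurable (?U \<Otimes>\<^sub>M ?V)"
    using measurable_compose[OF measurable_pair_swap' codebook_avg_measurable[OF A2 B2, of M2 M1]]
    by (simp add: case_prod_beta')
  have mJ: "case_prod J \<in> borel_measurable (?U \<Otimes>\<^sub>M ?V)"
    unfolding J_def using borel_measurable_add[OF m1 m2] by (simp add: case_prod_beta')
  have "(\<integral>\<^sup>+u. \<integral>\<^sup>+v. J u v \<partial>?V \<partial>?U) = (\<integral>\<^sup>+z. J (fst z) (snd z) \<partial>(?U \<Otimes>\<^sub>M ?V))"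
    using V.nn_integral_fst[OF mJ] by (simp add: case_prod_beta')
  also have "\<dots> = (\<integral>\<^sup>+z. codebook_avg M1 M2 A1 B1 (fst z) (snd z) \<partial>(?U \<Otimes>\<^sub>M ?V))
      + (\<integral>\<^sup>+z. codebook_avg M2 M1 A2 B2 (snd z) (fst z) \<partial>(?U \<Otimes>\<^sub>M ?V))"
    unfolding J_def by (rule nn_integral_add[OF m1 m2])
  also have "(\<integral>\<^sup>+z. codebook_avg M1 M2 A1 B1 (fst z) (snd z) \<partial>(?U \<Otimes>\<^sub>M ?V))
      = (\<integral>\<^sup>+u. \<integral>\<^sup>+v. codebook_avg M1 M2 A1 B1 u v \<partial>?V \<partial>?U)"
    using V.nn_integral_fst[OF m1] by simp
  also have "(\<integral>\<^sup>+z. codebook_avg M2 M1 A2 B2 (snd z) (fst z) \<partial>(?U \<Otimes>\<^sub>M ?V))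
      = (\<integral>\<^sup>+v. \<integral>\<^sup>+u. codebook_avg M2 M1 A2 B2 v u \<partial>?U \<partial>?V)"
    using UV.nn_integral_snd[OF m2] by simp
  also have "(\<integral>\<^sup>+u. \<integral>\<^sup>+v. codebook_avg M1 M2 A1 B1 u v \<partial>?V \<partial>?U)
      + (\<integral>\<^sup>+v. \<integral>\<^sup>+u. codebook_avg M2 M1 A2 B2 v u \<partial>?U \<partial>?V)
      \<le> ennreal (\<alpha>1 + (real M1 - 1) * \<beta>1) + ennreal (\<alpha>2 + (real M2 - 1) * \<beta>2)"
    by (intro add_mono expected_codebook_avg[OF G] M A1 B1 A2 B2 A1_le B1_le A2_le B2_le)
  also have "\<dots> = ennreal e" unfolding e_def using e by (rule ennreal_plus[symmetric])
  finally have le: "(\<integral>\<^sup>+u. \<integral>\<^sup>+v. J u v \<partial>?V \<partial>?U) \<le> ennreal e" .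
  have e0: "0 \<le> e" using e by (simp add: e_def)
  \<comment> \<open>Half of the slack \<open>\<eta>\<close> is spent on fixing the first codebook,
    the other half on the second.\<close>
  have "\<exists>u\<in>space ?U. (\<integral>\<^sup>+v. J u v \<partial>?V) \<le> ennreal (e + \<eta> / 2)"
    by (rule U.nn_integral_exists_le[OF le]) (use \<eta> e0 V.borel_measurable_nn_integral[OF mJ] in auto)
  then obtain u where u: "u \<in> space ?U" "(\<integral>\<^sup>+v. J u v \<partial>?V) \<le> ennreal (e + \<eta> / 2)" by blast
  have "\<exists>v\<in>space ?V. J u v \<le> ennreal (e + \<eta>)"
    by (rule V.nn_integral_exists_le[OF u(2)])
      (use \<eta> e0 measurable_compose[OF measurable_Pair1'[OF u(1)] mJ] in auto)
  then show ?thesis unfolding J_def e_def by blast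
qed

text \<open>If no index passes the threshold, \<open>LEAST\<close> yields an unspecified value; this
  can occur only when the sent word itself fails, an event that is counted as an error
  anyway.\<close>

definition threshold_decoder :: "nat \<Rightarrow> nat \<Rightarrow> real \<Rightarrow> (nat \<Rightarrow> real \<Rightarrow> real \<Rightarrow> real)
    \<Rightarrow> (nat \<Rightarrow> nat \<Rightarrow> real) \<Rightarrow> (nat \<Rightarrow> real) \<Rightarrow> nat" where
  "threshold_decoder M n \<gamma> i u y = (LEAST m. m \<in> {1..M} \<and> \<gamma> < (\<Sum>k<n. i k (u m k) (y k)))"

lemma threshold_decoder_measurable:
  assumes i: "\<And>k. k < n \<Longrightarrow> case_prod (i k) \<in> borel_measurable (borel \<Otimes>\<^sub>M borel)"
  shows "threshold_decoder M n \<gamma> i u \<in> measurable (PiM {..<n} (\<lambda>_. borel)) (count_space UNIV)"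
proof -
  have [measurable]: "(\<lambda>y. \<Sum>k<n. i k (u m k) (y k)) \<in> borel_measurable (PiM {..<n} (\<lambda>_. borel))" for m
  proof (rule borel_measurable_sum)
    fix k assume k: "k \<in> {..<n}"
    have "(\<lambda>y. i k (u m k) y) \<in> borel_measurable borel"
      using measurable_compose[OF measurable_Pair1' i[of k], of "u m k"] k by simp
    then show "(\<lambda>y. i k (u m k) (y k)) \<in> borel_measurable (PiM {..<n} (\<lambda>_. borel))"
      by (rule measurable_compose[OF measurable_component_singleton[OF k]])
  qed
  show ?thesis unfolding threshold_decoder_def[abs_def] by measurable
qed

lemma threshold_decoder_correct:
  assumes "m \<in> {1..M}" "\<gamma> < (\<Sum>k<n. i k (u m k) (y k))"
    and "\<And>l. l \<in> {1..M} - {m} \<Longrightarrow> (\<Sum>k<n. i k (u l k) (y k)) \<le> \<gamma>"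
  shows "threshold_decoder M n \<gamma> i u y = m"
  unfolding threshold_decoder_def
proof (rule Least_equality)
  fix l assume "l \<in> {1..M} \<and> \<gamma> < (\<Sum>k<n. i k (u l k) (y k))"
  then show "m \<le> l" using assms(3)[of l] by fastforce
qed (use assms in auto)

lemma prob_space_noise: "\<sigma> > 0 \<Longrightarrow> prob_space (noise \<sigma> n)"
  unfolding noise_def by (rule prob_space_PiM) (rule prob_space_normal_density)

text \<open>Indicators are replaced by exponentials: when the sent word fails, the product with
  factor \<open>- s\<close> is at least one, and when a competitor passes, the product with exponent
  one is. A codeword that differs from its letterwise image has \<open>bad \<ge> 1\<close>, which
  covers the trivial bound one on its error.\<close>

lemma err_prob_threshold_le:
  fixes i :: "nat \<Rightarrow> real \<Rightarrow> real \<Rightarrow> real" and f f' :: "nat \<Rightarrow> real \<Rightarrow> real"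
  assumes \<sigma>: "\<sigma> > 0" and s: "s > 0"
    and i: "\<And>k. k < n \<Longrightarrow> case_prod (i k) \<in> borel_measurable (borel \<Otimes>\<^sub>M borel)"
    and x: "\<And>m. 1 \<le> bad (u m) \<or> (\<forall>k<n. x m k = f k (u m k))"
    and x': "\<And>m. 1 \<le> bad' (v m) \<or> (\<forall>k<n. x' m k = f' k (v m k))"
  shows "ennreal (err_prob \<sigma> n h c M M' x x' (threshold_decoder M n (\<Sum>k<n. \<gamma> k) i u))
    \<le> codebook_avg M M'
        (\<lambda>a b. bad a + bad' b + (\<integral>\<^sup>+z. (\<Prod>k<n. ennreal (exp (- s * (i k (a k) (h * f k (a k) + c * f' k (b k) + z k) - \<gamma> k)))) \<partial>noise \<sigma> n))
        (\<lambda>l a b. \<integral>\<^sup>+z. (\<Prod>k<n. ennreal (exp (i k (l k) (h * f k (a k) + c * f' k (b k) + z k) - \<gamma> k))) \<partial>noise \<sigma> n)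
        u v"
proof -
  interpret prob_space "noise \<sigma> n" using \<sigma> by (rule prob_space_noise)
  let ?g = "threshold_decoder M n (\<Sum>k<n. \<gamma> k) i u"
  define E where "E = (\<lambda>m m'. {z \<in> space (noise \<sigma> n). ?g (\<lambda>k\<in>{..<n}. h * x m k + c * x' m' k + z k) \<noteq> m})"
  define \<alpha> where "\<alpha> = (\<lambda>a b z. \<Prod>k<n. ennreal (exp (- s * (i k (a k) (h * f k (a k) + c * f' k (b k) + z k) - \<gamma> k))))"
  define \<beta> where "\<beta> = (\<lambda>l a b z. \<Prod>k<n. ennreal (exp (i k (l k) (h * f k (a k) + c * f' k (b k) + z k) - \<gamma> k)))"
  have [measurable]: "(\<lambda>z. i k g (d + z k)) \<in> borel_measurable (noise \<sigma> n)" if "k < n" for k g d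
  proof -
    have "(\<lambda>y. i k g (d + y)) \<in> borel_measurable borel"
      using measurable_compose[OF measurable_compose[OF _ measurable_Pair1'] i[OF that], of "\<lambda>y. d + y" borel g] by simp
    moreover have "(\<lambda>z. z k) \<in> measurable (noise \<sigma> n) borel"
      unfolding noise_def using measurable_component_singleton[of k "{..<n}" "\<lambda>_. density lborel (normal_density 0 \<sigma>)"] that
      by simp
    ultimately show ?thesis by (rule measurable_compose[rotated])
  qed
  have m\<alpha>: "\<alpha> a b \<in> borel_measurable (noise \<sigma> n)" for a b
    unfolding \<alpha>_def by measurable
  have m\<beta>: "\<beta> l a b \<in> borel_measurable (noise \<sigma> n)" for l a b
    unfolding \<beta>_def by measurable
  have E_le: "emeasure (noise \<sigma> n) (E m m') \<le> bad (u m) + bad' (v m') + (\<integral>\<^sup>+z. \<alpha> (u m) (v m') z \<partial>noise \<sigma> n)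
      + (\<Sum>l\<in>{1..M}-{m}. \<integral>\<^sup>+z. \<beta> (u l) (u m) (v m') z \<partial>noise \<sigma> n)" (is "_ \<le> ?R") if m: "m \<in> {1..M}" for m m'
  \<comment> \<open>The third conjunct separates a degenerate case: outside the sigma-algebra
    \<open>emeasure\<close> is zero.\<close>
  proof (cases "(\<forall>k<n. x m k = f k (u m k)) \<and> (\<forall>k<n. x' m' k = f' k (v m' k)) \<and> E m m' \<in> events")
    case False
    then consider "1 \<le> bad (u m)" | "1 \<le> bad' (v m')" | "E m m' \<notin> events"
      using x[of m] x'[of m'] by blast
    then show ?thesis
    proof cases
      case 1
      have "emeasure (noise \<sigma> n) (E m m') \<le> 1" by (rule emeasure_le_1)
      also have "1 \<le> ?R" using 1 by (intro add_increasing2) auto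
      finally show ?thesis .
    next
      case 2
      have "emeasure (noise \<sigma> n) (E m m') \<le> 1" by (rule emeasure_le_1)
      also have "1 \<le> ?R"
        by (rule add_increasing2[OF _ add_increasing2[OF _ add_increasing[OF _ 2]]]) auto
      finally show ?thesis .
    qed (simp add: emeasure_notin_sets)
  next
    case True
    have "emeasure (noise \<sigma> n) (E m m') = (\<integral>\<^sup>+z. indicator (E m m') z \<partial>noise \<sigma> n)"
      using True by (intro nn_integral_indicator[symmetric]) auto
    also have "\<dots> \<le> (\<integral>\<^sup>+z. \<alpha> (u m) (v m') z + (\<Sum>l\<in>{1..M}-{m}. \<beta> (u l) (u m) (v m') z) \<partial>noise \<sigma> n)"
    proof (rule nn_integral_mono)
      fix z
      define y where "y = (\<lambda>k. h * f k (u m k) + c * f' k (v m' k) + z k)"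
      show "indicator (E m m') z \<le> \<alpha> (u m) (v m') z + (\<Sum>l\<in>{1..M}-{m}. \<beta> (u l) (u m) (v m') z)"
      proof (cases "z \<in> E m m'")
        case z: True
        have "(\<Sum>k<n. i k (u m k) (y k)) \<le> (\<Sum>k<n. \<gamma> k) \<or> (\<exists>l\<in>{1..M}-{m}. (\<Sum>k<n. \<gamma> k) < (\<Sum>k<n. i k (u l k) (y k)))"
        proof (rule ccontr)
          assume neg: "\<not> ?thesis"
          have y_eq: "(\<Sum>k<n. i k (u l k) ((\<lambda>k\<in>{..<n}. h * x m k + c * x' m' k + z k) k)) = (\<Sum>k<n. i k (u l k) (y k))" for l
            using True by (intro sum.cong) (auto simp: y_def)
          have "?g (\<lambda>k\<in>{..<n}. h * x m k + c * x' m' k + z k) = m"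
            by (rule threshold_decoder_correct[OF m]; unfold y_eq) (use neg in \<open>auto simp: not_le not_less\<close>)
          with z show False by (simp add: E_def)
        qed
        then show ?thesis
        proof
          assume "(\<Sum>k<n. i k (u m k) (y k)) \<le> (\<Sum>k<n. \<gamma> k)"
          then have "1 \<le> exp (\<Sum>k<n. - s * (i k (u m k) (y k) - \<gamma> k))"
            using s by (simp add: sum_distrib_left[symmetric] sum_subtractf mult_nonneg_nonpos sum_negf)
          also have "\<dots> = (\<Prod>k<n. exp (- s * (i k (u m k) (y k) - \<gamma> k)))" by (simp add: exp_sum)
          finally have "1 \<le> \<alpha> (u m) (v m') z"
            unfolding \<alpha>_def y_def by (simp add: prod_ennreal)
          then show ?thesis using z by (simp add: add_increasing2)
        next
          assume "\<exists>l\<in>{1..M}-{m}. (\<Sum>k<n. \<gamma> k) < (\<Sum>k<n. i k (u l k) (y k))"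
          then obtain l where l: "l \<in> {1..M}-{m}" "(\<Sum>k<n. \<gamma> k) < (\<Sum>k<n. i k (u l k) (y k))" by blast
          then have "1 \<le> exp (\<Sum>k<n. i k (u l k) (y k) - \<gamma> k)"
            by (simp add: sum_subtractf)
          also have "\<dots> = (\<Prod>k<n. exp (i k (u l k) (y k) - \<gamma> k))" by (simp add: exp_sum)
          finally have "1 \<le> \<beta> (u l) (u m) (v m') z"
            unfolding \<beta>_def y_def by (simp add: prod_ennreal)
          also have "\<dots> \<le> (\<Sum>l\<in>{1..M}-{m}. \<beta> (u l) (u m) (v m') z)"
            using l(1) by (intro member_le_sum) auto
          finally show ?thesis using z by (simp add: add_increasing)
        qed
      qed simp
    qed
    also have "\<dots> = (\<integral>\<^sup>+z. \<alpha> (u m) (v m') z \<partial>noise \<sigma> n) + (\<Sum>l\<in>{1..M}-{m}. \<integral>\<^sup>+z. \<beta> (u l) (u m) (v m') z \<partial>noise \<sigma> n)"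
      using m\<alpha> m\<beta> by (subst nn_integral_add) (auto simp: nn_integral_sum)
    also have "\<dots> \<le> ?R" by (simp add: add.assoc add_increasing)
    finally show ?thesis .
  qed
  have "ennreal (err_prob \<sigma> n h c M M' x x' ?g)
      = ennreal (1 / (real M * real M')) * (\<Sum>m\<in>{1..M}. \<Sum>m'\<in>{1..M'}. emeasure (noise \<sigma> n) (E m m'))"
    unfolding err_prob_def E_def emeasure_eq_measure
    by (subst sum_sum_ennreal) (simp_all add: ennreal_mult[symmetric] sum_nonneg)
  also have "\<dots> \<le> codebook_avg M M' (\<lambda>a b. bad a + bad' b + (\<integral>\<^sup>+z. \<alpha> a b z \<partial>noise \<sigma> n))
      (\<lambda>l a b. \<integral>\<^sup>+z. \<beta> l a b z \<partial>noise \<sigma> n) u v"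
    unfolding codebook_avg_def by (intro mult_left_mono sum_mono E_le) auto
  finally show ?thesis unfolding \<alpha>_def \<beta>_def .
qed

section \<open>Single-letter averages\<close>

lemma smear_add_nn_integral:
  assumes \<sigma>: "\<sigma> > 0" and f: "gauss_like \<sigma> f" and V: "V \<in> borel_measurable borel" "\<And>g. \<bar>V g\<bar> \<le> b"
    and F: "F \<in> borel_measurable borel"
  shows "(\<integral>\<^sup>+g. \<integral>\<^sup>+z. F (x + V g + z) \<partial>density lborel f \<partial>std_gauss)
    = (\<integral>\<^sup>+v. F (x + v) \<partial>density lborel (smear V f))"
proof -
  note [measurable] = F gauss_likeD(4)[OF gauss_like_smear[OF \<sigma> f V]]
  have "(\<integral>\<^sup>+g. \<integral>\<^sup>+z. F (x + (V g + z)) \<partial>density lborel f \<partial>std_gauss)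
    = (\<integral>\<^sup>+v. F (x + v) \<partial>density lborel (smear V f))"
    by (rule nn_integral_smear[OF f V(1), where F="\<lambda>v. F (x + v)"]) auto
  then show ?thesis by (simp add: add.assoc)
qed

lemma info_density_measurable:
  assumes \<sigma>: "\<sigma> > 0" and w: "gauss_like \<sigma> w" and X: "X \<in> borel_measurable borel" "\<And>g. \<bar>X g\<bar> \<le> b"
  shows "case_prod (info_density X w) \<in> borel_measurable (borel \<Otimes>\<^sub>M borel)"
proof -
  note [measurable] = X(1) gauss_likeD(4)[OF w] gauss_likeD(4)[OF gauss_like_smear[OF \<sigma> w X]]
  show ?thesis unfolding info_density_def by measurable
qed

text \<open>Change of measure for a competitor \<open>l\<close> independent of the output: the
  output density \<open>smear X w\<close> cancels the denominator of the exponentiated score,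
  leaving a translate of \<open>w\<close>, of mass one. Only the threshold factor survives.\<close>

lemma info_density_exp_moment:
  assumes \<sigma>: "\<sigma> > 0" and V: "V \<in> borel_measurable borel" "\<And>g. \<bar>V g\<bar> \<le> b'"
    and X: "X \<in> borel_measurable borel" "\<And>g. \<bar>X g\<bar> \<le> b"
  defines "w \<equiv> smear V (normal_density 0 \<sigma>)"
  shows "(\<integral>\<^sup>+l. \<integral>\<^sup>+a. \<integral>\<^sup>+c. \<integral>\<^sup>+z. ennreal (exp (info_density X w l (X a + V c + z) - \<gamma>))
      \<partial>density lborel (normal_density 0 \<sigma>) \<partial>std_gauss \<partial>std_gauss \<partial>std_gauss) = ennreal (exp (- \<gamma>))"
proof -
  interpret N: prob_space std_gauss by (rule prob_space_std_gauss)
  have n: "gauss_like \<sigma> (normal_density 0 \<sigma>)" using \<sigma> by (rule gauss_like_normal_density)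
  have w: "gauss_like \<sigma> w" unfolding w_def using \<sigma> n V by (rule gauss_like_smear)
  have q: "gauss_like \<sigma> (smear X w)" using \<sigma> w X by (rule gauss_like_smear)
  interpret W: prob_space "density lborel w" by (rule gauss_likeD(3)[OF w])
  note [measurable] = gauss_likeD(4)[OF w] gauss_likeD(4)[OF q] X(1)
  have "(\<integral>\<^sup>+a. \<integral>\<^sup>+c. \<integral>\<^sup>+z. ennreal (exp (info_density X w l (X a + V c + z) - \<gamma>))
      \<partial>density lborel (normal_density 0 \<sigma>) \<partial>std_gauss \<partial>std_gauss) = ennreal (exp (- \<gamma>))" for l
  proof -
    define F where "F = (\<lambda>y. ennreal (exp (info_density X w l y - \<gamma>)))"
    have F[measurable]: "F \<in> borel_measurable borel"
      unfolding F_def info_density_def by measurable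
    have "(\<integral>\<^sup>+a. \<integral>\<^sup>+c. \<integral>\<^sup>+z. F (X a + V c + z) \<partial>density lborel (normal_density 0 \<sigma>) \<partial>std_gauss \<partial>std_gauss)
        = (\<integral>\<^sup>+a. \<integral>\<^sup>+v. F (X a + v) \<partial>density lborel w \<partial>std_gauss)"
      unfolding w_def by (intro nn_integral_cong smear_add_nn_integral[OF \<sigma> n V F])
    also have "\<dots> = (\<integral>\<^sup>+y. F y \<partial>density lborel (smear X w))"
      by (rule nn_integral_smear[OF w]) auto
    also have "\<dots> = (\<integral>\<^sup>+y. ennreal (exp (- \<gamma>)) * ennreal (w (y - X l)) \<partial>lborel)"
    proof -
      have "ennreal (smear X w y) * F y = ennreal (exp (- \<gamma>)) * ennreal (w (y - X l))" for y
      proof -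
        have pos: "0 < w (y - X l)" "0 < smear X w y"
          by (rule gauss_likeD(2)[OF w] gauss_likeD(2)[OF q])+
        then have "exp (info_density X w l y - \<gamma>) = w (y - X l) / smear X w y * exp (- \<gamma>)"
          unfolding info_density_def diff_conv_add_uminus[of _ \<gamma>] exp_add exp_diff by simp
        with pos show ?thesis by (simp add: F_def ennreal_mult[symmetric])
      qed
      then show ?thesis by (simp add: nn_integral_density)
    qed
    also have "\<dots> = ennreal (exp (- \<gamma>)) * (\<integral>\<^sup>+y. ennreal (w (y - X l)) \<partial>lborel)"
      by (rule nn_integral_cmult) measurable
    also have "(\<integral>\<^sup>+y. ennreal (w (y - X l)) \<partial>lborel) = (\<integral>\<^sup>+y. ennreal (w y) \<partial>lborel)"
      by (subst nn_integral_real_affine[where c=1 and t="X l"]) auto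
    also have "\<dots> = 1" using W.emeasure_space_1 by (simp add: emeasure_density)
    finally show ?thesis by (simp add: F_def)
  qed
  then show ?thesis using N.emeasure_space_1 by simp
qed

text \<open>The score exceeds its threshold by \<open>2 * \<delta>\<close> on average, and the
  Chernoff bound keeps half of this. The moment condition comes from the linear growth of the
  score.\<close>

lemma info_density_chernoff:
  assumes \<sigma>: "\<sigma> > 0" and V: "V \<in> borel_measurable borel" "\<And>g. \<bar>V g\<bar> \<le> b'"
    and X: "X \<in> borel_measurable borel" "\<And>g. \<bar>X g\<bar> \<le> b" and \<delta>: "\<delta> > 0"
  defines "w \<equiv> smear V (normal_density 0 \<sigma>)"
  shows "\<forall>\<^sub>F s in at_right 0. (\<integral>\<^sup>+a. \<integral>\<^sup>+c. \<integral>\<^sup>+z. ennreal (exp (- s * (info_density X w a (X a + V c + z)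
      - (mutual_info X w - 2 * \<delta>)))) \<partial>density lborel (normal_density 0 \<sigma>) \<partial>std_gauss \<partial>std_gauss)
      \<le> ennreal (exp (- s * \<delta>))"
proof -
  have n: "gauss_like \<sigma> (normal_density 0 \<sigma>)" using \<sigma> by (rule gauss_like_normal_density)
  have w: "gauss_like \<sigma> w" unfolding w_def using \<sigma> n V by (rule gauss_like_smear)
  interpret NW: pair_prob_space std_gauss "density lborel w"
    by (rule pair_prob_space_gauss_like[OF w])
  define u where "u = (\<lambda>z. info_density X w (fst z) (X (fst z) + snd z) - (mutual_info X w - 2 * \<delta>))"
  have meas_i: "case_prod (info_density X w) \<in> borel_measurable (borel \<Otimes>\<^sub>M borel)"
    by (rule info_density_measurable[OF \<sigma> w X])
  have [measurable]: "(\<lambda>z. info_density X w (p z) (r z)) \<in> borel_measurable M"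
    if "p \<in> borel_measurable M" "r \<in> borel_measurable M" for p r :: "'a \<Rightarrow> real" and M
    using measurable_compose[OF measurable_Pair[OF that] meas_i] by simp
  note [measurable] = X(1) V(1)
  have mu[measurable]: "u \<in> borel_measurable (std_gauss \<Otimes>\<^sub>M density lborel w)"
    unfolding u_def by measurable
  obtain C where C: "C \<ge> 0" "\<forall>g v. \<bar>info_density X w g (X g + v)\<bar> \<le> C * (1 + \<bar>v\<bar>)"
    using info_density_bound[OF \<sigma> w X] by (elim exE conjE)
  define D where "D = 2 * (C + \<bar>mutual_info X w - 2 * \<delta>\<bar>)"
  have iexp: "integrable (std_gauss \<Otimes>\<^sub>M density lborel w) (\<lambda>z. exp (2 * \<bar>u z\<bar>))"
  proof (rule Bochner_Integration.integrable_bound)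
    show "integrable (std_gauss \<Otimes>\<^sub>M density lborel w) (\<lambda>z. exp D * exp ((2 * C) * \<bar>snd z\<bar>))"
      by (intro integrable_mult_right NW.integral_snd_coordinate gauss_like_exp_moment[OF \<sigma> w])
    have "2 * \<bar>u z\<bar> \<le> D + (2 * C) * \<bar>snd z\<bar>" for z
    proof -
      have "\<bar>u z\<bar> \<le> \<bar>info_density X w (fst z) (X (fst z) + snd z)\<bar> + \<bar>mutual_info X w - 2 * \<delta>\<bar>"
        unfolding u_def by (rule abs_triangle_ineq4)
      also have "\<dots> \<le> C * (1 + \<bar>snd z\<bar>) + \<bar>mutual_info X w - 2 * \<delta>\<bar>"
        using C(2) by simp
      finally show ?thesis unfolding D_def by (simp add: algebra_simps)
    qed
    then show "AE z in std_gauss \<Otimes>\<^sub>M density lborel w. norm (exp (2 * \<bar>u z\<bar>)) \<le> norm (exp D * exp ((2 * C) * \<bar>snd z\<bar>))"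
      by (intro AE_I2) (simp add: mult_exp_exp)
  qed measurable
  have ii: "integrable (std_gauss \<Otimes>\<^sub>M density lborel w) (\<lambda>z. info_density X w (fst z) (X (fst z) + snd z))"
  proof (rule Bochner_Integration.integrable_bound)
    show "integrable (std_gauss \<Otimes>\<^sub>M density lborel w) (\<lambda>z. C * exp (1 * \<bar>snd z\<bar>))"
      by (intro integrable_mult_right NW.integral_snd_coordinate gauss_like_exp_moment[OF \<sigma> w])
    have "\<bar>info_density X w g (X g + v)\<bar> \<le> C * exp \<bar>v\<bar>" for g v
      using order_trans[OF C(2)[rule_format] mult_left_mono[OF exp_ge_add_one_self C(1)]] by simp
    then show "AE z in std_gauss \<Otimes>\<^sub>M density lborel w. norm (info_density X w (fst z) (X (fst z) + snd z)) \<le> norm (C * exp (1 * \<bar>snd z\<bar>))"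
      using C(1) by (intro AE_I2) simp
  qed measurable
  have mean: "2 * \<delta> \<le> integral\<^sup>L (std_gauss \<Otimes>\<^sub>M density lborel w) u"
    unfolding u_def using ii NW.prob_space by (simp add: mutual_info_def)
  have eq: "(\<integral>\<^sup>+a. \<integral>\<^sup>+c. \<integral>\<^sup>+z. ennreal (exp (- s * (info_density X w a (X a + V c + z)
      - (mutual_info X w - 2 * \<delta>)))) \<partial>density lborel (normal_density 0 \<sigma>) \<partial>std_gauss \<partial>std_gauss)
      = (\<integral>\<^sup>+z. ennreal (exp (- s * u z)) \<partial>(std_gauss \<Otimes>\<^sub>M density lborel w))" for s
  proof -
    have "(\<integral>\<^sup>+c. \<integral>\<^sup>+z. ennreal (exp (- s * (info_density X w a (X a + V c + z)
      - (mutual_info X w - 2 * \<delta>)))) \<partial>density lborel (normal_density 0 \<sigma>) \<partial>std_gauss)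
      = (\<integral>\<^sup>+v. ennreal (exp (- s * u (a, v))) \<partial>density lborel w)" for a
      unfolding u_def fst_conv snd_conv
      using smear_add_nn_integral[OF \<sigma> n V, of "\<lambda>y. ennreal (exp (- s * (info_density X w a y
      - (mutual_info X w - 2 * \<delta>))))" "X a"] unfolding w_def[symmetric] by simp
    then show ?thesis
      by (simp add: NW.M2.nn_integral_fst[symmetric])
  qed
  have "\<forall>\<^sub>F s in at_right 0. (\<integral>\<^sup>+z. ennreal (exp (- s * u z)) \<partial>(std_gauss \<Otimes>\<^sub>M density lborel w)) \<le> ennreal (exp (- s * (2 * \<delta>) / 2))"
    by (rule NW.chernoff_eventually[OF mu iexp _ mean]) (use \<delta> in simp)
  then show ?thesis unfolding eq by simp
qed

text \<open>The same estimate for the distance of the input below its level, whose mean is again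
  \<open>2 * \<delta>\<close>. It controls codewords that exceed the average budget.\<close>

lemma input_chernoff:
  fixes f :: "real \<Rightarrow> real"
  assumes [measurable]: "f \<in> borel_measurable borel" and f: "\<And>g. 0 \<le> f g" "\<And>g. f g \<le> A" and \<delta>: "\<delta> > 0"
  shows "\<forall>\<^sub>F s in at_right 0. (\<integral>\<^sup>+g. ennreal (exp (s * (f g - (integral\<^sup>L std_gauss f + 2 * \<delta>)))) \<partial>std_gauss)
    \<le> ennreal (exp (- s * \<delta>))"
proof -
  interpret prob_space std_gauss by (rule prob_space_std_gauss)
  have i: "integrable std_gauss f" by (rule integrable_const_bound[of _ A]) (use f in auto)
  define u where "u = (\<lambda>g. (integral\<^sup>L std_gauss f + 2 * \<delta>) - f g)"
  have [measurable]: "u \<in> borel_measurable std_gauss" unfolding u_def by measurable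
  have "2 * \<bar>u g\<bar> \<le> 2 * (\<bar>integral\<^sup>L std_gauss f + 2 * \<delta>\<bar> + A)" for g
    using f[of g] abs_triangle_ineq4[of "integral\<^sup>L std_gauss f + 2 * \<delta>" "f g"] unfolding u_def by simp
  then have "integrable std_gauss (\<lambda>g. exp (2 * \<bar>u g\<bar>))"
    by (intro integrable_const_bound[of _ "exp (2 * (\<bar>integral\<^sup>L std_gauss f + 2 * \<delta>\<bar> + A))"] AE_I2) auto
  moreover have "2 * \<delta> \<le> expectation u"
    unfolding u_def using i prob_space by simp
  ultimately have "\<forall>\<^sub>F s in at_right 0. (\<integral>\<^sup>+g. ennreal (exp (- s * u g)) \<partial>std_gauss) \<le> ennreal (exp (- s * (2 * \<delta>) / 2))"
    using \<delta> by (intro chernoff_eventually) auto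
  moreover have "- s * u g = s * (f g - (integral\<^sup>L std_gauss f + 2 * \<delta>))" for s g
    by (simp add: u_def algebra_simps)
  ultimately show ?thesis by simp
qed

section \<open>Words of independent letters\<close>

abbreviation gauss_words :: "nat \<Rightarrow> (nat \<Rightarrow> real) measure" where
  "gauss_words n \<equiv> PiM {..<n} (\<lambda>_. std_gauss)"

lemma prob_space_gauss_words: "prob_space (gauss_words n)"
  by (rule prob_space_PiM) (rule prob_space_std_gauss)

lemma word_component: "k < n \<Longrightarrow> (\<lambda>a. a k) \<in> measurable (gauss_words n) borel"
  using measurable_component_singleton[of k "{..<n}" "\<lambda>_. std_gauss"] by simp

text \<open>Letters and noise are independent across positions, so the average of a product is the
  product of single-letter averages. \<open>K\<close> depends on the position because time sharing
  changes the input law along the block.\<close>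

lemma word_average2:
  fixes K :: "nat \<Rightarrow> real \<Rightarrow> real \<Rightarrow> real \<Rightarrow> ennreal"
  assumes \<sigma>: "\<sigma> > 0"
    and K: "\<And>k. k < n \<Longrightarrow> (\<lambda>(x, y, z). K k x y z) \<in> borel_measurable (borel \<Otimes>\<^sub>M (borel \<Otimes>\<^sub>M borel))"
  shows "case_prod (\<lambda>a b. \<integral>\<^sup>+z. (\<Prod>k<n. K k (a k) (b k) (z k)) \<partial>noise \<sigma> n) \<in> borel_measurable (gauss_words n \<Otimes>\<^sub>M gauss_words n)"
    and "(\<integral>\<^sup>+a. \<integral>\<^sup>+b. \<integral>\<^sup>+z. (\<Prod>k<n. K k (a k) (b k) (z k)) \<partial>noise \<sigma> n \<partial>gauss_words n \<partial>gauss_words n)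
      = (\<Prod>k<n. \<integral>\<^sup>+x. \<integral>\<^sup>+y. \<integral>\<^sup>+z. K k x y z \<partial>density lborel (normal_density 0 \<sigma>) \<partial>std_gauss \<partial>std_gauss)"
proof -
  let ?Z = "density lborel (normal_density 0 \<sigma>)"
  interpret Z: prob_space ?Z using \<sigma> by (rule prob_space_normal_density)
  interpret N: prob_space std_gauss by (rule prob_space_std_gauss)
  have K': "(\<lambda>z. K k (p z) (q z) (r z)) \<in> borel_measurable M"
    if "k < n" "p \<in> borel_measurable M" "q \<in> borel_measurable M" "r \<in> borel_measurable M"
    for k p q r and M :: "'c measure"
    using measurable_compose[OF measurable_Pair[OF that(2) measurable_Pair[OF that(3,4)]] K[OF that(1)]] by simp
  define H where "H = (\<lambda>k x y. \<integral>\<^sup>+z. K k x y z \<partial>?Z)"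
  have Hm: "case_prod (H k) \<in> borel_measurable (borel \<Otimes>\<^sub>M borel)" if "k < n" for k
    unfolding H_def case_prod_beta'
    by (rule Z.borel_measurable_nn_integral) (unfold case_prod_beta', rule K'[OF that]; measurable)
  have H': "(\<lambda>z. H k (p z) (q z)) \<in> borel_measurable M"
    if "k < n" "p \<in> borel_measurable M" "q \<in> borel_measurable M" for k p q and M :: "'c measure"
    using measurable_compose[OF measurable_Pair[OF that(2,3)] Hm[OF that(1)]] by simp
  have eq: "(\<integral>\<^sup>+z. (\<Prod>k<n. K k (a k) (b k) (z k)) \<partial>noise \<sigma> n) = (\<Prod>k<n. H k (a k) (b k))" for a b
    unfolding noise_def H_def
    by (rule nn_integral_PiM_prod) (auto intro!: K' Z.prob_space_axioms)
  show "case_prod (\<lambda>a b. \<integral>\<^sup>+z. (\<Prod>k<n. K k (a k) (b k) (z k)) \<partial>noise \<sigma> n) \<in> borel_measurable (gauss_words n \<Otimes>\<^sub>M gauss_words n)"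
    unfolding eq case_prod_beta'
    by (intro borel_measurable_prod_ennreal H' measurable_compose[OF measurable_fst word_component]
        measurable_compose[OF measurable_snd word_component]) auto
  have "(\<integral>\<^sup>+a. \<integral>\<^sup>+b. (\<Prod>k<n. H k (a k) (b k)) \<partial>gauss_words n \<partial>gauss_words n)
      = (\<integral>\<^sup>+a. (\<Prod>k<n. \<integral>\<^sup>+y. H k (a k) y \<partial>std_gauss) \<partial>gauss_words n)"
    by (intro nn_integral_cong nn_integral_PiM_prod) (auto intro!: H' N.prob_space_axioms)
  also have "\<dots> = (\<Prod>k<n. \<integral>\<^sup>+x. \<integral>\<^sup>+y. H k x y \<partial>std_gauss \<partial>std_gauss)"
    by (rule nn_integral_PiM_prod)
      (auto intro!: N.borel_measurable_nn_integral N.prob_space_axioms simp: case_prod_beta' intro!: H')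
  finally show "(\<integral>\<^sup>+a. \<integral>\<^sup>+b. \<integral>\<^sup>+z. (\<Prod>k<n. K k (a k) (b k) (z k)) \<partial>noise \<sigma> n \<partial>gauss_words n \<partial>gauss_words n)
      = (\<Prod>k<n. \<integral>\<^sup>+x. \<integral>\<^sup>+y. \<integral>\<^sup>+z. K k x y z \<partial>density lborel (normal_density 0 \<sigma>) \<partial>std_gauss \<partial>std_gauss)"
    unfolding eq by (simp add: H_def)
qed

lemma word_average3:
  fixes K :: "nat \<Rightarrow> real \<Rightarrow> real \<Rightarrow> real \<Rightarrow> real \<Rightarrow> ennreal"
  assumes \<sigma>: "\<sigma> > 0"
    and K: "\<And>k. k < n \<Longrightarrow> (\<lambda>(l, x, y, z). K k l x y z) \<in> borel_measurable (borel \<Otimes>\<^sub>M (borel \<Otimes>\<^sub>M (borel \<Otimes>\<^sub>M borel)))"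
  shows "(\<lambda>(l, a, b). \<integral>\<^sup>+z. (\<Prod>k<n. K k (l k) (a k) (b k) (z k)) \<partial>noise \<sigma> n)
      \<in> borel_measurable (gauss_words n \<Otimes>\<^sub>M (gauss_words n \<Otimes>\<^sub>M gauss_words n))"
    and "(\<integral>\<^sup>+l. \<integral>\<^sup>+a. \<integral>\<^sup>+b. \<integral>\<^sup>+z. (\<Prod>k<n. K k (l k) (a k) (b k) (z k)) \<partial>noise \<sigma> n \<partial>gauss_words n \<partial>gauss_words n \<partial>gauss_words n)
      = (\<Prod>k<n. \<integral>\<^sup>+l. \<integral>\<^sup>+x. \<integral>\<^sup>+y. \<integral>\<^sup>+z. K k l x y z \<partial>density lborel (normal_density 0 \<sigma>) \<partial>std_gauss \<partial>std_gauss \<partial>std_gauss)"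
proof -
  let ?Z = "density lborel (normal_density 0 \<sigma>)"
  interpret Z: prob_space ?Z using \<sigma> by (rule prob_space_normal_density)
  interpret N: prob_space std_gauss by (rule prob_space_std_gauss)
  have K': "(\<lambda>z. K k (m z) (p z) (q z) (r z)) \<in> borel_measurable M"
    if "k < n" "m \<in> borel_measurable M" "p \<in> borel_measurable M" "q \<in> borel_measurable M" "r \<in> borel_measurable M"
    for k m p q r and M :: "'c measure"
    using measurable_compose[OF measurable_Pair[OF that(2) measurable_Pair[OF that(3) measurable_Pair[OF that(4,5)]]] K[OF that(1)]]
    by simp
  define H where "H = (\<lambda>k l x y. \<integral>\<^sup>+z. K k l x y z \<partial>?Z)"
  have Hm: "(\<lambda>v. H k (fst v) (fst (snd v)) (snd (snd v))) \<in> borel_measurable (borel \<Otimes>\<^sub>M (borel \<Otimes>\<^sub>M borel))" if "k < n" for k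
    unfolding H_def
    by (rule Z.borel_measurable_nn_integral) (unfold case_prod_beta', rule K'[OF that]; measurable)
  have H': "(\<lambda>z. H k (m z) (p z) (q z)) \<in> borel_measurable M"
    if "k < n" "m \<in> borel_measurable M" "p \<in> borel_measurable M" "q \<in> borel_measurable M" for k m p q and M :: "'c measure"
    using measurable_compose[OF measurable_Pair[OF that(2) measurable_Pair[OF that(3,4)]] Hm[OF that(1)]] by simp
  define J where "J = (\<lambda>k l x. \<integral>\<^sup>+y. H k l x y \<partial>std_gauss)"
  have Jm: "(\<lambda>v. J k (fst v) (snd v)) \<in> borel_measurable (borel \<Otimes>\<^sub>M borel)" if "k < n" for k
    unfolding J_def
    by (rule N.borel_measurable_nn_integral) (unfold case_prod_beta', rule H'[OF that]; measurable)
  have J': "(\<lambda>z. J k (p z) (q z)) \<in> borel_measurable M"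
    if "k < n" "p \<in> borel_measurable M" "q \<in> borel_measurable M" for k p q and M :: "'c measure"
    using measurable_compose[OF measurable_Pair[OF that(2,3)] Jm[OF that(1)]] by simp
  have eq: "(\<integral>\<^sup>+z. (\<Prod>k<n. K k (l k) (a k) (b k) (z k)) \<partial>noise \<sigma> n) = (\<Prod>k<n. H k (l k) (a k) (b k))" for l a b
    unfolding noise_def H_def
    by (rule nn_integral_PiM_prod) (auto intro!: K' Z.prob_space_axioms)
  show "(\<lambda>(l, a, b). \<integral>\<^sup>+z. (\<Prod>k<n. K k (l k) (a k) (b k) (z k)) \<partial>noise \<sigma> n)
      \<in> borel_measurable (gauss_words n \<Otimes>\<^sub>M (gauss_words n \<Otimes>\<^sub>M gauss_words n))"
    unfolding eq case_prod_beta'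
    by (intro borel_measurable_prod_ennreal H' measurable_compose[OF measurable_fst word_component]
        measurable_compose[OF measurable_compose[OF measurable_snd measurable_fst] word_component]
        measurable_compose[OF measurable_compose[OF measurable_snd measurable_snd] word_component]) auto
  have "(\<integral>\<^sup>+l. \<integral>\<^sup>+a. \<integral>\<^sup>+b. (\<Prod>k<n. H k (l k) (a k) (b k)) \<partial>gauss_words n \<partial>gauss_words n \<partial>gauss_words n)
      = (\<integral>\<^sup>+l. \<integral>\<^sup>+a. (\<Prod>k<n. J k (l k) (a k)) \<partial>gauss_words n \<partial>gauss_words n)"
    unfolding J_def by (intro nn_integral_cong nn_integral_PiM_prod) (auto intro!: H' N.prob_space_axioms)
  also have "\<dots> = (\<integral>\<^sup>+l. (\<Prod>k<n. \<integral>\<^sup>+x. J k (l k) x \<partial>std_gauss) \<partial>gauss_words n)"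
    by (intro nn_integral_cong nn_integral_PiM_prod) (auto intro!: J' N.prob_space_axioms)
  also have "\<dots> = (\<Prod>k<n. \<integral>\<^sup>+l. \<integral>\<^sup>+x. J k l x \<partial>std_gauss \<partial>std_gauss)"
    by (rule nn_integral_PiM_prod)
      (auto intro!: N.borel_measurable_nn_integral N.prob_space_axioms simp: case_prod_beta' intro!: J')
  finally show "(\<integral>\<^sup>+l. \<integral>\<^sup>+a. \<integral>\<^sup>+b. \<integral>\<^sup>+z. (\<Prod>k<n. K k (l k) (a k) (b k) (z k)) \<partial>noise \<sigma> n \<partial>gauss_words n \<partial>gauss_words n \<partial>gauss_words n)
      = (\<Prod>k<n. \<integral>\<^sup>+l. \<integral>\<^sup>+x. \<integral>\<^sup>+y. \<integral>\<^sup>+z. K k l x y z \<partial>density lborel (normal_density 0 \<sigma>) \<partial>std_gauss \<partial>std_gauss \<partial>std_gauss)"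
    unfolding eq by (simp add: H_def J_def)
qed

section \<open>Single-letter quantities of one receiver\<close>

definition interference :: "real \<Rightarrow> real \<Rightarrow> (real \<Rightarrow> real) \<Rightarrow> real \<Rightarrow> real" where
  "interference \<sigma> c f' = smear (\<lambda>g. c * f' g) (normal_density 0 \<sigma>)"

definition user_rate :: "real \<Rightarrow> real \<Rightarrow> real \<Rightarrow> (real \<Rightarrow> real) \<Rightarrow> (real \<Rightarrow> real) \<Rightarrow> real" where
  "user_rate \<sigma> h c f f' = mutual_info (\<lambda>g. h * f g) (interference \<sigma> c f')"

definition letter_info :: "real \<Rightarrow> real \<Rightarrow> real \<Rightarrow> (real \<Rightarrow> real) \<Rightarrow> (real \<Rightarrow> real) \<Rightarrow> real \<Rightarrow> real \<Rightarrow> real" where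
  "letter_info \<sigma> h c f f' = info_density (\<lambda>g. h * f g) (interference \<sigma> c f')"

definition valid_input :: "real \<Rightarrow> (real \<Rightarrow> real) \<Rightarrow> bool" where
  "valid_input A f \<longleftrightarrow> f \<in> borel_measurable borel \<and> (\<forall>g. 0 \<le> f g \<and> f g \<le> A)"

text \<open>Records that \<open>s\<close> is small enough for both Chernoff bounds of an input pair,
  the one on the score and the one on the budget, so that one \<open>s\<close> can serve a whole
  block.\<close>

definition good_exponent :: "real \<Rightarrow> real \<Rightarrow> real \<Rightarrow> real \<Rightarrow> real \<Rightarrow> (real \<Rightarrow> real) \<Rightarrow> (real \<Rightarrow> real) \<Rightarrow> bool" where
  "good_exponent s \<delta> \<sigma> h c f f' \<longleftrightarrow>
    (\<integral>\<^sup>+a. \<integral>\<^sup>+b. \<integral>\<^sup>+z. ennreal (exp (- s * (letter_info \<sigma> h c f f' a (h * f a + c * f' b + z)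
        - (user_rate \<sigma> h c f f' - 2 * \<delta>)))) \<partial>density lborel (normal_density 0 \<sigma>) \<partial>std_gauss \<partial>std_gauss)
      \<le> ennreal (exp (- s * \<delta>)) \<and>
    (\<integral>\<^sup>+g. ennreal (exp (s * (f g - (integral\<^sup>L std_gauss f + 2 * \<delta>)))) \<partial>std_gauss) \<le> ennreal (exp (- s * \<delta>))"

lemma valid_input_scaled:
  assumes "valid_input A f" "c \<ge> 0"
  shows "(\<lambda>g. c * f g) \<in> borel_measurable borel" "\<bar>c * f g\<bar> \<le> c * A"
  using assms by (auto simp: valid_input_def abs_mult mult_left_mono)

lemma gauss_like_interference:
  assumes "\<sigma> > 0" "valid_input A f'" "c \<ge> 0"
  shows "gauss_like \<sigma> (interference \<sigma> c f')"
  unfolding interference_def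
  by (rule gauss_like_smear[OF assms(1) gauss_like_normal_density[OF assms(1)] valid_input_scaled[OF assms(2,3)]])

lemma letter_info_measurable:
  assumes "\<sigma> > 0" "valid_input A f" "valid_input A f'" "h \<ge> 0" "c \<ge> 0"
  shows "case_prod (letter_info \<sigma> h c f f') \<in> borel_measurable (borel \<Otimes>\<^sub>M borel)"
  unfolding letter_info_def
  by (rule info_density_measurable[OF assms(1) gauss_like_interference[OF assms(1,3,5)] valid_input_scaled[OF assms(2,4)]])

lemma eventually_good_exponent:
  assumes \<sigma>: "\<sigma> > 0" and f: "valid_input A f" and f': "valid_input A f'" and "h \<ge> 0" "c \<ge> 0" and \<delta>: "\<delta> > 0"
  shows "\<forall>\<^sub>F s in at_right 0. good_exponent s \<delta> \<sigma> h c f f'"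
  unfolding good_exponent_def letter_info_def user_rate_def interference_def
  using info_density_chernoff[OF \<sigma> valid_input_scaled[OF f' \<open>c \<ge> 0\<close>] valid_input_scaled[OF f \<open>h \<ge> 0\<close>] \<delta>]
    input_chernoff[of f A, OF _ _ _ \<delta>] f
  by (intro eventually_conj) (auto simp: valid_input_def)

text \<open>The factor 3 counts two budget violations and the failure of the sent word.
  Factorisation turns the per-letter estimates into powers, with \<open>good'\<close> supplying the
  budget estimate of the other user; for a competitor each letter contributes exactly
  \<open>exp (- \<gamma> k)\<close>.\<close>

lemma receiver_average:
  fixes f f' :: "nat \<Rightarrow> real \<Rightarrow> real"
  assumes \<sigma>: "\<sigma> > 0" and h: "h \<ge> 0" "c \<ge> 0"
    and f: "\<And>k. valid_input A (f k)" and f': "\<And>k. valid_input A (f' k)"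
    and s: "s > 0"
    and good: "\<forall>k<n. good_exponent s \<delta> \<sigma> h c (f k) (f' k)"
    and good': "\<forall>k<n. good_exponent s \<delta> \<sigma> h' c' (f' k) (f k)"
  defines "i \<equiv> \<lambda>k. letter_info \<sigma> h c (f k) (f' k)"
    and "\<gamma> \<equiv> \<lambda>k. user_rate \<sigma> h c (f k) (f' k) - 2 * \<delta>"
    and "bad \<equiv> \<lambda>a. \<Prod>k<n. ennreal (exp (s * (f k (a k) - (integral\<^sup>L std_gauss (f k) + 2 * \<delta>))))"
    and "bad' \<equiv> \<lambda>a. \<Prod>k<n. ennreal (exp (s * (f' k (a k) - (integral\<^sup>L std_gauss (f' k) + 2 * \<delta>))))"
  defines "Aw \<equiv> \<lambda>a b. bad a + bad' b + (\<integral>\<^sup>+z. (\<Prod>k<n. ennreal (exp (- s * (i k (a k) (h * f k (a k) + c * f' k (b k) + z k) - \<gamma> k)))) \<partial>noise \<sigma> n)"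
    and "Bw \<equiv> \<lambda>l a b. \<integral>\<^sup>+z. (\<Prod>k<n. ennreal (exp (i k (l k) (h * f k (a k) + c * f' k (b k) + z k) - \<gamma> k))) \<partial>noise \<sigma> n"
  shows "case_prod Aw \<in> borel_measurable (gauss_words n \<Otimes>\<^sub>M gauss_words n)"
    and "(\<lambda>(l, a, b). Bw l a b) \<in> borel_measurable (gauss_words n \<Otimes>\<^sub>M (gauss_words n \<Otimes>\<^sub>M gauss_words n))"
    and "(\<integral>\<^sup>+a. \<integral>\<^sup>+b. Aw a b \<partial>gauss_words n \<partial>gauss_words n) \<le> ennreal (3 * exp (- s * \<delta> * n))"
    and "(\<integral>\<^sup>+l. \<integral>\<^sup>+a. \<integral>\<^sup>+b. Bw l a b \<partial>gauss_words n \<partial>gauss_words n \<partial>gauss_words n) \<le> ennreal (exp (- (\<Sum>k<n. \<gamma> k)))"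
proof -
  interpret N: prob_space std_gauss by (rule prob_space_std_gauss)
  interpret G: prob_space "gauss_words n" by (rule prob_space_gauss_words)
  interpret GG: pair_prob_space "gauss_words n" "gauss_words n" ..
  have im[measurable]: "(\<lambda>v. i k (p v) (q v)) \<in> borel_measurable M"
    if "p \<in> borel_measurable M" "q \<in> borel_measurable M" for k p q and M :: "'c measure"
    unfolding i_def
    using measurable_compose[OF measurable_Pair[OF that] letter_info_measurable[OF \<sigma> f f' h, of k k]] by simp
  have [measurable]: "f k \<in> borel_measurable borel" "f' k \<in> borel_measurable borel" for k
    using f f' by (auto simp: valid_input_def)
  have KA: "(\<lambda>(x, y, z). ennreal (exp (- s * (i k x (h * f k x + c * f' k y + z) - \<gamma> k))))
      \<in> borel_measurable (borel \<Otimes>\<^sub>M (borel \<Otimes>\<^sub>M borel))" for k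
    unfolding case_prod_beta' by measurable
  have KB: "(\<lambda>(l, x, y, z). ennreal (exp (i k l (h * f k x + c * f' k y + z) - \<gamma> k)))
      \<in> borel_measurable (borel \<Otimes>\<^sub>M (borel \<Otimes>\<^sub>M (borel \<Otimes>\<^sub>M borel)))" for k
    unfolding case_prod_beta' by measurable
  note wA = word_average2[OF \<sigma> KA, of n] and wB = word_average3[OF \<sigma> KB, of n]
  have pow: "(\<Prod>k<n. ennreal (exp (- s * \<delta>))) = ennreal (exp (- s * \<delta> * n))"
    by (simp add: ennreal_power exp_of_nat_mult[symmetric] mult_ac)
  have bad_m[measurable]: "bad \<in> borel_measurable (gauss_words n)" "bad' \<in> borel_measurable (gauss_words n)"
    unfolding bad_def bad'_def
    by (intro borel_measurable_prod_ennreal measurable_compose[OF word_component]; simp)+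
  have bad_le: "(\<integral>\<^sup>+a. bad a \<partial>gauss_words n) \<le> ennreal (exp (- s * \<delta> * n))"
    "(\<integral>\<^sup>+a. bad' a \<partial>gauss_words n) \<le> ennreal (exp (- s * \<delta> * n))"
    unfolding bad_def bad'_def pow[symmetric]
    by (subst nn_integral_PiM_prod;
        (simp add: N.prob_space_axioms; fail | (rule prod_mono_ennreal, use good good' in \<open>auto simp: good_exponent_def\<close>)))+
  define \<alpha> where "\<alpha> = (\<lambda>a b. \<integral>\<^sup>+z. (\<Prod>k<n. ennreal (exp (- s * (i k (a k) (h * f k (a k) + c * f' k (b k) + z k) - \<gamma> k)))) \<partial>noise \<sigma> n)"
  have \<alpha>_m: "(\<lambda>v. \<alpha> (fst v) (snd v)) \<in> borel_measurable (gauss_words n \<Otimes>\<^sub>M gauss_words n)"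
    using wA(1) by (simp add: \<alpha>_def case_prod_beta')
  have \<alpha>_le: "(\<integral>\<^sup>+a. \<integral>\<^sup>+b. \<alpha> a b \<partial>gauss_words n \<partial>gauss_words n) \<le> ennreal (exp (- s * \<delta> * n))"
    unfolding \<alpha>_def wA(2) pow[symmetric]
    by (rule prod_mono_ennreal) (use good in \<open>auto simp: good_exponent_def i_def \<gamma>_def\<close>)
  have Aw: "Aw = (\<lambda>a b. bad a + bad' b + \<alpha> a b)" by (simp add: Aw_def \<alpha>_def)
  have b1: "(\<lambda>v. bad (fst v)) \<in> borel_measurable (gauss_words n \<Otimes>\<^sub>M gauss_words n)"
    "(\<lambda>v. bad' (snd v)) \<in> borel_measurable (gauss_words n \<Otimes>\<^sub>M gauss_words n)"
    by (intro measurable_compose[OF measurable_fst bad_m(1)] measurable_compose[OF measurable_snd bad_m(2)])+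
  show Awm: "case_prod Aw \<in> borel_measurable (gauss_words n \<Otimes>\<^sub>M gauss_words n)"
    unfolding Aw case_prod_beta' by (intro borel_measurable_add b1 \<alpha>_m)
  show "(\<lambda>(l, a, b). Bw l a b) \<in> borel_measurable (gauss_words n \<Otimes>\<^sub>M (gauss_words n \<Otimes>\<^sub>M gauss_words n))"
    unfolding Bw_def by (rule wB(1))
  have "(\<integral>\<^sup>+a. \<integral>\<^sup>+b. Aw a b \<partial>gauss_words n \<partial>gauss_words n)
      = (\<integral>\<^sup>+v. bad (fst v) + bad' (snd v) + \<alpha> (fst v) (snd v) \<partial>(gauss_words n \<Otimes>\<^sub>M gauss_words n))"
    using G.nn_integral_fst[OF Awm] by (simp add: Aw case_prod_beta')
  also have "\<dots> = (\<integral>\<^sup>+v. bad (fst v) \<partial>(gauss_words n \<Otimes>\<^sub>M gauss_words n))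
      + (\<integral>\<^sup>+v. bad' (snd v) \<partial>(gauss_words n \<Otimes>\<^sub>M gauss_words n))
      + (\<integral>\<^sup>+v. \<alpha> (fst v) (snd v) \<partial>(gauss_words n \<Otimes>\<^sub>M gauss_words n))"
    using b1 \<alpha>_m by (simp add: nn_integral_add)
  also have "(\<integral>\<^sup>+v. bad (fst v) \<partial>(gauss_words n \<Otimes>\<^sub>M gauss_words n)) = (\<integral>\<^sup>+a. bad a \<partial>gauss_words n)"
    using G.nn_integral_fst[OF b1(1)] G.emeasure_space_1 by simp
  also have "(\<integral>\<^sup>+v. bad' (snd v) \<partial>(gauss_words n \<Otimes>\<^sub>M gauss_words n)) = (\<integral>\<^sup>+a. bad' a \<partial>gauss_words n)"
    using G.nn_integral_fst[OF b1(2)] G.emeasure_space_1 by simp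
  also have "(\<integral>\<^sup>+v. \<alpha> (fst v) (snd v) \<partial>(gauss_words n \<Otimes>\<^sub>M gauss_words n)) = (\<integral>\<^sup>+a. \<integral>\<^sup>+b. \<alpha> a b \<partial>gauss_words n \<partial>gauss_words n)"
    using G.nn_integral_fst[OF \<alpha>_m] by simp
  also have "(\<integral>\<^sup>+a. bad a \<partial>gauss_words n) + (\<integral>\<^sup>+a. bad' a \<partial>gauss_words n) + (\<integral>\<^sup>+a. \<integral>\<^sup>+b. \<alpha> a b \<partial>gauss_words n \<partial>gauss_words n)
      \<le> ennreal (exp (- s * \<delta> * n)) + ennreal (exp (- s * \<delta> * n)) + ennreal (exp (- s * \<delta> * n))"
    by (intro add_mono bad_le \<alpha>_le)
  also have "\<dots> = ennreal (3 * exp (- s * \<delta> * n))"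
    by (simp add: ennreal_plus[symmetric] del: ennreal_plus)
  finally show "(\<integral>\<^sup>+a. \<integral>\<^sup>+b. Aw a b \<partial>gauss_words n \<partial>gauss_words n) \<le> ennreal (3 * exp (- s * \<delta> * n))" .
  have "(\<integral>\<^sup>+l. \<integral>\<^sup>+a. \<integral>\<^sup>+b. Bw l a b \<partial>gauss_words n \<partial>gauss_words n \<partial>gauss_words n) = (\<Prod>k<n. ennreal (exp (- \<gamma> k)))"
    unfolding Bw_def wB(2)
  proof (intro prod.cong refl)
    fix k
    show "(\<integral>\<^sup>+l. \<integral>\<^sup>+x. \<integral>\<^sup>+y. \<integral>\<^sup>+z. ennreal (exp (i k l (h * f k x + c * f' k y + z) - \<gamma> k))
        \<partial>density lborel (normal_density 0 \<sigma>) \<partial>std_gauss \<partial>std_gauss \<partial>std_gauss) = ennreal (exp (- \<gamma> k))"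
      unfolding i_def letter_info_def interference_def
      by (rule info_density_exp_moment[OF \<sigma> valid_input_scaled[OF f' h(2)] valid_input_scaled[OF f h(1)]])
  qed
  also have "\<dots> = ennreal (exp (- (\<Sum>k<n. \<gamma> k)))"
    by (simp add: prod_ennreal exp_sum[symmetric] sum_negf)
  finally show "(\<integral>\<^sup>+l. \<integral>\<^sup>+a. \<integral>\<^sup>+b. Bw l a b \<partial>gauss_words n \<partial>gauss_words n \<partial>gauss_words n) \<le> ennreal (exp (- (\<Sum>k<n. \<gamma> k)))"
    by simp
qed

text \<open>
  Codewords violating the average constraint are replaced by the zero codeword; this is absorbed
  in the terms \<open>bad\<close> and \<open>bad'\<close> of \<open>receiver_average\<close>.
\<close>

lemma one_shot_coding:
  fixes f1 f2 :: "nat \<Rightarrow> real \<Rightarrow> real"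
  assumes \<sigma>: "\<sigma> > 0" and h: "h11 \<ge> 0" "h12 \<ge> 0" "h21 \<ge> 0" "h22 \<ge> 0" and A: "A \<ge> 0"
    and \<alpha>: "\<alpha>1 \<ge> 0" "\<alpha>2 \<ge> 0" and M: "M1 \<ge> 1" "M2 \<ge> 1"
    and f1: "\<And>k. valid_input A (f1 k)" and f2: "\<And>k. valid_input A (f2 k)" and s: "s > 0"
    and good1: "\<forall>k<n. good_exponent s \<delta> \<sigma> h11 h21 (f1 k) (f2 k)"
    and good2: "\<forall>k<n. good_exponent s \<delta> \<sigma> h22 h12 (f2 k) (f1 k)"
    and mean1: "(\<Sum>k<n. integral\<^sup>L std_gauss (f1 k) + 2 * \<delta>) \<le> real n * (\<alpha>1 * A)"
    and mean2: "(\<Sum>k<n. integral\<^sup>L std_gauss (f2 k) + 2 * \<delta>) \<le> real n * (\<alpha>2 * A)"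
    and \<eta>: "\<eta> > 0"
  shows "\<exists>x1 x2 g1 g2. admissible_codebook A \<alpha>1 n M1 x1 \<and> admissible_codebook A \<alpha>2 n M2 x2
    \<and> g1 \<in> measurable (PiM {..<n} (\<lambda>_. borel)) (count_space UNIV)
    \<and> g2 \<in> measurable (PiM {..<n} (\<lambda>_. borel)) (count_space UNIV)
    \<and> err_prob \<sigma> n h11 h21 M1 M2 x1 x2 g1 + err_prob \<sigma> n h22 h12 M2 M1 x2 x1 g2
      \<le> 6 * exp (- s * \<delta> * n)
        + (real M1 - 1) * exp (- (\<Sum>k<n. user_rate \<sigma> h11 h21 (f1 k) (f2 k) - 2 * \<delta>))
        + (real M2 - 1) * exp (- (\<Sum>k<n. user_rate \<sigma> h22 h12 (f2 k) (f1 k) - 2 * \<delta>)) + \<eta>"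
proof -
  define clip where "clip = (\<lambda>\<alpha> (f :: nat \<Rightarrow> real \<Rightarrow> real) (u :: nat \<Rightarrow> nat \<Rightarrow> real) m k.
    if (\<Sum>k<n. f k (u m k)) \<le> real n * (\<alpha> * A) then f k (u m k) else 0)"
  have clip_adm: "admissible_codebook A \<alpha> n M (clip \<alpha> f u)"
    if "\<And>k. valid_input A (f k)" "\<alpha> \<ge> 0" for \<alpha> f u M
  proof -
    have "(\<Sum>k<n. clip \<alpha> f u m k) \<le> real n * (\<alpha> * A)" for m
      using that(2) A by (cases "(\<Sum>k<n. f k (u m k)) \<le> real n * (\<alpha> * A)") (simp_all add: clip_def)
    then show ?thesis using that(1) A by (auto simp: admissible_codebook_def clip_def valid_input_def)
  qed
  \<comment> \<open>The allowed total is at least the sum of the per-letter levels, so exceeding it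
    makes the sum of the exponents non-negative and the product at least one.\<close>
  have clip_bad: "1 \<le> (\<Prod>k<n. ennreal (exp (s * (f k (u m k) - (integral\<^sup>L std_gauss (f k) + 2 * \<delta>)))))
      \<or> (\<forall>k<n. clip \<alpha> f u m k = f k (u m k))"
    if "(\<Sum>k<n. integral\<^sup>L std_gauss (f k) + 2 * \<delta>) \<le> real n * (\<alpha> * A)" for \<alpha> f u m
  proof (cases "(\<Sum>k<n. f k (u m k)) \<le> real n * (\<alpha> * A)")
    case False
    then have "1 \<le> exp (\<Sum>k<n. s * (f k (u m k) - (integral\<^sup>L std_gauss (f k) + 2 * \<delta>)))"
      using that s by (simp add: sum_distrib_left[symmetric] sum_subtractf)
    also have "\<dots> = (\<Prod>k<n. exp (s * (f k (u m k) - (integral\<^sup>L std_gauss (f k) + 2 * \<delta>))))"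
      by (simp add: exp_sum)
    finally show ?thesis by (simp add: prod_ennreal)
  qed (simp add: clip_def)
  note av1 = receiver_average[where f=f1 and f'=f2, OF \<sigma> h(1,3) f1 f2 s good1 good2]
  note av2 = receiver_average[where f=f2 and f'=f1, OF \<sigma> h(4,2) f2 f1 s good2 good1]
  let ?\<gamma>1 = "\<lambda>k. user_rate \<sigma> h11 h21 (f1 k) (f2 k) - 2 * \<delta>"
  let ?\<gamma>2 = "\<lambda>k. user_rate \<sigma> h22 h12 (f2 k) (f1 k) - 2 * \<delta>"
  let ?i1 = "\<lambda>k. letter_info \<sigma> h11 h21 (f1 k) (f2 k)"
  let ?i2 = "\<lambda>k. letter_info \<sigma> h22 h12 (f2 k) (f1 k)"
  define e where "e = 3 * exp (- s * \<delta> * n) + (real M1 - 1) * exp (- sum ?\<gamma>1 {..<n})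
      + (3 * exp (- s * \<delta> * n) + (real M2 - 1) * exp (- sum ?\<gamma>2 {..<n})) + \<eta>"
  have e0: "0 \<le> e" unfolding e_def using M \<eta> by (intro add_nonneg_nonneg) auto
  have nn3: "0 \<le> 3 * exp (- s * \<delta> * n)" by simp
  from random_codebooks[OF prob_space_gauss_words M av1(1,2) av2(1,2) av1(3) nn3 av1(4) exp_ge_zero
      av2(3) nn3 av2(4) exp_ge_zero \<eta>]
  obtain u v where uv: "codebook_avg M1 M2
      (\<lambda>a b. (\<Prod>k<n. ennreal (exp (s * (f1 k (a k) - (integral\<^sup>L std_gauss (f1 k) + 2 * \<delta>)))))
        + (\<Prod>k<n. ennreal (exp (s * (f2 k (b k) - (integral\<^sup>L std_gauss (f2 k) + 2 * \<delta>)))))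
        + (\<integral>\<^sup>+z. (\<Prod>k<n. ennreal (exp (- s * (?i1 k (a k) (h11 * f1 k (a k) + h21 * f2 k (b k) + z k) - ?\<gamma>1 k)))) \<partial>noise \<sigma> n))
      (\<lambda>l a b. \<integral>\<^sup>+z. (\<Prod>k<n. ennreal (exp (?i1 k (l k) (h11 * f1 k (a k) + h21 * f2 k (b k) + z k) - ?\<gamma>1 k))) \<partial>noise \<sigma> n) u v
    + codebook_avg M2 M1
      (\<lambda>a b. (\<Prod>k<n. ennreal (exp (s * (f2 k (a k) - (integral\<^sup>L std_gauss (f2 k) + 2 * \<delta>)))))
        + (\<Prod>k<n. ennreal (exp (s * (f1 k (b k) - (integral\<^sup>L std_gauss (f1 k) + 2 * \<delta>)))))
        + (\<integral>\<^sup>+z. (\<Prod>k<n. ennreal (exp (- s * (?i2 k (a k) (h22 * f2 k (a k) + h12 * f1 k (b k) + z k) - ?\<gamma>2 k)))) \<partial>noise \<sigma> n))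
      (\<lambda>l a b. \<integral>\<^sup>+z. (\<Prod>k<n. ennreal (exp (?i2 k (l k) (h22 * f2 k (a k) + h12 * f1 k (b k) + z k) - ?\<gamma>2 k))) \<partial>noise \<sigma> n) v u
    \<le> ennreal e"
    unfolding e_def by (elim exE)
  define x1 where "x1 = clip \<alpha>1 f1 u"
  define x2 where "x2 = clip \<alpha>2 f2 v"
  \<comment> \<open>The decoders score the unclipped seeds. Where clipping changed the codeword the
    error bound is trivial, and elsewhere the sent word is the letterwise image of its
    seeds.\<close>
  define g1 where "g1 = threshold_decoder M1 n (sum ?\<gamma>1 {..<n}) ?i1 u"
  define g2 where "g2 = threshold_decoder M2 n (sum ?\<gamma>2 {..<n}) ?i2 v"
  have i1: "case_prod (?i1 k) \<in> borel_measurable (borel \<Otimes>\<^sub>M borel)" for k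
    by (rule letter_info_measurable[OF \<sigma> f1 f2 h(1,3)])
  have i2: "case_prod (?i2 k) \<in> borel_measurable (borel \<Otimes>\<^sub>M borel)" for k
    by (rule letter_info_measurable[OF \<sigma> f2 f1 h(4,2)])
  have e1: "ennreal (err_prob \<sigma> n h11 h21 M1 M2 x1 x2 g1) + ennreal (err_prob \<sigma> n h22 h12 M2 M1 x2 x1 g2) \<le> ennreal e"
    unfolding x1_def x2_def g1_def g2_def
    by (rule order_trans[OF add_mono uv]; rule err_prob_threshold_le[OF \<sigma> s])
      (use i1 i2 clip_bad[OF mean1] clip_bad[OF mean2] in auto)
  have nn: "0 \<le> err_prob \<sigma> n h c M M' x x' g" for h c M M' x x' g
    by (simp add: err_prob_def sum_nonneg)
  have "err_prob \<sigma> n h11 h21 M1 M2 x1 x2 g1 + err_prob \<sigma> n h22 h12 M2 M1 x2 x1 g2 \<le> e"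
    using e1 e0 nn by (simp add: ennreal_plus[symmetric] ennreal_le_iff del: ennreal_plus)
  then have "err_prob \<sigma> n h11 h21 M1 M2 x1 x2 g1 + err_prob \<sigma> n h22 h12 M2 M1 x2 x1 g2
      \<le> 6 * exp (- s * \<delta> * n) + (real M1 - 1) * exp (- sum ?\<gamma>1 {..<n})
        + (real M2 - 1) * exp (- sum ?\<gamma>2 {..<n}) + \<eta>"
    unfolding e_def by simp
  moreover have "admissible_codebook A \<alpha>1 n M1 x1" "admissible_codebook A \<alpha>2 n M2 x2"
    unfolding x1_def x2_def using clip_adm f1 f2 \<alpha> by auto
  moreover have "g1 \<in> measurable (PiM {..<n} (\<lambda>_. borel)) (count_space UNIV)"
    "g2 \<in> measurable (PiM {..<n} (\<lambda>_. borel)) (count_space UNIV)"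
    unfolding g1_def g2_def by (rule threshold_decoder_measurable[OF i1] threshold_decoder_measurable[OF i2])+
  ultimately show ?thesis by blast
qed

section \<open>Time sharing\<close>

lemma block_schedule:
  fixes m :: "'i \<Rightarrow> nat"
  assumes "finite S"
  shows "\<exists>\<tau>. (\<forall>k < sum m S. \<tau> k \<in> S) \<and> (\<forall>g :: 'i \<Rightarrow> real. (\<Sum>k < sum m S. g (\<tau> k)) = (\<Sum>t\<in>S. real (m t) * g t))"
  using assms
proof (induction S)
  case (insert t S)
  then obtain \<tau> where \<tau>: "\<forall>k < sum m S. \<tau> k \<in> S"
    "\<And>g :: 'i \<Rightarrow> real. (\<Sum>k < sum m S. g (\<tau> k)) = (\<Sum>t\<in>S. real (m t) * g t)" by blast
  define \<tau>' where "\<tau>' = (\<lambda>k. if k < sum m S then \<tau> k else t)"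
  have sum_eq: "sum m (insert t S) = sum m S + m t" using insert by simp
  have "(\<Sum>k < sum m S + m t. g (\<tau>' k)) = (\<Sum>t\<in>insert t S. real (m t) * g t)" for g :: "'i \<Rightarrow> real"
  proof -
    have "(\<Sum>k < sum m S + m t. g (\<tau>' k)) = (\<Sum>k < sum m S. g (\<tau>' k)) + (\<Sum>k\<in>{sum m S..<sum m S + m t}. g (\<tau>' k))"
      unfolding lessThan_atLeast0 by (rule sum.atLeastLessThan_concat[symmetric]) auto
    also have "(\<Sum>k < sum m S. g (\<tau>' k)) = (\<Sum>t\<in>S. real (m t) * g t)"
      unfolding \<tau>(2)[symmetric] by (intro sum.cong) (auto simp: \<tau>'_def)
    also have "(\<Sum>k\<in>{sum m S..<sum m S + m t}. g (\<tau>' k)) = (\<Sum>k\<in>{sum m S..<sum m S + m t}. g t)"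
      by (intro sum.cong) (auto simp: \<tau>'_def)
    finally show ?thesis using insert by simp
  qed
  moreover have "\<forall>k < sum m S + m t. \<tau>' k \<in> insert t S"
    using \<tau>(1) by (auto simp: \<tau>'_def)
  ultimately show ?case unfolding sum_eq by blast
qed simp

text \<open>Each \<open>t\<close> receives the integer part of \<open>n * wt t\<close> positions,
  and the at most \<open>card S\<close> remaining ones go to a fixed element. Every additive
  functional then deviates from its weighted mean by an amount bounded uniformly in
  \<open>n\<close>.\<close>

lemma schedule:
  fixes wt :: "'i \<Rightarrow> real"
  assumes S: "finite S" "S \<noteq> {}" and wt: "\<And>t. t \<in> S \<Longrightarrow> 0 \<le> wt t" "sum wt S = 1"
  shows "\<exists>\<tau>. (\<forall>n k. \<tau> n k \<in> S) \<and>
    (\<forall>g :: 'i \<Rightarrow> real. \<exists>C. \<forall>n. \<bar>(\<Sum>k<n. g (\<tau> n k)) - real n * (\<Sum>t\<in>S. wt t * g t)\<bar> \<le> C)"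
proof -
  obtain t0 where t0: "t0 \<in> S" using S by blast
  define m where "m = (\<lambda>n t. nat \<lfloor>real n * wt t\<rfloor>)"
  have m: "real (m n t) \<le> real n * wt t" "real n * wt t < real (m n t) + 1" if "t \<in> S" for n t
  proof -
    have "0 \<le> \<lfloor>real n * wt t\<rfloor>" using wt(1)[OF that] by simp
    then have "real (m n t) = of_int \<lfloor>real n * wt t\<rfloor>" by (simp add: m_def)
    then show "real (m n t) \<le> real n * wt t" "real n * wt t < real (m n t) + 1" by linarith+
  qed
  have N: "real (sum (m n) S) \<le> real n" "real n \<le> real (sum (m n) S) + real (card S)" for n
  proof -
    have "(\<Sum>t\<in>S. real (m n t)) \<le> (\<Sum>t\<in>S. real n * wt t)" using m by (intro sum_mono) auto
    moreover have "(\<Sum>t\<in>S. real n * wt t) \<le> (\<Sum>t\<in>S. real (m n t) + 1)" using m by (intro sum_mono) (auto intro: less_imp_le)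
    ultimately show "real (sum (m n) S) \<le> real n" "real n \<le> real (sum (m n) S) + real (card S)"
      using wt(2) by (simp_all add: sum_distrib_left[symmetric] sum.distrib)
  qed
  have "\<forall>n. \<exists>\<tau>. (\<forall>k < sum (m n) S. \<tau> k \<in> S) \<and> (\<forall>g :: 'i \<Rightarrow> real. (\<Sum>k < sum (m n) S. g (\<tau> k)) = (\<Sum>t\<in>S. real (m n t) * g t))"
    using block_schedule[OF S(1)] by blast
  then obtain \<tau>0 where \<tau>0: "\<And>n k. k < sum (m n) S \<Longrightarrow> \<tau>0 n k \<in> S"
    "\<And>n (g :: 'i \<Rightarrow> real). (\<Sum>k < sum (m n) S. g (\<tau>0 n k)) = (\<Sum>t\<in>S. real (m n t) * g t)" by metis
  define \<tau> where "\<tau> = (\<lambda>n k. if k < sum (m n) S then \<tau>0 n k else t0)"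
  have "\<bar>(\<Sum>k<n. g (\<tau> n k)) - real n * (\<Sum>t\<in>S. wt t * g t)\<bar> \<le> (\<Sum>t\<in>S. \<bar>g t\<bar>) + real (card S) * \<bar>g t0\<bar>"
    for g :: "'i \<Rightarrow> real" and n
  proof -
    have le: "sum (m n) S \<le> n" using N(1)[of n] by linarith
    have "(\<Sum>k<n. g (\<tau> n k)) = (\<Sum>k < sum (m n) S. g (\<tau> n k)) + (\<Sum>k\<in>{sum (m n) S..<n}. g (\<tau> n k))"
      unfolding lessThan_atLeast0 using le by (intro sum.atLeastLessThan_concat[symmetric]) auto
    also have "(\<Sum>k < sum (m n) S. g (\<tau> n k)) = (\<Sum>t\<in>S. real (m n t) * g t)"
      unfolding \<tau>0(2)[symmetric] by (intro sum.cong) (auto simp: \<tau>_def)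
    also have "(\<Sum>k\<in>{sum (m n) S..<n}. g (\<tau> n k)) = (real n - real (sum (m n) S)) * g t0"
      using le by (simp add: \<tau>_def of_nat_diff)
    finally have "(\<Sum>k<n. g (\<tau> n k)) - real n * (\<Sum>t\<in>S. wt t * g t)
        = (\<Sum>t\<in>S. (real (m n t) - real n * wt t) * g t) + (real n - real (sum (m n) S)) * g t0"
      by (simp add: sum_distrib_left sum_subtractf left_diff_distrib mult.assoc)
    also have "\<bar>\<dots>\<bar> \<le> \<bar>\<Sum>t\<in>S. (real (m n t) - real n * wt t) * g t\<bar> + \<bar>(real n - real (sum (m n) S)) * g t0\<bar>"
      by (rule abs_triangle_ineq)
    also have "\<bar>\<Sum>t\<in>S. (real (m n t) - real n * wt t) * g t\<bar> \<le> (\<Sum>t\<in>S. \<bar>g t\<bar>)"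
    proof (rule order_trans[OF sum_abs sum_mono])
      fix t assume t: "t \<in> S"
      have "\<bar>real (m n t) - real n * wt t\<bar> \<le> 1" using m[OF t, of n] by (simp add: abs_le_iff)
      then show "\<bar>(real (m n t) - real n * wt t) * g t\<bar> \<le> \<bar>g t\<bar>"
        by (simp add: abs_mult mult_left_le_one_le)
    qed
    also have "\<bar>(real n - real (sum (m n) S)) * g t0\<bar> \<le> real (card S) * \<bar>g t0\<bar>"
      unfolding abs_mult using N[of n] by (intro mult_right_mono) (simp_all add: abs_le_iff)
    finally show ?thesis by simp
  qed
  moreover have "\<forall>n k. \<tau> n k \<in> S" using \<tau>0(1) t0 by (simp add: \<tau>_def)
  ultimately show ?thesis by blast
qed

text \<open>The number of competitors is one less than the number of messages, which exactly undoes
  the rounding up.\<close>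

lemma num_msgs_bounds: "num_msgs n R \<ge> 1" "real (num_msgs n R) - 1 \<le> exp (real n * (R * ln 2))"
proof -
  have p: "0 < 2 powr (real n * R)" by simp
  then have c: "1 \<le> \<lceil>2 powr (real n * R)\<rceil>" by linarith
  then show "num_msgs n R \<ge> 1" unfolding num_msgs_def by linarith
  have "real (num_msgs n R) = of_int \<lceil>2 powr (real n * R)\<rceil>"
    using c by (simp add: num_msgs_def)
  then have "real (num_msgs n R) - 1 \<le> 2 powr (real n * R)" by linarith
  then show "real (num_msgs n R) - 1 \<le> exp (real n * (R * ln 2))"
    by (simp add: powr_def mult_ac)
qed

text \<open>Strictness leaves a margin of at least \<open>3 * \<delta>\<close>: the Chernoff levels
  take \<open>2 * \<delta>\<close> per letter, and the last \<open>\<delta>\<close> outweighs the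
  bounded rounding error of the schedule, giving exponential decay in the rates and feasibility in
  the means.\<close>

lemma time_sharing_achievable:
  fixes wt :: "'i \<Rightarrow> real" and F1 F2 :: "'i \<Rightarrow> real \<Rightarrow> real"
  assumes \<sigma>: "\<sigma> > 0" and h: "h11 \<ge> 0" "h12 \<ge> 0" "h21 \<ge> 0" "h22 \<ge> 0" and A: "A \<ge> 0"
    and \<alpha>: "\<alpha>1 \<ge> 0" "\<alpha>2 \<ge> 0"
    and S: "finite S" "S \<noteq> {}" and wt: "\<And>t. t \<in> S \<Longrightarrow> 0 \<le> wt t" "sum wt S = 1"
    and F1: "\<And>t. valid_input A (F1 t)" and F2: "\<And>t. valid_input A (F2 t)"
    and R1: "R1 * ln 2 < (\<Sum>t\<in>S. wt t * user_rate \<sigma> h11 h21 (F1 t) (F2 t))"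
    and R2: "R2 * ln 2 < (\<Sum>t\<in>S. wt t * user_rate \<sigma> h22 h12 (F2 t) (F1 t))"
    and m1: "(\<Sum>t\<in>S. wt t * integral\<^sup>L std_gauss (F1 t)) < \<alpha>1 * A"
    and m2: "(\<Sum>t\<in>S. wt t * integral\<^sup>L std_gauss (F2 t)) < \<alpha>2 * A"
  shows "achievable h11 h12 h21 h22 \<sigma> A \<alpha>1 \<alpha>2 (R1, R2)"
proof -
  obtain \<tau> where \<tau>: "\<And>n k. \<tau> n k \<in> S"
    "\<And>g :: 'i \<Rightarrow> real. \<exists>C. \<forall>n. \<bar>(\<Sum>k<n. g (\<tau> n k)) - real n * (\<Sum>t\<in>S. wt t * g t)\<bar> \<le> C"
    using schedule[OF S wt] by blast
  define I1 I2 where "I1 = (\<lambda>t. user_rate \<sigma> h11 h21 (F1 t) (F2 t))" and "I2 = (\<lambda>t. user_rate \<sigma> h22 h12 (F2 t) (F1 t))"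
  define E1 E2 where "E1 = (\<lambda>t. integral\<^sup>L std_gauss (F1 t))" and "E2 = (\<lambda>t. integral\<^sup>L std_gauss (F2 t))"
  define avg where "avg = (\<lambda>g :: 'i \<Rightarrow> real. \<Sum>t\<in>S. wt t * g t)"
  define \<delta> where "\<delta> = Min {avg I1 - R1 * ln 2, avg I2 - R2 * ln 2, \<alpha>1 * A - avg E1, \<alpha>2 * A - avg E2} / 4"
  have \<delta>: "\<delta> > 0"
    using R1 R2 m1 m2 by (simp add: \<delta>_def avg_def I1_def I2_def E1_def E2_def)
  have gaps: "R1 * ln 2 + 3 * \<delta> \<le> avg I1" "R2 * ln 2 + 3 * \<delta> \<le> avg I2" "avg E1 + 3 * \<delta> \<le> \<alpha>1 * A" "avg E2 + 3 * \<delta> \<le> \<alpha>2 * A"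
  proof -
    have "4 * \<delta> \<le> avg I1 - R1 * ln 2" "4 * \<delta> \<le> avg I2 - R2 * ln 2" "4 * \<delta> \<le> \<alpha>1 * A - avg E1" "4 * \<delta> \<le> \<alpha>2 * A - avg E2"
      by (simp_all add: \<delta>_def)
    with \<delta> show "R1 * ln 2 + 3 * \<delta> \<le> avg I1" "R2 * ln 2 + 3 * \<delta> \<le> avg I2" "avg E1 + 3 * \<delta> \<le> \<alpha>1 * A" "avg E2 + 3 * \<delta> \<le> \<alpha>2 * A"
      by linarith+
  qed
  \<comment> \<open>Only finitely many input pairs occur, so one exponent, independent of the block
    length, suits all of them.\<close>
  have "\<forall>\<^sub>F s in at_right 0. \<forall>t\<in>S. good_exponent s \<delta> \<sigma> h11 h21 (F1 t) (F2 t) \<and> good_exponent s \<delta> \<sigma> h22 h12 (F2 t) (F1 t)"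
    using S(1) by (intro eventually_ball_finite ballI eventually_conj 
        eventually_good_exponent[OF \<sigma> F1 F2 h(1,3) \<delta>] eventually_good_exponent[OF \<sigma> F2 F1 h(4,2) \<delta>])
  then have "\<forall>\<^sub>F s in at_right 0. 0 < s \<and> (\<forall>t\<in>S. good_exponent s \<delta> \<sigma> h11 h21 (F1 t) (F2 t) \<and> good_exponent s \<delta> \<sigma> h22 h12 (F2 t) (F1 t))"
    by (intro eventually_conj eventually_at_right_less)
  then have "\<exists>s>0. \<forall>t\<in>S. good_exponent s \<delta> \<sigma> h11 h21 (F1 t) (F2 t) \<and> good_exponent s \<delta> \<sigma> h22 h12 (F2 t) (F1 t)"
    by (rule eventually_happens'[rotated]) simp
  then obtain s where s: "s > 0"
    "\<And>t. t \<in> S \<Longrightarrow> good_exponent s \<delta> \<sigma> h11 h21 (F1 t) (F2 t)" "\<And>t. t \<in> S \<Longrightarrow> good_exponent s \<delta> \<sigma> h22 h12 (F2 t) (F1 t)"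
    by blast
  obtain C1 where C1: "\<And>n. \<bar>(\<Sum>k<n. I1 (\<tau> n k)) - real n * avg I1\<bar> \<le> C1" using \<tau>(2)[of I1] unfolding avg_def by blast
  obtain C2 where C2: "\<And>n. \<bar>(\<Sum>k<n. I2 (\<tau> n k)) - real n * avg I2\<bar> \<le> C2" using \<tau>(2)[of I2] unfolding avg_def by blast
  obtain C3 where C3: "\<And>n. \<bar>(\<Sum>k<n. E1 (\<tau> n k)) - real n * avg E1\<bar> \<le> C3" using \<tau>(2)[of E1] unfolding avg_def by blast
  obtain C4 where C4: "\<And>n. \<bar>(\<Sum>k<n. E2 (\<tau> n k)) - real n * avg E2\<bar> \<le> C4" using \<tau>(2)[of E2] unfolding avg_def by blast
  \<comment> \<open>From \<open>n0\<close> on, the rounding errors of the two means are at most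
    \<open>\<delta> * n\<close>. The rounding errors of the rates need no such start, since
    \<open>exp (C1 - \<delta> * n)\<close> tends to zero anyway.\<close>
  obtain n0 :: nat where n0: "C3 / \<delta> \<le> real n0" "C4 / \<delta> \<le> real n0"
    using real_arch_simple[of "max (C3 / \<delta>) (C4 / \<delta>)"] by auto
  define bound where "bound = (\<lambda>n. 6 * exp (- s * \<delta> * real n) + exp (C1 - \<delta> * real n) + exp (C2 - \<delta> * real n) + 1 / real (Suc n))"
  define ok where "ok = (\<lambda>n x1 x2 g1 g2. admissible_codebook A \<alpha>1 n (num_msgs n R1) x1
       \<and> admissible_codebook A \<alpha>2 n (num_msgs n R2) x2
       \<and> g1 \<in> measurable (PiM {..<n} (\<lambda>_. borel)) (count_space UNIV)
       \<and> g2 \<in> measurable (PiM {..<n} (\<lambda>_. borel)) (count_space UNIV)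
       \<and> (n0 \<le> n \<longrightarrow> err_prob \<sigma> n h11 h21 (num_msgs n R1) (num_msgs n R2) x1 x2 g1
          + err_prob \<sigma> n h22 h12 (num_msgs n R2) (num_msgs n R1) x2 x1 g2 \<le> bound n))"
  have "\<exists>x1 x2 g1 g2. ok n x1 x2 g1 g2" for n
  proof (cases "n0 \<le> n")
    case False
    \<comment> \<open>Admissible codebooks are demanded at every block length. Short blocks, where
      rounding could break the mean constraint, get the zero codebook, and no error bound is claimed
      for them.\<close>
    have "admissible_codebook A \<alpha> n M (\<lambda>_ _. 0)" if "\<alpha> \<ge> 0" for \<alpha> M
      using that A by (simp add: admissible_codebook_def)
    then show ?thesis
      using False \<alpha> by (intro exI[of _ "\<lambda>_ _. 0"] exI[of _ "\<lambda>_. 0"]) (auto simp: ok_def)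
  next
    case True
    have big: "C3 \<le> \<delta> * real n" "C4 \<le> \<delta> * real n"
    proof -
      have "C3 / \<delta> \<le> real n" "C4 / \<delta> \<le> real n" using n0 True by linarith+
      then show "C3 \<le> \<delta> * real n" "C4 \<le> \<delta> * real n" using \<delta> by (simp_all add: field_simps)
    qed
    have mean: "(\<Sum>k<n. E (\<tau> n k) + 2 * \<delta>) \<le> real n * a"
      if "\<bar>(\<Sum>k<n. E (\<tau> n k)) - real n * avg E\<bar> \<le> C" "C \<le> \<delta> * real n" "avg E + 3 * \<delta> \<le> a" for E a C
    proof -
      have "(\<Sum>k<n. E (\<tau> n k) + 2 * \<delta>) = (\<Sum>k<n. E (\<tau> n k)) + real n * (2 * \<delta>)" by (simp add: sum.distrib)
      also have "\<dots> \<le> real n * avg E + \<delta> * real n + real n * (2 * \<delta>)" using that(1,2) by (simp add: abs_le_iff)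
      also have "\<dots> = real n * (avg E + 3 * \<delta>)" by (simp add: algebra_simps)
      also have "\<dots> \<le> real n * a" using that(3) by (intro mult_left_mono) auto
      finally show ?thesis .
    qed
    have ex: "(real (num_msgs n R) - 1) * exp (- (\<Sum>k<n. I (\<tau> n k) - 2 * \<delta>)) \<le> exp (C - \<delta> * real n)"
      if "\<bar>(\<Sum>k<n. I (\<tau> n k)) - real n * avg I\<bar> \<le> C" "R * ln 2 + 3 * \<delta> \<le> avg I" for I R C
    proof -
      have "(real (num_msgs n R) - 1) * exp (- (\<Sum>k<n. I (\<tau> n k) - 2 * \<delta>))
          \<le> exp (real n * (R * ln 2)) * exp (- (\<Sum>k<n. I (\<tau> n k) - 2 * \<delta>))"
        by (intro mult_right_mono num_msgs_bounds) simp
      also have "\<dots> = exp (real n * (R * ln 2) - (\<Sum>k<n. I (\<tau> n k)) + real n * (2 * \<delta>))"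
        by (simp add: mult_exp_exp sum_subtractf)
      also have "\<dots> \<le> exp (C - \<delta> * real n)"
      proof -
        have "real n * (R * ln 2 + 3 * \<delta>) \<le> real n * avg I" using that(2) by (intro mult_left_mono) auto
        moreover have "real n * (R * ln 2 + 3 * \<delta>) = real n * (R * ln 2) + real n * (2 * \<delta>) + \<delta> * real n"
          by (simp add: algebra_simps)
        moreover have "real n * avg I - C \<le> (\<Sum>k<n. I (\<tau> n k))"
          using that(1) by (simp add: abs_le_iff)
        ultimately show ?thesis unfolding exp_le_cancel_iff by linarith
      qed
      finally show ?thesis .
    qed
    have "\<exists>x1 x2 g1 g2. admissible_codebook A \<alpha>1 n (num_msgs n R1) x1 \<and> admissible_codebook A \<alpha>2 n (num_msgs n R2) x2
      \<and> g1 \<in> measurable (PiM {..<n} (\<lambda>_. borel)) (count_space UNIV)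
      \<and> g2 \<in> measurable (PiM {..<n} (\<lambda>_. borel)) (count_space UNIV)
      \<and> err_prob \<sigma> n h11 h21 (num_msgs n R1) (num_msgs n R2) x1 x2 g1 + err_prob \<sigma> n h22 h12 (num_msgs n R2) (num_msgs n R1) x2 x1 g2
      \<le> 6 * exp (- s * \<delta> * n)
        + (real (num_msgs n R1) - 1) * exp (- (\<Sum>k<n. user_rate \<sigma> h11 h21 (F1 (\<tau> n k)) (F2 (\<tau> n k)) - 2 * \<delta>))
        + (real (num_msgs n R2) - 1) * exp (- (\<Sum>k<n. user_rate \<sigma> h22 h12 (F2 (\<tau> n k)) (F1 (\<tau> n k)) - 2 * \<delta>)) + 1 / real (Suc n)"
    proof (rule one_shot_coding[OF \<sigma> h A \<alpha> num_msgs_bounds(1) num_msgs_bounds(1) F1 F2 s(1)])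
      show "(\<Sum>k<n. integral\<^sup>L std_gauss (F1 (\<tau> n k)) + 2 * \<delta>) \<le> real n * (\<alpha>1 * A)"
        using mean[OF C3 big(1) gaps(3)] by (simp add: E1_def)
      show "(\<Sum>k<n. integral\<^sup>L std_gauss (F2 (\<tau> n k)) + 2 * \<delta>) \<le> real n * (\<alpha>2 * A)"
        using mean[OF C4 big(2) gaps(4)] by (simp add: E2_def)
    qed (use s \<tau>(1) in auto)
    then obtain x1 x2 g1 g2 where c: "admissible_codebook A \<alpha>1 n (num_msgs n R1) x1" "admissible_codebook A \<alpha>2 n (num_msgs n R2) x2"
      "g1 \<in> measurable (PiM {..<n} (\<lambda>_. borel)) (count_space UNIV)"
      "g2 \<in> measurable (PiM {..<n} (\<lambda>_. borel)) (count_space UNIV)"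
      "err_prob \<sigma> n h11 h21 (num_msgs n R1) (num_msgs n R2) x1 x2 g1 + err_prob \<sigma> n h22 h12 (num_msgs n R2) (num_msgs n R1) x2 x1 g2
      \<le> 6 * exp (- s * \<delta> * n)
        + (real (num_msgs n R1) - 1) * exp (- (\<Sum>k<n. I1 (\<tau> n k) - 2 * \<delta>))
        + (real (num_msgs n R2) - 1) * exp (- (\<Sum>k<n. I2 (\<tau> n k) - 2 * \<delta>)) + 1 / real (Suc n)"
      unfolding I1_def I2_def by (elim exE conjE)
    have "err_prob \<sigma> n h11 h21 (num_msgs n R1) (num_msgs n R2) x1 x2 g1 + err_prob \<sigma> n h22 h12 (num_msgs n R2) (num_msgs n R1) x2 x1 g2 \<le> bound n"
      using c(5) ex[OF C1 gaps(1)] ex[OF C2 gaps(2)] unfolding bound_def by linarith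
    with c(1-4) show ?thesis unfolding ok_def by blast
  qed
  then obtain x1 x2 g1 g2 where okn: "\<And>n. ok n (x1 n) (x2 n) (g1 n) (g2 n)" by metis
  have lim: "bound \<longlonglongrightarrow> 0"
  proof -
    have "bound \<longlonglongrightarrow> 6 * 0 + 0 + 0 + 0"
      unfolding bound_def
    proof (intro tendsto_add tendsto_mult tendsto_const)
      have e: "(\<lambda>n. exp (c - d * real n)) \<longlonglongrightarrow> 0" if "d > 0" for c d :: real
        using that by real_asymp
      show "(\<lambda>n. exp (- s * \<delta> * real n)) \<longlonglongrightarrow> 0" using e[of "s * \<delta>" 0] s \<delta> by simp
      show "(\<lambda>n. exp (C1 - \<delta> * real n)) \<longlonglongrightarrow> 0" "(\<lambda>n. exp (C2 - \<delta> * real n)) \<longlonglongrightarrow> 0"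
        using e \<delta> by auto
      show "(\<lambda>n. 1 / real (Suc n)) \<longlonglongrightarrow> 0" by real_asymp
    qed
    then show ?thesis by simp
  qed
  have nn: "0 \<le> err_prob \<sigma> n h c M M' x x' g" for n h c M M' x x' g
    by (simp add: err_prob_def sum_nonneg)
  have "(\<lambda>n. err_prob \<sigma> n h11 h21 (num_msgs n R1) (num_msgs n R2) (x1 n) (x2 n) (g1 n)) \<longlonglongrightarrow> 0"
  proof (rule tendsto_sandwich[OF _ _ tendsto_const lim])
    show "\<forall>\<^sub>F n in sequentially. err_prob \<sigma> n h11 h21 (num_msgs n R1) (num_msgs n R2) (x1 n) (x2 n) (g1 n) \<le> bound n"
      using eventually_ge_at_top[of n0]
    proof eventually_elim
      case (elim n)
      then show ?case using okn[of n] nn[of n h22 h12 "num_msgs n R2" "num_msgs n R1" "x2 n" "x1 n" "g2 n"] unfolding ok_def by linarith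
    qed
  qed (simp add: nn)
  moreover have "(\<lambda>n. err_prob \<sigma> n h22 h12 (num_msgs n R2) (num_msgs n R1) (x2 n) (x1 n) (g2 n)) \<longlonglongrightarrow> 0"
  proof (rule tendsto_sandwich[OF _ _ tendsto_const lim])
    show "\<forall>\<^sub>F n in sequentially. err_prob \<sigma> n h22 h12 (num_msgs n R2) (num_msgs n R1) (x2 n) (x1 n) (g2 n) \<le> bound n"
      using eventually_ge_at_top[of n0]
    proof eventually_elim
      case (elim n)
      then show ?case using okn[of n] nn[of n h11 h21 "num_msgs n R1" "num_msgs n R2" "x1 n" "x2 n" "g1 n"] unfolding ok_def by linarith
    qed
  qed (simp add: nn)
  ultimately show ?thesis
    unfolding achievable_def fst_conv snd_conv using okn unfolding ok_def by blast
qed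

section \<open>From points of the rate regions to the closure of achievable pairs\<close>

lemma TIN_point_inputs:
  fixes h11 h12 h21 h22 \<sigma> A \<alpha>1 \<alpha>2 :: real
  assumes h: "h11 \<ge> 0" "h12 \<ge> 0" "h21 \<ge> 0" "h22 \<ge> 0" and \<sigma>: "\<sigma> > 0"
    and \<kappa>: "\<kappa>1 \<in> {0..A}" "\<kappa>2 \<in> {0..A}" and \<theta>: "\<theta>1 \<in> {0<..1}" "\<theta>2 \<in> {0<..1}"
    and \<theta>\<kappa>: "\<theta>1 * \<kappa>1 \<le> \<alpha>1 * A" "\<theta>2 * \<kappa>2 \<le> \<alpha>2 * A"
    and p: "p \<in> R_TIN' h11 h12 h21 h22 \<sigma> \<kappa>1 \<kappa>2 \<theta>1 \<theta>2"
  shows "\<exists>F1 F2. valid_input A F1 \<and> valid_input A F2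
    \<and> integral\<^sup>L std_gauss F1 \<le> \<alpha>1 * A \<and> integral\<^sup>L std_gauss F2 \<le> \<alpha>2 * A
    \<and> fst p * ln 2 \<le> user_rate \<sigma> h11 h21 F1 F2 \<and> snd p * ln 2 \<le> user_rate \<sigma> h22 h12 F2 F1"
proof -
  from \<theta> have \<theta>pos: "0 < \<theta>1" "0 < \<theta>2" by auto
  obtain T1 T1' where T1: "\<And>x. (T1 has_real_derivative T1' x) (at x)" "\<And>x. 0 < T1' x"
    "T1' \<in> borel_measurable borel" "\<And>x. 0 \<le> T1 x" "\<And>x. T1 x \<le> 1"
    "integral\<^sup>L std_gauss T1 \<le> \<theta>1" "integrable std_gauss (\<lambda>x. ln (T1' x))"
    "integral\<^sup>L std_gauss (\<lambda>x. ln (T1' x)) = ln (rho \<theta>1) / 2" "rho \<theta>1 > 0"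
    using max_entropy_input[OF \<theta>pos(1)] by metis
  obtain T2 T2' where T2: "\<And>x. (T2 has_real_derivative T2' x) (at x)" "\<And>x. 0 < T2' x"
    "T2' \<in> borel_measurable borel" "\<And>x. 0 \<le> T2 x" "\<And>x. T2 x \<le> 1"
    "integral\<^sup>L std_gauss T2 \<le> \<theta>2" "integrable std_gauss (\<lambda>x. ln (T2' x))"
    "integral\<^sup>L std_gauss (\<lambda>x. ln (T2' x)) = ln (rho \<theta>2) / 2" "rho \<theta>2 > 0"
    using max_entropy_input[OF \<theta>pos(2)] by metis
  have [measurable]: "T1 \<in> borel_measurable borel" "T2 \<in> borel_measurable borel"
    by (intro borel_measurable_continuous_onI continuous_at_imp_continuous_on ballI
        DERIV_isCont[OF T1(1)] DERIV_isCont[OF T2(1)])+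
  \<comment> \<open>Scaling by the amplitude keeps the symbols in \<open>{0..A}\<close>, and the
    mean is at most \<open>\<theta>1 * \<kappa>1\<close> respectively
    \<open>\<theta>2 * \<kappa>2\<close>, which the region bounds by the average constraint.\<close>
  define F1 F2 where "F1 = (\<lambda>g. \<kappa>1 * T1 g)" and "F2 = (\<lambda>g. \<kappa>2 * T2 g)"
  have "\<kappa>1 * T1 g \<le> A" "\<kappa>2 * T2 g \<le> A" for g
    using \<kappa> mult_left_le[OF T1(5), of \<kappa>1 g] mult_left_le[OF T2(5), of \<kappa>2 g] by auto
  then have "valid_input A F1" "valid_input A F2"
    using \<kappa> T1(4) T2(4) by (auto simp: valid_input_def F1_def F2_def)
  moreover have "integral\<^sup>L std_gauss F1 \<le> \<alpha>1 * A" "integral\<^sup>L std_gauss F2 \<le> \<alpha>2 * A"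
    using \<theta>\<kappa> mult_left_mono[OF T1(6), of \<kappa>1] mult_left_mono[OF T2(6), of \<kappa>2] \<kappa>
    by (simp_all add: F1_def F2_def mult.commute)
  moreover have "ln 2 * Ffun \<sigma> 0 (h11 * \<kappa>1) (h21 * \<kappa>2) 1 \<theta>1 \<theta>2 \<le> user_rate \<sigma> h11 h21 F1 F2"
    using Ffun_le_mutual_info[OF \<sigma> _ _ \<theta>pos(2) T1(1-5,7-9) _ T2(4-6), of "h11 * \<kappa>1" "h21 * \<kappa>2"] \<kappa> h
    by (simp add: user_rate_def interference_def F1_def F2_def mult.assoc)
  moreover have "ln 2 * Ffun \<sigma> 0 (h22 * \<kappa>2) (h12 * \<kappa>1) 1 \<theta>2 \<theta>1 \<le> user_rate \<sigma> h22 h12 F2 F1"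
    using Ffun_le_mutual_info[OF \<sigma> _ _ \<theta>pos(1) T2(1-5,7-9) _ T1(4-6), of "h22 * \<kappa>2" "h12 * \<kappa>1"] \<kappa> h
    by (simp add: user_rate_def interference_def F1_def F2_def mult.assoc)
  moreover have "fst p * ln 2 \<le> ln 2 * Ffun \<sigma> 0 (h11 * \<kappa>1) (h21 * \<kappa>2) 1 \<theta>1 \<theta>2"
    "snd p * ln 2 \<le> ln 2 * Ffun \<sigma> 0 (h22 * \<kappa>2) (h12 * \<kappa>1) 1 \<theta>2 \<theta>1"
    using p by (auto simp: R_TIN'_def mult.commute)
  ultimately show ?thesis by (meson order_trans)
qed

theorem theorem1:
  fixes h11 h12 h21 h22 \<sigma> A \<alpha>1 \<alpha>2 :: real
  assumes "h11 \<ge> 0" "h12 \<ge> 0" "h21 \<ge> 0" "h22 \<ge> 0"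
    and "\<sigma> > 0" and "A > 0"
    and "\<alpha>1 \<in> {0<..1}" and "\<alpha>2 \<in> {0<..1}"
  shows "G_TIN' h11 h12 h21 h22 \<sigma> A \<alpha>1 \<alpha>2 \<subseteq> capacity_region h11 h12 h21 h22 \<sigma> A \<alpha>1 \<alpha>2"
proof
  fix r assume "r \<in> G_TIN' h11 h12 h21 h22 \<sigma> A \<alpha>1 \<alpha>2"
  then obtain P u where P: "finite P" "\<And>p. p \<in> P \<Longrightarrow> 0 \<le> u p" "sum u P = 1" "(\<Sum>p\<in>P. u p *\<^sub>R p) = r"
    and PR: "P \<subseteq> \<Union> {R_TIN' h11 h12 h21 h22 \<sigma> \<kappa>1 \<kappa>2 \<theta>1 \<theta>2 | \<kappa>1 \<kappa>2 \<theta>1 \<theta>2.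
        \<kappa>1 \<in> {0..A} \<and> \<kappa>2 \<in> {0..A} \<and> \<theta>1 \<in> {0<..1} \<and> \<theta>2 \<in> {0<..1}
        \<and> \<theta>1 * \<kappa>1 \<in> {0..\<alpha>1 * A} \<and> \<theta>2 * \<kappa>2 \<in> {0..\<alpha>2 * A}}"
    unfolding G_TIN'_def convex_hull_explicit by blast
  define Q where "Q = (\<lambda>p F1 F2. valid_input A F1 \<and> valid_input A F2
    \<and> integral\<^sup>L std_gauss F1 \<le> \<alpha>1 * A \<and> integral\<^sup>L std_gauss F2 \<le> \<alpha>2 * A
    \<and> fst p * ln 2 \<le> user_rate \<sigma> h11 h21 F1 F2 \<and> snd p * ln 2 \<le> user_rate \<sigma> h22 h12 F2 F1)"
  have "\<forall>p\<in>P. \<exists>F1 F2. Q p F1 F2"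
  proof
    fix p assume "p \<in> P"
    with PR obtain \<kappa>1 \<kappa>2 \<theta>1 \<theta>2 where "p \<in> R_TIN' h11 h12 h21 h22 \<sigma> \<kappa>1 \<kappa>2 \<theta>1 \<theta>2"
      "\<kappa>1 \<in> {0..A}" "\<kappa>2 \<in> {0..A}" "\<theta>1 \<in> {0<..1}" "\<theta>2 \<in> {0<..1}"
      "\<theta>1 * \<kappa>1 \<in> {0..\<alpha>1 * A}" "\<theta>2 * \<kappa>2 \<in> {0..\<alpha>2 * A}" by blast
    then show "\<exists>F1 F2. Q p F1 F2"
      unfolding Q_def by (intro TIN_point_inputs[OF assms(1-5), of \<kappa>1 A \<kappa>2 \<theta>1 \<theta>2]) auto
  qed
  then obtain T1 T2 where TQ: "\<And>p. p \<in> P \<Longrightarrow> Q p (T1 p) (T2 p)" by metis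
  have T: "valid_input A (T1 p)" "valid_input A (T2 p)"
    "integral\<^sup>L std_gauss (T1 p) \<le> \<alpha>1 * A" "integral\<^sup>L std_gauss (T2 p) \<le> \<alpha>2 * A"
    "fst p * ln 2 \<le> user_rate \<sigma> h11 h21 (T1 p) (T2 p)"
    "snd p * ln 2 \<le> user_rate \<sigma> h22 h12 (T2 p) (T1 p)" if "p \<in> P" for p
    using TQ[OF that] by (simp_all add: Q_def)
  have zero: "valid_input A (\<lambda>_. 0)" using assms(6) by (simp add: valid_input_def)
  \<comment> \<open>\<open>None\<close> is the idle slot with zero input. The default zero outside
    \<open>P\<close> makes validity hold for every \<open>t\<close>, as
    \<open>time_sharing_achievable\<close> asks.\<close>
  define F1 where "F1 = (\<lambda>t. case t of None \<Rightarrow> (\<lambda>_. 0) | Some p \<Rightarrow> if p \<in> P then T1 p else (\<lambda>_. 0))"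
  define F2 where "F2 = (\<lambda>t. case t of None \<Rightarrow> (\<lambda>_. 0) | Some p \<Rightarrow> if p \<in> P then T2 p else (\<lambda>_. 0))"
  have F: "valid_input A (F1 t)" "valid_input A (F2 t)" for t
    using T zero by (auto simp: F1_def F2_def split: option.split)
  define J1 J2 where "J1 = user_rate \<sigma> h11 h21 (\<lambda>_. 0) (\<lambda>_. 0)" and "J2 = user_rate \<sigma> h22 h12 (\<lambda>_. 0) (\<lambda>_. 0)"
  have split: "(\<Sum>t\<in>insert None (Some ` P). (case t of None \<Rightarrow> \<eta> | Some p \<Rightarrow> (1 - \<eta>) * u p) * g t)
      = \<eta> * g None + (1 - \<eta>) * (\<Sum>p\<in>P. u p * g (Some p))" for \<eta> and g :: "(real \<times> real) option \<Rightarrow> real"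
    using P(1) by (simp add: sum.reindex sum_distrib_left mult.assoc)
  have r: "fst r = (\<Sum>p\<in>P. u p * fst p)" "snd r = (\<Sum>p\<in>P. u p * snd p)"
    unfolding P(4)[symmetric] by (simp_all add: fst_sum snd_sum)
  show "r \<in> capacity_region h11 h12 h21 h22 \<sigma> A \<alpha>1 \<alpha>2"
    unfolding capacity_region_def closure_approachable
  proof (intro allI impI)
    fix e :: real assume e: "e > 0"
    \<comment> \<open>Both rates will be lowered by \<open>d\<close>, so the displacement is at most
      \<open>2 * d\<close>, which is below \<open>e\<close>.\<close>
    define d where "d = e / 4"
    \<comment> \<open>Moving a unit of time to the idle slot, whose rates are \<open>J1\<close> and
      \<open>J2\<close>, costs at most \<open>D\<close> relative to the target rates; the summand
      one keeps \<open>D\<close> positive. With the choice of \<open>\<eta>\<close> the loss is at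
      most half of \<open>d * ln 2\<close>.\<close>
    define D where "D = 1 + \<bar>fst r * ln 2 - J1\<bar> + \<bar>snd r * ln 2 - J2\<bar>"
    define \<eta> where "\<eta> = min (1 / 2) (d * ln 2 / (2 * D))"
    have d: "d > 0" using e by (simp add: d_def)
    have D: "D > 0" by (simp add: D_def add_pos_nonneg)
    have \<eta>: "0 < \<eta>" "\<eta> < 1" using d D by (auto simp: \<eta>_def)
    have \<eta>D: "\<eta> * D < d * ln 2"
    proof -
      have "\<eta> * D \<le> d * ln 2 / (2 * D) * D" using D by (intro mult_right_mono) (auto simp: \<eta>_def)
      also have "\<dots> = d * ln 2 / 2" using D by simp
      also have "\<dots> < d * ln 2" using d by simp
      finally show ?thesis .
    qed
    define w where "w = (\<lambda>t. case t of None \<Rightarrow> \<eta> | Some p \<Rightarrow> (1 - \<eta>) * u p)"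
    have gain: "(x - d) * ln 2 < \<eta> * J + (1 - \<eta>) * V"
      if "x * ln 2 \<le> V" "\<bar>x * ln 2 - J\<bar> \<le> D" for x J V
    proof -
      have "\<eta> * (x * ln 2 - J) \<le> \<eta> * D" using \<eta> that(2) by (intro mult_left_mono) auto
      then have "\<eta> * (x * ln 2 - J) < d * ln 2" using \<eta>D by simp
      moreover have "(1 - \<eta>) * (x * ln 2) \<le> (1 - \<eta>) * V" using \<eta> that(1) by (intro mult_left_mono) auto
      ultimately show ?thesis by (simp add: algebra_simps)
    qed
    \<comment> \<open>The lowered rates may be negative, for instance at points on the axes;
      \<open>num_msgs\<close> is then one, and \<open>achievable\<close> puts no sign condition on
      the pair.\<close>
    have "achievable h11 h12 h21 h22 \<sigma> A \<alpha>1 \<alpha>2 (fst r - d, snd r - d)"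
    proof (rule time_sharing_achievable[where S="insert None (Some ` P)" and wt=w and ?F1.0=F1 and ?F2.0=F2])
      show "sum w (insert None (Some ` P)) = 1"
        using split[of \<eta> "\<lambda>_. 1"] P(3) by (simp add: w_def)
      show "0 \<le> w t" if "t \<in> insert None (Some ` P)" for t
        using that \<eta> P(2) by (auto simp: w_def)
      have "fst r * ln 2 \<le> (\<Sum>p\<in>P. u p * user_rate \<sigma> h11 h21 (T1 p) (T2 p))"
        unfolding r sum_distrib_right mult.assoc using P(2) T(5) by (intro sum_mono mult_left_mono) auto
      then have "(fst r - d) * ln 2 < \<eta> * J1 + (1 - \<eta>) * (\<Sum>p\<in>P. u p * user_rate \<sigma> h11 h21 (T1 p) (T2 p))"
        by (rule gain) (simp add: D_def)
      also have "\<dots> = (\<Sum>t\<in>insert None (Some ` P). w t * user_rate \<sigma> h11 h21 (F1 t) (F2 t))"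
        unfolding w_def split by (simp add: F1_def F2_def J1_def)
      finally show "(fst r - d) * ln 2 < (\<Sum>t\<in>insert None (Some ` P). w t * user_rate \<sigma> h11 h21 (F1 t) (F2 t))" .
      have "snd r * ln 2 \<le> (\<Sum>p\<in>P. u p * user_rate \<sigma> h22 h12 (T2 p) (T1 p))"
        unfolding r sum_distrib_right mult.assoc using P(2) T(6) by (intro sum_mono mult_left_mono) auto
      then have "(snd r - d) * ln 2 < \<eta> * J2 + (1 - \<eta>) * (\<Sum>p\<in>P. u p * user_rate \<sigma> h22 h12 (T2 p) (T1 p))"
        by (rule gain) (simp add: D_def)
      also have "\<dots> = (\<Sum>t\<in>insert None (Some ` P). w t * user_rate \<sigma> h22 h12 (F2 t) (F1 t))"
        unfolding w_def split by (simp add: F1_def F2_def J2_def)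
      finally show "(snd r - d) * ln 2 < (\<Sum>t\<in>insert None (Some ` P). w t * user_rate \<sigma> h22 h12 (F2 t) (F1 t))" .
      \<comment> \<open>Idle positions use no power, so the mean shrinks by the factor
        \<open>1 - \<eta>\<close> and, as \<open>a * A\<close> is positive, the constraint becomes
        strict.\<close>
      have mean: "(1 - \<eta>) * (\<Sum>p\<in>P. u p * E p) < a * A"
        if "\<And>p. p \<in> P \<Longrightarrow> E p \<le> a * A" "a > 0" for E a
      proof -
        have "(\<Sum>p\<in>P. u p * E p) \<le> (\<Sum>p\<in>P. u p * (a * A))"
          using P(2) that(1) by (intro sum_mono mult_left_mono) auto
        also have "\<dots> = a * A" using P(3) by (simp add: sum_distrib_right[symmetric])
        finally have "(1 - \<eta>) * (\<Sum>p\<in>P. u p * E p) \<le> (1 - \<eta>) * (a * A)"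
          using \<eta> by (intro mult_left_mono) auto
        also have "\<dots> < 1 * (a * A)" using \<eta> that(2) assms(6) by (intro mult_strict_right_mono) auto
        finally show ?thesis by simp
      qed
      show "(\<Sum>t\<in>insert None (Some ` P). w t * integral\<^sup>L std_gauss (F1 t)) < \<alpha>1 * A"
        unfolding w_def split using mean[of "\<lambda>p. integral\<^sup>L std_gauss (T1 p)" \<alpha>1] T(3) assms(7)
        by (simp add: F1_def)
      show "(\<Sum>t\<in>insert None (Some ` P). w t * integral\<^sup>L std_gauss (F2 t)) < \<alpha>2 * A"
        unfolding w_def split using mean[of "\<lambda>p. integral\<^sup>L std_gauss (T2 p)" \<alpha>2] T(4) assms(8)
        by (simp add: F2_def)
    qed (use assms P(1) F in auto)
    moreover have "dist (fst r - d, snd r - d) r < e"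
    proof -
      have "dist (fst r - d, snd r - d) r = sqrt (d\<^sup>2 + d\<^sup>2)"
        by (cases r) (simp add: dist_Pair_Pair dist_real_def)
      also have "\<dots> \<le> d + d" using d by (intro sqrt_sum_squares_le_sum) auto
      also have "\<dots> < e" using e by (simp add: d_def)
      finally show ?thesis .
    qed
    ultimately show "\<exists>y\<in>{R. achievable h11 h12 h21 h22 \<sigma> A \<alpha>1 \<alpha>2 R}. dist y r < e" by blast
  qed
qed

end
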